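(* Let $(\mathcal U,\mathcal L)$ be a $\mathrm{FinSet}$-pair of degree $D$ on the spaces $(V_n)$, with embeddings $\varphi_{N,n}$ in $\mathcal U$ and $\psi_{N,n}$ in $\mathcal L$, let $(\Omega_n\subseteq V_n)$ be $\mathrm{FinSet}$-compatible, compact, semialgebraic and nonempty, and let $(p_n)\in\varprojlim_{\mathcal U}\mathbb R[V_n]_{\le d}^{\mathfrak S_n}$ be a freely-described polynomial of degree $d$. If $\mathcal U$ is a $\mathcal Z$-sequence, endow each $V_n$ with the norm $\|\cdot\|_1$ and assume that $R=\sup_n\sup_{x\in\Omega_n}\|x\|_1<\infty$. Consider the freely-described problems $u_n=\inf_{x\in\Omega_n}p_n(x)$ and their limiting optimal value $u_\infty=\inf_nu_n$. Then: (1) (Dual cost) For each $k\ge dD$ there exists $q_k\in\mathbb R[V_k]_{\le d}$ such that $$p_n(x)=\mathbb E[q_k(L_{k,n}x)]\quad\text{for all }x\in V_n\text{ and all }n.\qquad( * )$$ The corresponding freely-symmetrized element $(\mathrm{sym}_n^{\mathcal L}q_k)$ is unique, meaning that if $q_{k_1}$ and $q_{k_2}$ are two polynomials satisfying $( * )$ (with $k=k_1$ and $k=k_2$, where $k_1,k_2\ge dD$), then $\mathrm{sym}_n^{\mathcal L}q_{k_1}=\mathrm{sym}_n^{\mathcal L}q_{k_2}$ whenever $n\succeq_{\mathcal L}k_1,k_2$. For any $k\ge dD$ and any $q_k\in\mathbb R[V_k]_{\le d}$ satisfying $( * )$, we have $$u_\infty=\inf_{(\mu_n)\in\varprojlim_{\mathcal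 L}\mathcal P(\Omega_n)^{\mathfrak S_n}}\mathbb E_{\mu_k}q_k.$$ (2) (Freely-symmetrized bounds) Let $k\ge dD$, let $q_k\in\mathbb R[V_k]_{\le d}$ satisfy $( * )$, and consider $\ell_n=\inf_{x\in\Omega_n}\mathrm{sym}_n^{\mathcal L}q_k(x)$ for $k\preceq_{\mathcal L}n$. Then $\ell_n\le\ell_N\le u_\infty$ for all $k\preceq_{\mathcal L}n\preceq_{\mathcal L}N$, and denoting $\ell_\infty=\sup_n\ell_n$ (over $n\succeq_{\mathcal L}k$), we have $\ell_\infty=u_\infty$. (3) (Rate of convergence I) If $\mathcal U$ is a $\mathcal D$-sequence and $k\le n$, then $$u_n-\ell_n\le\frac{k(k-1)}{n}\|q_k\|_{\Omega_k},$$ where $\|q_k\|_{\Omega_k}=\sup_{x\in\Omega_k}|q_k(x)|$. (4) (Rate of convergence II) If $\mathcal U$ is a $\mathcal Z$-sequence, then for any $k\mid n$ $$u_n-\ell_n\le\frac{d(d+1)D(dD-1)}{n}\|q_k\|_c\max\{1,R\}^d,$$ where $\|q_k\|_c$ is the largest magnitude of a coefficient in $q_k$.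
   Context: Conventions. Dimension indices $n,m,k,N,M$ are positive integers; $[n]=\{1,\dots,n\}$; $n\mid N$ is divisibility; $\mathfrak S_n$ is the symmetric group on $[n]$. Vector spaces are finite-dimensional real inner product spaces and $A^\star$ is the adjoint of $A$. $\mathbb R^n$ has its standard basis and inner product, and $\mathfrak S_n$ acts by $(\sigma x)_i=x_{\sigma^{-1}(i)}$. $\mathbb R[V]_{\le d}$ is the space of polynomials on $V$ of degree at most $d$. Standard constructions. A standard construction $\mathcal F$ is built inductively from the identity construction using finitely many of the following operations, each producing spaces $\mathcal F(\mathbb R^n)$ and, for each linear $A:\mathbb R^n\to\mathbb R^m$, a linear map $\mathcal F(A):\mathcal F(\mathbb R^n)\to\mathcal F(\mathbb R^m)$: the product $\mathcal F_1\times\mathcal F_2$ (with $\mathcal F_1(A)\times\mathcal F_2(A)$); the tensor product $\mathcal F_1\otimes\mathcal F_2$ (with $\mathcal F_1(A)\otimes\mathcal F_2(A)$); the symmetric power $\mathrm{Sym}^k\mathcal F_1$, viewed as symmetric tensors (with $\mathcal F_1(A)^{\otimes k}$ restricted to symmetric tensors); and homogeneous degree-$k$ polynomials $\mathbb R[\mathcal F_1]_k$ over $\mathcal F_1(\mathbb R^n)$ (with $p\mapsto p\circ\mathcal F_1(A)^\star$); $\mathbb R[\mathcal F_1]_0=\mathbb R$ is trivial, and $\mathbb R[\mathcal F_1]_{\le k}=\mathbb R[\mathcal F_1]_0\times\cdots\times\mathbb R[\mathcal F_1]_k$. Degree: $\deg\mathrm{id}=1$, $\deg(\mathcal F_1\times\mathcal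 F_2)=\max\{\deg\mathcal F_1,\deg\mathcal F_2\}$, $\deg(\mathcal F_1\otimes\mathcal F_2)=\deg\mathcal F_1+\deg\mathcal F_2$, $\deg\mathrm{Sym}^k\mathcal F_1=\deg\mathbb R[\mathcal F_1]_k=k\deg\mathcal F_1$. Bases and inner products. If $(e_\alpha)_{\alpha\in\mathcal A}$, $(e_\beta)_{\beta\in\mathcal B}$ are the orthogonal bases of $W,U$: $W\times U$ has basis $(e_\alpha,0),(0,e_\beta)$ and the sum inner product; $W\otimes U$ has basis $e_\alpha\otimes e_\beta$ and the product inner product; $\mathrm{Sym}^kW$ has basis the orbit sums $E_{[\alpha_1,\dots,\alpha_k]}=\sum e_{\alpha_1'}\otimes\cdots\otimes e_{\alpha_k'}$ over distinct rearrangements $(\alpha_i')$ of $(\alpha_i)$, and the inner product making $E_{[\alpha_1,\dots,\alpha_k]}/\sqrt{\prod_i\langle e_{\alpha_i},e_{\alpha_i}\rangle}$ orthonormal; $\mathbb R[W]_k$ has basis the monomials $m_\mu(x)=\prod_\alpha\langle x,e_\alpha\rangle^{\mu_\alpha}$, $|\mu|=k$, and the Bombieri inner product making $m_\mu\big/\sqrt{\tfrac{\mu!}{k!}\prod_\alpha\langle e_\alpha,e_\alpha\rangle^{\mu_\alpha}}$ orthonormal. Let $(e_\alpha)_{\alpha\in\mathcal A_n}$ be the basis of $V_n=\mathcal F(\mathbb R^n)$ so constructed; $\|\cdot\|_1$ on $V_n$ is the $\ell_1$-norm of coordinates in this basis. Writing $x=\sum_\alpha x_\alpha e_\alpha\in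 V_k$ and $q_k(x)=\sum_Ic_I\prod_\alpha x_\alpha^{I_\alpha}$, $\|q_k\|_c=\max_I|c_I|$. Sequences. $\mathcal Z$ consists of $(\mathbb R^n)$ with zero-padding embeddings $\zeta_{N,n}(x)=(x,0_{N-n})$ for $n\le N$; $\mathcal D$ consists of $(\mathbb R^n)$ with duplication embeddings $\delta_{N,n}(x)=x\otimes\mathbf 1_{N/n}=(x_1,\dots,x_1,\dots,x_n,\dots,x_n)$ (each entry repeated $N/n$ times) for $n\mid N$. The $\mathcal Z$-sequence $\mathcal F(\mathcal Z)$ (index order $\le$) and the $\mathcal D$-sequence $\mathcal F(\mathcal D)$ (index order divisibility) are the spaces $V_n=\mathcal F(\mathbb R^n)$ with $\mathfrak S_n$-action $\mathcal F(\sigma)$ and embeddings $\mathcal F(\zeta_{N,n})$, resp. $\mathcal F(\delta_{N,n})$. A $\mathrm{FinSet}$-pair of degree $D$ is a pair $(\mathcal U,\mathcal L)$ equal to $(\mathcal F(\mathcal Z),\mathcal F(\mathcal D))$ or $(\mathcal F(\mathcal D),\mathcal F(\mathcal Z))$ for some standard construction $\mathcal F$ of degree $D$; $\preceq_{\mathcal U},\preceq_{\mathcal L}$ are the respective index orders. Sets $(\Omega_n\subseteq V_n)$ are $\mathrm{FinSet}$-compatible if each $\Omega_n$ is $\mathfrak S_n$-invariant, $\varphi_{N,n}\Omega_n\subseteq\Omega_N$ for $n\preceq_{\mathcal U}N$, and $\psi_{N,n}^\star\Omega_N\subseteq\Omega_n$ for $n\preceq_{\mathcal L}N$. De Finetti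 maps. For $f:[m]\to[n]$ let $\rho(f):\mathbb R^n\to\mathbb R^m$, $(\rho(f)x)_i=x_{f(i)}$, and also write $\rho(f)$ for $\mathcal F(\rho(f)):V_n\to V_m$. Let $F_{m,n}:[n]\to[m]$ be uniformly random. The random linear map $L_{m,n}:V_n\to V_m$ is $\rho(F_{n,m})$ if $(\mathcal U,\mathcal L)=(\mathcal F(\mathcal D),\mathcal F(\mathcal Z))$, and $\rho(F_{m,n})^\star$ if $(\mathcal U,\mathcal L)=(\mathcal F(\mathcal Z),\mathcal F(\mathcal D))$. Free objects. $\varprojlim_{\mathcal U}\mathbb R[V_n]_{\le d}^{\mathfrak S_n}$ is the set of sequences $(p_n)$ of $\mathfrak S_n$-invariant polynomials $p_n\in\mathbb R[V_n]_{\le d}$ with $p_N\circ\varphi_{N,n}=p_n$ for $n\preceq_{\mathcal U}N$. For $q\in\mathbb R[V_k]$ and $k\preceq_{\mathcal L}n$, $\mathrm{sym}_n^{\mathcal L}q(x)=\frac1{n!}\sum_{\sigma\in\mathfrak S_n}q(\psi_{n,k}^\star\sigma x)$. $\varprojlim_{\mathcal L}\mathcal P(\Omega_n)^{\mathfrak S_n}$ is the set of sequences $(\mu_n)$ of $\mathfrak S_n$-invariant Borel probability measures $\mu_n$ on $\Omega_n$ such that the pushforward of $\mu_N$ under $\psi_{N,n}^\star$ is $\mu_n$ for all $n\preceq_{\mathcal L}N$. *)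

theory Defs
  imports
    "HOL-Probability.Probability"
    "HOL-Library.Poly_Mapping"
    "HOL-Combinatorics.Multiset_Permutations"
begin

text \<open>
  The space \<open>\<F>(\<real>\<^sup>n)\<close> is represented by coordinate vectors with respect to its
  orthogonal basis \<open>(e\<^sub>\<alpha>)\<close>, and linear maps by their matrices. The standard basis of
  \<open>\<real>\<^sup>n\<close> is numbered \<open>0, \<dots>, n - 1\<close>. The space \<open>\<real>[\<F>]\<^sub>\<le>\<^sub>k\<close> is the iterated
  product of \<open>HomPoly 0 \<F>, \<dots>, HomPoly k \<F>\<close>.
\<close>

datatype construction =
    Ident
  | Product construction construction
  | Tensor construction construction
  | SymPow nat construction
  | HomPoly nat construction

primrec deg :: "construction \<Rightarrow> nat" where
  "deg Ident = 1"
| "deg (Product F G) = max (deg F) (deg G)"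
| "deg (Tensor F G) = deg F + deg G"
| "deg (SymPow k F) = k * deg F"
| "deg (HomPoly k F) = k * deg F"

text \<open>
  \<open>IMset M\<close> labels the orbit sum \<open>E\<^bsub>[\<alpha>\<^sub>1,\<dots>,\<alpha>\<^sub>k]\<^esub>\<close> of a symmetric power and the
  monomial \<open>m\<^sub>\<mu>\<close> of a polynomial space, \<open>M\<close> being the multiset of the \<open>\<alpha>\<^sub>i\<close> resp. the
  multiset with multiplicities \<open>\<mu>\<^sub>\<alpha>\<close>.
\<close>

datatype idx =
    ICoord nat
  | ILeft idx
  | IRight idx
  | IPair idx idx
  | IMset "idx multiset"

type_synonym coord_vec = "idx \<Rightarrow> real"
type_synonym coord_mat = "idx \<Rightarrow> idx \<Rightarrow> real"
type_synonym coord_poly = "idx multiset \<Rightarrow>\<^sub>0 real"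

definition msets_of_size :: "nat \<Rightarrow> 'a set \<Rightarrow> 'a multiset set" where
  "msets_of_size k A = {M. size M = k \<and> set_mset M \<subseteq> A}"

primrec basis :: "construction \<Rightarrow> nat \<Rightarrow> idx set" where
  "basis Ident n = ICoord ` {..<n}"
| "basis (Product F G) n = ILeft ` basis F n \<union> IRight ` basis G n"
| "basis (Tensor F G) n = (\<lambda>(a, b). IPair a b) ` (basis F n \<times> basis G n)"
| "basis (SymPow k F) n = IMset ` msets_of_size k (basis F n)"
| "basis (HomPoly k F) n = IMset ` msets_of_size k (basis F n)"

definition space_of :: "construction \<Rightarrow> nat \<Rightarrow> coord_vec set" where
  "space_of F n = {x. \<forall>a. a \<notin> basis F n \<longrightarrow> x a = 0}"

text \<open>The squared norms \<open>\<langle>e\<^sub>\<alpha>, e\<^sub>\<alpha>\<rangle>\<close>; values at labels that are no basis labels are irrelevant.\<close>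

primrec gram :: "construction \<Rightarrow> idx \<Rightarrow> real" where
  "gram Ident a = 1"
| "gram (Product F G) a = (case a of ILeft b \<Rightarrow> gram F b | IRight b \<Rightarrow> gram G b | _ \<Rightarrow> 0)"
| "gram (Tensor F G) a = (case a of IPair b c \<Rightarrow> gram F b * gram G c | _ \<Rightarrow> 0)"
| "gram (SymPow k F) a = (case a of IMset M \<Rightarrow> (\<Prod>b\<in>#M. gram F b) | _ \<Rightarrow> 0)"
| "gram (HomPoly k F) a =
     (case a of IMset M \<Rightarrow>
        (\<Prod>b\<in>set_mset M. fact (count M b)) / fact k * (\<Prod>b\<in>#M. gram F b)
      | _ \<Rightarrow> 0)"

definition ip :: "construction \<Rightarrow> nat \<Rightarrow> coord_vec \<Rightarrow> coord_vec \<Rightarrow> real" where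
  "ip F n x y = (\<Sum>a\<in>basis F n. gram F a * x a * y a)"

definition norm1 :: "construction \<Rightarrow> nat \<Rightarrow> coord_vec \<Rightarrow> real" where
  "norm1 F n x = (\<Sum>a\<in>basis F n. \<bar>x a\<bar>)"

text \<open>
  Let \<open>B\<close> be a matrix acting on \<open>W\<close>. In the basis of orbit sums, the entry of \<open>B\<^sup>\<otimes>\<^sup>k\<close> at
  \<open>(N, M)\<close> is the coefficient of \<open>e\<^bsub>b\<^sub>1\<^esub> \<otimes> \<dots> \<otimes> e\<^bsub>b\<^sub>k\<^esub>\<close> in
  \<open>B\<^sup>\<otimes>\<^sup>k E\<^sub>M\<close>, for any enumeration \<open>b\<close> of \<open>N\<close>.
\<close>

definition sym_matr :: "coord_mat \<Rightarrow> idx multiset \<Rightarrow> idx multiset \<Rightarrow> real" where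
  "sym_matr B N M =
     (\<Sum>as\<in>permutations_of_multiset M. prod_list (map2 B (SOME bs. mset bs = N) as))"

text \<open>
  \<open>m\<^sub>M(B\<^sup>* x) = \<Prod>\<^bsub>a\<in>M\<^esub> \<langle>x, B e\<^sub>a\<rangle> = \<Prod>\<^bsub>a\<in>M\<^esub> \<Sum>\<^sub>b B\<^bsub>b a\<^esub> \<langle>x, e\<^sub>b\<rangle>\<close>;
  the entry at \<open>(N, M)\<close> of \<open>p \<mapsto> p \<circ> B\<^sup>*\<close> is the coefficient of \<open>m\<^sub>N\<close> herein.
  The set \<open>Y\<close> contains the basis labels of the target of \<open>B\<close>.
\<close>

definition pullback_matr :: "idx set \<Rightarrow> coord_mat \<Rightarrow> idx multiset \<Rightarrow> idx multiset \<Rightarrow> real" where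
  "pullback_matr Y B N M =
     Poly_Mapping.lookup (\<Prod>a\<in>#M. \<Sum>b\<in>Y. Poly_Mapping.single {#b#} (B b a)) N"

text \<open>The matrix of \<open>\<F>(A) : \<F>(\<real>\<^sup>n) \<rightarrow> \<F>(\<real>\<^sup>m)\<close>, where \<open>A i j\<close> is the entry of \<open>A\<close> in row \<open>i\<close>, column \<open>j\<close>.\<close>

primrec fmatr :: "construction \<Rightarrow> nat \<Rightarrow> (nat \<Rightarrow> nat \<Rightarrow> real) \<Rightarrow> coord_mat" where
  "fmatr Ident m A b a = (case (b, a) of (ICoord i, ICoord j) \<Rightarrow> A i j | _ \<Rightarrow> 0)"
| "fmatr (Product F G) m A b a =
     (case (b, a) of
        (ILeft b', ILeft a') \<Rightarrow> fmatr F m A b' a'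
      | (IRight b', IRight a') \<Rightarrow> fmatr G m A b' a'
      | _ \<Rightarrow> 0)"
| "fmatr (Tensor F G) m A b a =
     (case (b, a) of
        (IPair b1 b2, IPair a1 a2) \<Rightarrow> fmatr F m A b1 a1 * fmatr G m A b2 a2
      | _ \<Rightarrow> 0)"
| "fmatr (SymPow k F) m A b a =
     (case (b, a) of (IMset N, IMset M) \<Rightarrow> sym_matr (fmatr F m A) N M | _ \<Rightarrow> 0)"
| "fmatr (HomPoly k F) m A b a =
     (case (b, a) of (IMset N, IMset M) \<Rightarrow> pullback_matr (basis F m) (fmatr F m A) N M | _ \<Rightarrow> 0)"

definition fmap :: "construction \<Rightarrow> nat \<Rightarrow> nat \<Rightarrow> (nat \<Rightarrow> nat \<Rightarrow> real) \<Rightarrow> coord_vec \<Rightarrow> coord_vec" where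
  "fmap F n m A x =
     (\<lambda>b. if b \<in> basis F m then \<Sum>a\<in>basis F n. fmatr F m A b a * x a else 0)"

text \<open>The adjoint \<open>\<F>(A)\<^sup>* : \<F>(\<real>\<^sup>m) \<rightarrow> \<F>(\<real>\<^sup>n)\<close>; see lemma \<open>ip_fmap\<close> below.\<close>

definition fmap_adj :: "construction \<Rightarrow> nat \<Rightarrow> nat \<Rightarrow> (nat \<Rightarrow> nat \<Rightarrow> real) \<Rightarrow> coord_vec \<Rightarrow> coord_vec" where
  "fmap_adj F n m A y =
     (\<lambda>a. if a \<in> basis F n
          then (\<Sum>b\<in>basis F m. gram F b * fmatr F m A b a * y b) / gram F a else 0)"

text \<open>Polynomials in the coordinates \<open>x\<^sub>\<alpha>\<close>; the exponent \<open>I\<close> is a multiset of basis labels.\<close>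

definition peval :: "coord_poly \<Rightarrow> coord_vec \<Rightarrow> real" where
  "peval q x = (\<Sum>I\<in>Poly_Mapping.keys q. Poly_Mapping.lookup q I * (\<Prod>a\<in>#I. x a))"

definition polys :: "construction \<Rightarrow> nat \<Rightarrow> coord_poly set" where
  "polys F n = {q. \<forall>I\<in>Poly_Mapping.keys q. set_mset I \<subseteq> basis F n}"

definition polys_le :: "construction \<Rightarrow> nat \<Rightarrow> nat \<Rightarrow> coord_poly set" where
  "polys_le F n d = {q \<in> polys F n. \<forall>I\<in>Poly_Mapping.keys q. size I \<le> d}"

definition coeff_norm :: "coord_poly \<Rightarrow> real" where
  "coeff_norm q = Max (insert 0 ((\<lambda>I. \<bar>Poly_Mapping.lookup q I\<bar>) ` Poly_Mapping.keys q))"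

definition semialgebraic :: "construction \<Rightarrow> nat \<Rightarrow> coord_vec set \<Rightarrow> bool" where
  "semialgebraic F n S \<longleftrightarrow>
     (\<exists>C. finite C \<and>
        (\<forall>(E, G)\<in>C. finite E \<and> finite G \<and> E \<subseteq> polys F n \<and> G \<subseteq> polys F n) \<and>
        S = (\<Union>(E, G)\<in>C. {x \<in> space_of F n.
               (\<forall>f\<in>E. peval f x = 0) \<and> (\<forall>g\<in>G. peval g x > 0)}))"

text \<open>
  \<open>ZeroPad\<close> is \<open>\<Z>\<close>, \<open>Dupl\<close> is \<open>\<D>\<close>. The index orders are orders on the positive
  integers.
\<close>

datatype base_seq = ZeroPad | Dupl

primrec index_le :: "base_seq \<Rightarrow> nat \<Rightarrow> nat \<Rightarrow> bool" where
  "index_le ZeroPad n N \<longleftrightarrow> 0 < n \<and> 0 < N \<and> n \<le> N"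
| "index_le Dupl n N \<longleftrightarrow> 0 < n \<and> 0 < N \<and> n dvd N"

primrec embed_matr :: "base_seq \<Rightarrow> nat \<Rightarrow> nat \<Rightarrow> nat \<Rightarrow> nat \<Rightarrow> real" where
  "embed_matr ZeroPad n N i j = of_bool (j = i)"
| "embed_matr Dupl n N i j = of_bool (j = i div (N div n))"

definition embed :: "construction \<Rightarrow> base_seq \<Rightarrow> nat \<Rightarrow> nat \<Rightarrow> coord_vec \<Rightarrow> coord_vec" where
  "embed F S n N = fmap F n N (embed_matr S n N)"

definition embed_adj :: "construction \<Rightarrow> base_seq \<Rightarrow> nat \<Rightarrow> nat \<Rightarrow> coord_vec \<Rightarrow> coord_vec" where
  "embed_adj F S n N = fmap_adj F n N (embed_matr S n N)"

definition act :: "construction \<Rightarrow> nat \<Rightarrow> (nat \<Rightarrow> nat) \<Rightarrow> coord_vec \<Rightarrow> coord_vec" where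
  "act F n \<sigma> = fmap F n n (\<lambda>i j. of_bool (j = inv \<sigma> i))"

definition FinSet_pair :: "construction \<Rightarrow> base_seq \<Rightarrow> base_seq \<Rightarrow> nat \<Rightarrow> bool" where
  "FinSet_pair F U L D \<longleftrightarrow>
     deg F = D \<and> (U = ZeroPad \<and> L = Dupl \<or> U = Dupl \<and> L = ZeroPad)"

definition FinSet_compatible ::
  "construction \<Rightarrow> base_seq \<Rightarrow> base_seq \<Rightarrow> (nat \<Rightarrow> coord_vec set) \<Rightarrow> bool" where
  "FinSet_compatible F U L \<Omega> \<longleftrightarrow>
     (\<forall>n>0. \<Omega> n \<subseteq> space_of F n) \<and>
     (\<forall>n>0. \<forall>\<sigma>. \<sigma> permutes {..<n} \<longrightarrow> act F n \<sigma> ` \<Omega> n \<subseteq> \<Omega> n) \<and>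
     (\<forall>n N. index_le U n N \<longrightarrow> embed F U n N ` \<Omega> n \<subseteq> \<Omega> N) \<and>
     (\<forall>n N. index_le L n N \<longrightarrow> embed_adj F L n N ` \<Omega> N \<subseteq> \<Omega> n)"

definition rho_matr :: "(nat \<Rightarrow> nat) \<Rightarrow> nat \<Rightarrow> nat \<Rightarrow> real" where
  "rho_matr f i j = of_bool (j = f i)"

text \<open>The random linear map \<open>L\<^bsub>m,n\<^esub> : V\<^sub>n \<rightarrow> V\<^sub>m\<close>; it depends on the pair only through \<open>\<U>\<close>.\<close>

primrec deFinetti :: "construction \<Rightarrow> base_seq \<Rightarrow> nat \<Rightarrow> nat \<Rightarrow> (coord_vec \<Rightarrow> coord_vec) pmf" where
  "deFinetti F Dupl m n =
     map_pmf (\<lambda>f. fmap F n m (rho_matr f)) (pmf_of_set ({..<m} \<rightarrow>\<^sub>E {..<n}))"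
| "deFinetti F ZeroPad m n =
     map_pmf (\<lambda>f. fmap_adj F m n (rho_matr f)) (pmf_of_set ({..<n} \<rightarrow>\<^sub>E {..<m}))"

definition free_polys :: "construction \<Rightarrow> base_seq \<Rightarrow> nat \<Rightarrow> (nat \<Rightarrow> coord_poly) set" where
  "free_polys F U d = {p.
     (\<forall>n>0. p n \<in> polys_le F n d) \<and>
     (\<forall>n>0. \<forall>\<sigma>. \<sigma> permutes {..<n} \<longrightarrow>
        (\<forall>x\<in>space_of F n. peval (p n) (act F n \<sigma> x) = peval (p n) x)) \<and>
     (\<forall>n N. index_le U n N \<longrightarrow>
        (\<forall>x\<in>space_of F n. peval (p N) (embed F U n N x) = peval (p n) x))}"

definition free_sym :: "construction \<Rightarrow> base_seq \<Rightarrow> nat \<Rightarrow> nat \<Rightarrow> coord_poly \<Rightarrow> coord_vec \<Rightarrow> real" where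
  "free_sym F L k n q x =
     (\<Sum>\<sigma> | \<sigma> permutes {..<n}. peval q (embed_adj F L k n (act F n \<sigma> x))) / fact n"

text \<open>Borel sets of \<open>\<Omega>\<^sub>n\<close> come from the product topology on coordinate functions.\<close>

definition free_measures ::
  "construction \<Rightarrow> base_seq \<Rightarrow> (nat \<Rightarrow> coord_vec set) \<Rightarrow> (nat \<Rightarrow> coord_vec measure) set" where
  "free_measures F L \<Omega> = {\<mu>.
     (\<forall>n>0. prob_space (\<mu> n) \<and> sets (\<mu> n) = sets (restrict_space borel (\<Omega> n))) \<and>
     (\<forall>n>0. \<forall>\<sigma>. \<sigma> permutes {..<n} \<longrightarrow> distr (\<mu> n) (\<mu> n) (act F n \<sigma>) = \<mu> n) \<and>
     (\<forall>n N. index_le L n N \<longrightarrow> distr (\<mu> N) (\<mu> n) (embed_adj F L n N) = \<mu> n)}"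

text \<open>The identity \<open>p\<^sub>n(x) = \<E>[q(L\<^bsub>k,n\<^esub> x)]\<close> for all \<open>n\<close>, where \<open>q\<close> lies in \<open>\<real>[V\<^sub>k]\<^sub>\<le>\<^sub>d\<close>.\<close>

definition dual_cost ::
  "construction \<Rightarrow> base_seq \<Rightarrow> nat \<Rightarrow> (nat \<Rightarrow> coord_poly) \<Rightarrow> nat \<Rightarrow> coord_poly \<Rightarrow> bool" where
  "dual_cost F U d p k q \<longleftrightarrow>
     q \<in> polys_le F k d \<and>
     (\<forall>n>0. \<forall>x\<in>space_of F n.
        peval (p n) x = measure_pmf.expectation (deFinetti F U k n) (\<lambda>\<Lambda>. peval q (\<Lambda> x)))"

text \<open>
  Infima and suprema are taken in the extended reals, so that they carry no implicit
  boundedness or nonemptiness assumption.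
\<close>

definition upper_val :: "(nat \<Rightarrow> coord_vec set) \<Rightarrow> (nat \<Rightarrow> coord_poly) \<Rightarrow> nat \<Rightarrow> ereal" where
  "upper_val \<Omega> p n = (INF x\<in>\<Omega> n. ereal (peval (p n) x))"

definition upper_lim :: "(nat \<Rightarrow> coord_vec set) \<Rightarrow> (nat \<Rightarrow> coord_poly) \<Rightarrow> ereal" where
  "upper_lim \<Omega> p = (INF n\<in>{0<..}. upper_val \<Omega> p n)"

definition lower_val ::
  "construction \<Rightarrow> base_seq \<Rightarrow> (nat \<Rightarrow> coord_vec set) \<Rightarrow> nat \<Rightarrow> coord_poly \<Rightarrow> nat \<Rightarrow> ereal" where
  "lower_val F L \<Omega> k q n = (INF x\<in>\<Omega> n. ereal (free_sym F L k n q x))"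

definition radius :: "construction \<Rightarrow> (nat \<Rightarrow> coord_vec set) \<Rightarrow> ereal" where
  "radius F \<Omega> = (SUP n\<in>{0<..}. SUP x\<in>\<Omega> n. ereal (norm1 F n x))"

lemma finite_msets_of_size:
  assumes "finite A"
  shows "finite (msets_of_size k A)"
proof -
  have "msets_of_size k A \<subseteq> mset ` {xs. set xs \<subseteq> A \<and> length xs = k}"
  proof
    fix M assume M: "M \<in> msets_of_size k A"
    obtain xs where "mset xs = M" using ex_mset by blast
    with M show "M \<in> mset ` {xs. set xs \<subseteq> A \<and> length xs = k}"
      by (auto simp: msets_of_size_def)
  qed
  then show ?thesis
    using finite_lists_length_eq[OF assms] finite_surj by blast
qed

lemma finite_basis: "finite (basis F n)"
  by (induction F) (auto simp: finite_msets_of_size)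

lemma gram_pos: "a \<in> basis F n \<Longrightarrow> gram F a > 0"
proof (induction F arbitrary: a)
  case (SymPow k F)
  have "(\<Prod>b\<in>#M. gram F b) > 0" if "set_mset M \<subseteq> basis F n" for M
    using that by (induction M) (auto simp: SymPow.IH)
  with SymPow.prems show ?case by (auto simp: msets_of_size_def)
next
  case (HomPoly k F)
  have "(\<Prod>b\<in>#M. gram F b) > 0" if "set_mset M \<subseteq> basis F n" for M
    using that by (induction M) (auto simp: HomPoly.IH)
  with HomPoly.prems show ?case by (auto simp: msets_of_size_def prod_pos)
qed auto

lemma ip_fmap: "ip F m (fmap F n m A x) y = ip F n x (fmap_adj F n m A y)"
proof -
  have "ip F m (fmap F n m A x) y =
      (\<Sum>b\<in>basis F m. \<Sum>a\<in>basis F n. gram F b * fmatr F m A b a * x a * y b)"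
    by (auto simp: ip_def fmap_def sum_distrib_left sum_distrib_right mult_ac
             intro!: sum.cong)
  also have "\<dots> = (\<Sum>a\<in>basis F n. \<Sum>b\<in>basis F m. gram F b * fmatr F m A b a * x a * y b)"
    by (rule sum.swap)
  also have "\<dots> = ip F n x (fmap_adj F n m A y)"
    unfolding ip_def
  proof (rule sum.cong[OF refl])
    fix a assume "a \<in> basis F n"
    moreover from this have "gram F a \<noteq> 0" using gram_pos[of a F n] by simp
    ultimately have "gram F a * x a * fmap_adj F n m A y a =
        x a * (\<Sum>b\<in>basis F m. gram F b * fmatr F m A b a * y b)"
      by (simp add: fmap_adj_def)
    then show "(\<Sum>b\<in>basis F m. gram F b * fmatr F m A b a * x a * y b) =
        gram F a * x a * fmap_adj F n m A y a"
      by (simp add: sum_distrib_left mult_ac)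
  qed
  finally show ?thesis .
qed

text \<open>
  The symmetric tensor with coordinates \<open>x\<close> has the coefficient \<open>x (IMset (mset as))\<close>
  at \<open>e\<^bsub>as\<^sub>1\<^esub> \<otimes> \<dots> \<otimes> e\<^bsub>as\<^sub>k\<^esub>\<close>.
\<close>

lemma sym_matr_eq:
  assumes "size M = length bs"
  shows "sym_matr B (mset bs) M =
    (\<Sum>as\<in>permutations_of_multiset M. prod_list (map2 B bs as))"
proof -
  define cs where "cs = (SOME cs. mset cs = mset bs)"
  have "mset cs = mset bs"
    unfolding cs_def by (rule someI[of _ bs]) simp
  then obtain \<pi> where \<pi>: "\<pi> permutes {..<length bs}" and cs: "permute_list \<pi> bs = cs"
    using mset_eq_permutation by blast
  have len: "length as = length bs" if "as \<in> permutations_of_multiset M" for as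
    using that assms by (auto simp: permutations_of_multiset_def)
  have inv: "inv \<pi> permutes {..<length bs}"
    by (rule permutes_inv[OF \<pi>])
  have perm: "prod_list (map2 B bs as) = prod_list (map2 B cs (permute_list \<pi> as))"
    if "as \<in> permutations_of_multiset M" for as
  proof -
    have "zip cs (permute_list \<pi> as) = permute_list \<pi> (zip bs as)"
      unfolding cs[symmetric]
      by (rule permute_list_zip[symmetric, OF \<pi>]) (simp_all add: len[OF that])
    then have "mset (map2 B cs (permute_list \<pi> as)) = mset (map2 B bs as)"
      by (simp only: mset_map) (simp add: mset_permute_list \<pi> len[OF that])
    then have "prod_mset (mset (map2 B cs (permute_list \<pi> as))) = prod_mset (mset (map2 B bs as))"
      by (rule arg_cong)
    then show ?thesis by (simp only: prod_mset_prod_list)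
  qed
  have "(\<Sum>as\<in>permutations_of_multiset M. prod_list (map2 B bs as)) =
      (\<Sum>as\<in>permutations_of_multiset M. prod_list (map2 B cs as))"
  proof (rule sum.reindex_bij_witness[where j = "permute_list \<pi>" and i = "permute_list (inv \<pi>)"])
    fix as assume as: "as \<in> permutations_of_multiset M"
    show "permute_list (inv \<pi>) (permute_list \<pi> as) = as"
      using permute_list_compose[of "inv \<pi>" as \<pi>] inv
      by (simp add: len[OF as] permutes_inv_o[OF \<pi>])
    show "permute_list \<pi> (permute_list (inv \<pi>) as) = as"
      using permute_list_compose[of \<pi> as "inv \<pi>"] \<pi>
      by (simp add: len[OF as] permutes_inv_o[OF \<pi>])
    show "permute_list \<pi> as \<in> permutations_of_multiset M"
      "permute_list (inv \<pi>) as \<in> permutations_of_multiset M"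
      using as len[OF as] \<pi> inv by (auto simp: permutations_of_multiset_def)
    show "prod_list (map2 B cs (permute_list \<pi> as)) = prod_list (map2 B bs as)"
      using perm[OF as] by simp
  qed
  then show ?thesis
    by (simp add: sym_matr_def cs_def)
qed

lemma fmap_SymPow:
  assumes "set bs \<subseteq> basis F m" "length bs = k"
  shows "fmap (SymPow k F) n m A x (IMset (mset bs)) =
    (\<Sum>as | set as \<subseteq> basis F n \<and> length as = k.
       prod_list (map2 (fmatr F m A) bs as) * x (IMset (mset as)))"
proof -
  let ?S = "{as. set as \<subseteq> basis F n \<and> length as = k}"
  let ?f = "\<lambda>as. prod_list (map2 (fmatr F m A) bs as) * x (IMset (mset as))"
  have fin: "finite ?S"
    by (rule finite_lists_length_eq) (rule finite_basis)
  have img: "mset ` ?S \<subseteq> msets_of_size k (basis F n)"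
    by (auto simp: msets_of_size_def)
  have inS: "{as \<in> ?S. mset as = M} = permutations_of_multiset M"
    if "M \<in> msets_of_size k (basis F n)" for M
    using that by (auto simp: msets_of_size_def permutations_of_multiset_def)
  have "IMset (mset bs) \<in> basis (SymPow k F) m"
    using assms by (auto simp: msets_of_size_def)
  then have "fmap (SymPow k F) n m A x (IMset (mset bs)) =
      (\<Sum>M\<in>msets_of_size k (basis F n). sym_matr (fmatr F m A) (mset bs) M * x (IMset M))"
    by (simp add: fmap_def sum.reindex inj_on_def)
  also have "\<dots> = (\<Sum>M\<in>msets_of_size k (basis F n). \<Sum>as\<in>permutations_of_multiset M. ?f as)"
    using assms
    by (intro sum.cong refl)
       (auto simp: sym_matr_eq msets_of_size_def sum_distrib_right permutations_of_multiset_def)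
  also have "\<dots> = (\<Sum>M\<in>msets_of_size k (basis F n). \<Sum>as\<in>{as \<in> ?S. mset as = M}. ?f as)"
    by (intro sum.cong refl inS[symmetric])
  also have "\<dots> = sum ?f ?S"
    by (rule sum.group[OF fin finite_msets_of_size[OF finite_basis] img])
  finally show ?thesis .
qed

lemma peval_superset:
  assumes "finite S" "Poly_Mapping.keys q \<subseteq> S"
  shows "peval q x = (\<Sum>I\<in>S. Poly_Mapping.lookup q I * (\<Prod>a\<in>#I. x a))"
  unfolding peval_def using assms
  by (intro sum.mono_neutral_left) (auto simp: in_keys_iff)

lemma peval_single [simp]: "peval (Poly_Mapping.single I c) x = c * (\<Prod>a\<in>#I. x a)"
  by (subst peval_superset[of "{I}"]) auto

lemma peval_zero [simp]: "peval 0 x = 0"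
  by (simp add: peval_def)

lemma peval_one [simp]: "peval 1 x = 1"
  using peval_single[of "{#}" 1 x] by simp

lemma peval_add: "peval (p + q) x = peval p x + peval q x"
proof -
  let ?S = "Poly_Mapping.keys p \<union> Poly_Mapping.keys q"
  have "Poly_Mapping.keys (p + q) \<subseteq> ?S" by (rule keys_add)
  then show ?thesis
    by (simp add: peval_superset[of ?S] lookup_add distrib_right sum.distrib)
qed

lemma peval_sum: "peval (\<Sum>i\<in>A. f i) x = (\<Sum>i\<in>A. peval (f i) x)"
  by (induction A rule: infinite_finite_induct) (auto simp: peval_add)

lemma sum_singles:
  "(\<Sum>I\<in>Poly_Mapping.keys q. Poly_Mapping.single I (Poly_Mapping.lookup q I)) = q"
  by (rule poly_mapping_eqI)
     (auto simp: lookup_sum lookup_single when_def in_keys_iff)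

lemma peval_mult: "peval (p * q) x = peval p x * peval q x"
proof -
  have "p * q = (\<Sum>I\<in>Poly_Mapping.keys p. \<Sum>J\<in>Poly_Mapping.keys q.
      Poly_Mapping.single (I + J) (Poly_Mapping.lookup p I * Poly_Mapping.lookup q J))"
    by (simp only: mult_single[symmetric] sum_product[symmetric] sum_singles)
  then show ?thesis
    by (simp add: peval_sum) (simp add: peval_def sum_product mult_ac)
qed

lemma peval_prod_mset: "peval (\<Prod>a\<in>#M. f a) x = (\<Prod>a\<in>#M. peval (f a) x)"
  by (induction M) (auto simp: peval_mult)

lemma keys_linear_product:
  assumes "finite Y"
  shows "Poly_Mapping.keys (\<Prod>a\<in>#M. \<Sum>b\<in>Y. Poly_Mapping.single {#b#} (B b a :: real))
    \<subseteq> msets_of_size (size M) Y"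
proof (induction M)
  case empty
  then show ?case by (auto simp: msets_of_size_def)
next
  case (add a M)
  have "Poly_Mapping.keys (\<Sum>b\<in>Y. Poly_Mapping.single {#b#} (B b a)) \<subseteq> (\<lambda>b. {#b#}) ` Y"
    by (rule order_trans[OF keys_sum]) (auto split: if_splits)
  then show ?case
    using add keys_mult[of "\<Sum>b\<in>Y. Poly_Mapping.single {#b#} (B b a)"
        "\<Prod>a\<in>#M. \<Sum>b\<in>Y. Poly_Mapping.single {#b#} (B b a)"]
    by (fastforce simp: msets_of_size_def)
qed

text \<open>The value at \<open>w\<close> of the polynomial with coordinates \<open>p\<close> in the basis \<open>m\<^sub>M\<close>.\<close>

definition hom_eval ::
  "construction \<Rightarrow> nat \<Rightarrow> nat \<Rightarrow> coord_vec \<Rightarrow> coord_vec \<Rightarrow> real" where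
  "hom_eval F k n p w =
     (\<Sum>M\<in>msets_of_size k (basis F n). p (IMset M) * (\<Prod>a\<in>#M. gram F a * w a))"

lemma fmap_HomPoly:
  "hom_eval F k m (fmap (HomPoly k F) n m A p) w = hom_eval F k n p (fmap_adj F n m A w)"
proof -
  let ?B = "fmatr F m A" and ?Y = "basis F m"
  let ?X = "msets_of_size k (basis F n)" and ?Z = "msets_of_size k (basis F m)"
  let ?z = "\<lambda>b. gram F b * w b"
  have subst_eq: "(\<Sum>N\<in>?Z. pullback_matr ?Y ?B N M * (\<Prod>b\<in>#N. ?z b)) =
      (\<Prod>a\<in>#M. gram F a * fmap_adj F n m A w a)" if M: "M \<in> ?X" for M
  proof -
    let ?P = "\<Prod>a\<in>#M. \<Sum>b\<in>?Y. Poly_Mapping.single {#b#} (?B b a)"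
    have "Poly_Mapping.keys ?P \<subseteq> ?Z"
      using keys_linear_product[OF finite_basis, where M = M and B = ?B] M by (simp add: msets_of_size_def)
    then have "(\<Sum>N\<in>?Z. pullback_matr ?Y ?B N M * (\<Prod>b\<in>#N. ?z b)) = peval ?P ?z"
      by (simp add: peval_superset[of ?Z] finite_msets_of_size finite_basis pullback_matr_def)
    also have "\<dots> = (\<Prod>a\<in>#M. \<Sum>b\<in>?Y. ?B b a * ?z b)"
      by (simp add: peval_prod_mset peval_sum)
    also have "\<dots> = (\<Prod>a\<in>#M. gram F a * fmap_adj F n m A w a)"
    proof (rule arg_cong[where f = prod_mset], rule image_mset_cong)
      fix a assume "a \<in># M"
      then have a: "a \<in> basis F n" using M by (auto simp: msets_of_size_def)
      then have "gram F a \<noteq> 0" using gram_pos[of a F n] by simp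
      with a show "(\<Sum>b\<in>?Y. ?B b a * ?z b) = gram F a * fmap_adj F n m A w a"
        by (simp add: fmap_adj_def mult_ac)
    qed
    finally show ?thesis .
  qed
  have "hom_eval F k m (fmap (HomPoly k F) n m A p) w =
      (\<Sum>N\<in>?Z. \<Sum>M\<in>?X. p (IMset M) * (pullback_matr ?Y ?B N M * (\<Prod>b\<in>#N. ?z b)))"
    unfolding hom_eval_def
    by (intro sum.cong refl)
       (simp add: fmap_def sum.reindex inj_on_def sum_distrib_right sum_distrib_left mult_ac)
  also have "\<dots> = (\<Sum>M\<in>?X. p (IMset M) * (\<Sum>N\<in>?Z. pullback_matr ?Y ?B N M * (\<Prod>b\<in>#N. ?z b)))"
    by (subst sum.swap) (simp add: sum_distrib_left)
  also have "\<dots> = hom_eval F k n p (fmap_adj F n m A w)"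
    by (simp add: subst_eq hom_eval_def)
  finally show ?thesis .
qed

end

theory Submission
  imports Defs
begin

text \<open>
  For an index map \<open>f\<close>, the matrix of \<open>\<F>(\<rho>(f))\<close> in the given bases is a relabelling of the basis
  labels up to rescaling by the Gram matrix. Hence every map in the statement (embeddings, their
  adjoints, permutations, de Finetti maps) is a pullback (if \<open>\<U>\<close> is a \<open>\<D>\<close>-sequence) or a
  pushforward (if \<open>\<U>\<close> is a \<open>\<Z>\<close>-sequence) along an index map, and a label of \<open>\<F>\<close> involves at most
  \<open>D\<close> indices.

  Averaging over random index maps is triangular on the invariant polynomials of degree at most
  \<open>d\<close> with respect to the number of indices occurring in a monomial, with nonzero constants on the
  diagonal, because a map that is not injective on these indices decreases their number. So it is
  injective, and since at most \<open>dD \<le> k\<close> indices occur, every \<open>p\<^sub>n\<close> with \<open>n \<ge> k\<close> is the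
  average of some \<open>q\<close> on \<open>V\<^sub>k\<close>; injectivity and a common multiple of \<open>n\<close> and \<open>k\<close> show that one
  \<open>q\<close> serves all \<open>n\<close>. Uniqueness of the symmetrization is injectivity on \<open>V\<^sub>n\<close>.

  The lower bounds replace a uniformly random map on \<open>s\<close> points by a uniformly random injection,
  which changes the expectation of a function bounded by \<open>B\<close> by at most \<open>s(s - 1)B/n\<close>. This gives
  both rates and \<open>\<ell>\<^sub>\<infinity> = u\<^sub>\<infinity>\<close>. The laws of \<open>L\<^bsub>m,n\<^esub> x\<close> form a free measure with cost \<open>p\<^sub>n(x)\<close>, and
  every free measure has cost at least every \<open>\<ell>\<^sub>n\<close>.
\<close>

subsection \<open>Relabelling of basis labels\<close>

text \<open>Writing polynomials as sums over lists of labels makes coefficients non-unique, so the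
  arguments never read coefficients off a function; they exhibit representations. The two kinds of
  sequences are then transposes of each other. A pullback carries monomials to monomials, whereas a
  pushforward leaves the monomials in place and precomposes the coefficient function with the
  relabelling. Hence in the injectivity proofs the triangular elimination removes the monomials with
  the most points first for pullbacks, but for pushforwards it makes the coefficients vanish on the
  monomials with the fewest points first. On the kernel each elimination step is free, because what
  is subtracted represents zero. The rates come from a union bound: among \<open>s\<close> points
  some two collide with probability at most \<open>s(s - 1)/(2n)\<close>, and a collision costs at
  most \<open>2B\<close>. For pushforwards this is applied to one monomial at a time; a monomial of
  length \<open>j\<close> has at most \<open>jD\<close> and at most \<open>dD\<close> points, and
  the weights \<open>j\<close> sum to \<open>d(d + 1)/2\<close>, where the factor \<open>1/2\<close>
  is given away.\<close>

primrec relabel :: "(nat \<Rightarrow> nat) \<Rightarrow> idx \<Rightarrow> idx" where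
  "relabel f (ICoord i) = ICoord (f i)"
| "relabel f (ILeft a) = ILeft (relabel f a)"
| "relabel f (IRight a) = IRight (relabel f a)"
| "relabel f (IPair a b) = IPair (relabel f a) (relabel f b)"
| "relabel f (IMset M) = IMset (image_mset (relabel f) M)"

primrec supp :: "idx \<Rightarrow> nat set" where
  "supp (ICoord i) = {i}"
| "supp (ILeft a) = supp a"
| "supp (IRight a) = supp a"
| "supp (IPair a b) = supp a \<union> supp b"
| "supp (IMset M) = \<Union> (set_mset (image_mset supp M))"

lemma relabel_cong: "(\<And>i. i \<in> supp a \<Longrightarrow> f i = g i) \<Longrightarrow> relabel f a = relabel g a"
  by (induction a) (auto intro!: image_mset_cong)

lemma relabel_ident [simp]: "relabel (\<lambda>i. i) a = a"
  by (induction a) (auto simp: multiset.map_ident_strong)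

lemma relabel_relabel [simp]: "relabel f (relabel g a) = relabel (f \<circ> g) a"
  by (induction a) (auto simp: multiset.map_comp intro!: image_mset_cong)

lemma supp_relabel: "supp (relabel f a) = f ` supp a"
  by (induction a) auto

lemma IMset_in_image [simp]: "IMset M \<in> IMset ` A \<longleftrightarrow> M \<in> A"
  by auto

text \<open>The shape of a label decides whether it belongs to \<open>F\<close> at all;
  \<open>n\<close> only bounds the indices at its leaves. So bases for different \<open>n\<close>
  can be compared through supports alone.\<close>

lemma basis_iff_supp:
  "a \<in> basis F n \<Longrightarrow> a \<in> basis F m \<longleftrightarrow> supp a \<subseteq> {..<m}"
proof (induction F arbitrary: a)
  case (SymPow k F)
  then obtain M where M: "a = IMset M" "size M = k" "set_mset M \<subseteq> basis F n"
    by (auto simp: msets_of_size_def)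
  then have "set_mset M \<subseteq> basis F m \<longleftrightarrow> (\<forall>b\<in>#M. supp b \<subseteq> {..<m})"
    using SymPow.IH by (meson subset_iff)
  then show ?case using M by (simp add: msets_of_size_def UN_subset_iff)
next
  case (HomPoly k F)
  then obtain M where M: "a = IMset M" "size M = k" "set_mset M \<subseteq> basis F n"
    by (auto simp: msets_of_size_def)
  then have "set_mset M \<subseteq> basis F m \<longleftrightarrow> (\<forall>b\<in>#M. supp b \<subseteq> {..<m})"
    using HomPoly.IH by (meson subset_iff)
  then show ?case using M by (simp add: msets_of_size_def UN_subset_iff)
next
  case (Tensor F G)
  then show ?case by fastforce
qed auto

lemma supp_basis: "a \<in> basis F n \<Longrightarrow> supp a \<subseteq> {..<n}"
  using basis_iff_supp by blast

lemma relabel_basis: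
  "a \<in> basis F n \<Longrightarrow> f ` supp a \<subseteq> {..<m} \<Longrightarrow> relabel f a \<in> basis F m"
proof (induction F arbitrary: a)
  case (SymPow k F)
  then obtain M where M: "a = IMset M" "size M = k" "set_mset M \<subseteq> basis F n"
    by (auto simp: msets_of_size_def)
  have "relabel f b \<in> basis F m" if "b \<in># M" for b
    using SymPow.prems(2) M that by (intro SymPow.IH) (auto simp: M(1))
  then show ?case using M(2) unfolding M(1) by (auto simp: msets_of_size_def )
next
  case (HomPoly k F)
  then obtain M where M: "a = IMset M" "size M = k" "set_mset M \<subseteq> basis F n"
    by (auto simp: msets_of_size_def)
  have "relabel f b \<in> basis F m" if "b \<in># M" for b
    using HomPoly.prems(2) M that by (intro HomPoly.IH) (auto simp: M(1))
  then show ?case using M(2) unfolding M(1) by (auto simp: msets_of_size_def )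
next
  case (Tensor F G)
  then show ?case by fastforce
qed auto

lemma finite_supp [simp]: "finite (supp a)"
  by (induction a) auto

lemma card_Union_mset_le:
  assumes "\<And>b. b \<in># M \<Longrightarrow> card (g b) \<le> D" "\<And>b. b \<in># M \<Longrightarrow> finite (g b)"
  shows "card (\<Union> (g ` set_mset M)) \<le> size M * D"
  using assms
proof (induction M)
  case (add b M)
  have "card (\<Union> (g ` set_mset (add_mset b M))) \<le> card (g b) + card (\<Union> (g ` set_mset M))"
    by (simp add: card_Un_le)
  also have "\<dots> \<le> D + size M * D"
    using add by (intro add_mono) auto
  finally show ?case by simp
qed auto

text \<open>\<open>deg\<close> follows the recursion of the largest number of leaves in a label: a
  pair adds them, a multiset of size \<open>k\<close> multiplies by \<open>k\<close>, a product
  offers a choice and hence the maximum.\<close>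

lemma card_supp_le: "a \<in> basis F n \<Longrightarrow> card (supp a) \<le> deg F"
proof (induction F arbitrary: a)
  case (Tensor F G)
  then show ?case
    by (auto intro!: order_trans[OF card_Un_le] add_mono)
next
  case (SymPow k F)
  then show ?case by (force simp: msets_of_size_def intro!: card_Union_mset_le)
next
  case (HomPoly k F)
  then show ?case by (force simp: msets_of_size_def intro!: card_Union_mset_le)
next
  case (Product F G)
  then show ?case by (auto simp: le_max_iff_disj)
qed auto

section \<open>Coefficients of products of linear forms\<close>

lemma sum_count_image_mset:
  assumes "finite Y" "set_mset N \<subseteq> Y"
  shows "(\<Sum>b\<in>{b\<in>Y. h b = a}. count N b) = count (image_mset h N) a"
  by (simp add: count_image_mset') (use assms in \<open>auto intro!: sum.mono_neutral_right simp: not_in_iff\<close>)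

lemma prod_fact_count_add_mset:
  "(\<Prod>b\<in>set_mset (add_mset a M). fact (count (add_mset a M) b)) =
     (real (Suc (count M a)) * (\<Prod>b\<in>set_mset M. fact (count M b)) :: real)"
proof -
  have "(\<Prod>b\<in>set_mset (add_mset a M). fact (count (add_mset a M) b) :: real) =
      (\<Prod>b\<in>set_mset (add_mset a M). (if b = a then real (Suc (count M a)) else 1) * fact (count M b))"
    by (intro prod.cong) auto
  also have "\<dots> = real (Suc (count M a)) * (\<Prod>b\<in>set_mset (add_mset a M). fact (count M b))"
    by (simp add: prod.distrib prod.delta)
  also have "(\<Prod>b\<in>set_mset (add_mset a M). fact (count M b) :: real) = (\<Prod>b\<in>set_mset M. fact (count M b))"
    by (rule prod.mono_neutral_right) (auto simp: not_in_iff)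
  finally show ?thesis .
qed

lemma lookup_single_mult:
  fixes q :: coord_poly
  shows "Poly_Mapping.lookup (Poly_Mapping.single {#b#} c * q) N =
    (if b \<in># N then c * Poly_Mapping.lookup q (N - {#b#}) else 0)"
proof -
  have "Poly_Mapping.single {#b#} c * q =
      (\<Sum>J\<in>Poly_Mapping.keys q. Poly_Mapping.single ({#b#} + J) (c * Poly_Mapping.lookup q J))"
    by (subst sum_singles[symmetric, of q]) (simp add: sum_distrib_left mult_single)
  then have *: "Poly_Mapping.lookup (Poly_Mapping.single {#b#} c * q) N =
      (\<Sum>J\<in>Poly_Mapping.keys q. (c * Poly_Mapping.lookup q J when {#b#} + J = N))"
    by (simp add: lookup_sum lookup_single)
  show ?thesis
  proof (cases "b \<in># N")
    case True
    have "(\<Sum>J\<in>Poly_Mapping.keys q. (c * Poly_Mapping.lookup q J when {#b#} + J = N)) =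
        (\<Sum>J\<in>Poly_Mapping.keys q. if J = N - {#b#} then c * Poly_Mapping.lookup q J else 0)"
      using True by (intro sum.cong) (auto simp: when_def)
    then show ?thesis using True * by (auto simp: in_keys_iff)
  next
    case False
    then show ?thesis unfolding * by (auto simp: when_def intro!: sum.neutral)
  qed
qed

text \<open>A multinomial theorem: the factors of \<open>M\<close> equal to \<open>a\<close> form a
  power of a linear form over the fibre of \<open>h\<close> at \<open>a\<close>, so the coefficient
  is a product of multinomial numbers times the weights. The Bombieri norm of the monomials
  compensates exactly these factorials.\<close>

lemma lookup_relabel_product:
  fixes h :: "idx \<Rightarrow> idx" and w :: "idx \<Rightarrow> real"
  assumes "finite Y" "set_mset N \<subseteq> Y"
  shows "Poly_Mapping.lookup
      (\<Prod>a\<in>#M. \<Sum>b\<in>Y. Poly_Mapping.single {#b#} (if a = h b then w b else 0)) N =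
    (if M = image_mset h N then
       (\<Prod>a\<in>set_mset M. fact (count M a)) / (\<Prod>b\<in>set_mset N. fact (count N b)) * (\<Prod>b\<in>#N. w b)
     else 0)"
  using assms(2)
proof (induction M arbitrary: N)
  case empty
  then show ?case by (auto simp: lookup_one when_def)
next
  case (add a M)
  let ?L = "\<lambda>a. \<Sum>b\<in>Y. Poly_Mapping.single {#b#} (if a = h b then w b else 0)"
  let ?fc = "\<lambda>M. \<Prod>a\<in>set_mset M. fact (count M a) :: real"
  let ?R = "\<lambda>M N. if M = image_mset h N then ?fc M / ?fc N * (\<Prod>b\<in>#N. w b) else 0"
  have "Poly_Mapping.lookup (\<Prod>a\<in>#add_mset a M. ?L a) N =
     (\<Sum>b\<in>Y. if b \<in># N then (if a = h b then w b else 0) * Poly_Mapping.lookup (\<Prod>a\<in>#M. ?L a) (N - {#b#}) else 0)"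
    by (simp add: sum_distrib_right lookup_sum lookup_single_mult)
  also have "\<dots> = (\<Sum>b\<in>Y. if b \<in># N \<and> a = h b then w b * ?R M (N - {#b#}) else 0)"
  proof (intro sum.cong refl)
    fix b assume "b \<in> Y"
    have "set_mset (N - {#b#}) \<subseteq> Y"
      using add.prems by (auto dest: in_diffD)
    then show "(if b \<in># N then (if a = h b then w b else 0) *
          Poly_Mapping.lookup (\<Prod>a\<in>#M. ?L a) (N - {#b#}) else 0) =
        (if b \<in># N \<and> a = h b then w b * ?R M (N - {#b#}) else 0)"
      by (simp only: add.IH) simp
  qed
  \<comment> \<open>Removing one copy of \<open>b\<close> divides the factorial of \<open>N\<close>
    by \<open>count N b\<close>; with this factor moved to the numerator the rest no longer depends
    on \<open>b\<close>.\<close>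
  also have "\<dots> = (\<Sum>b\<in>Y. if h b = a \<and> add_mset a M = image_mset h N
       then count N b * (?fc M / ?fc N * (\<Prod>b\<in>#N. w b)) else 0)"
  proof (intro sum.cong refl)
    fix b assume "b \<in> Y"
    show "(if b \<in># N \<and> a = h b then w b * ?R M (N - {#b#}) else 0) =
      (if h b = a \<and> add_mset a M = image_mset h N then count N b * (?fc M / ?fc N * (\<Prod>b\<in>#N. w b)) else 0)"
    proof (cases "b \<in># N \<and> a = h b")
      case True
      then obtain N' where N: "N = add_mset b N'" by (meson multi_member_split)
      have "w b * (?fc M / ?fc N' * (\<Prod>b\<in>#N'. w b)) =
          real (count N b) * (?fc M / (real (Suc (count N' b)) * ?fc N') * (\<Prod>b\<in>#N. w b))"
        unfolding N by simp
      then show ?thesis using True unfolding N prod_fact_count_add_mset by auto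
    next
      case False
      have "count N b = 0" if "h b = a"
        using False that by (auto simp: count_eq_zero_iff)
      then show ?thesis using False by auto
    qed
  qed
  also have "\<dots> = (if add_mset a M = image_mset h N then
       (\<Sum>b\<in>{b\<in>Y. h b = a}. count N b) * (?fc M / ?fc N * (\<Prod>b\<in>#N. w b)) else 0)"
    using assms(1) by (auto simp: sum_distrib_right sum_divide_distrib sum.If_cases Int_def intro!: sum.cong)
  also have "\<dots> = ?R (add_mset a M) N"
  proof (cases "add_mset a M = image_mset h N")
    case True
    \<comment> \<open>The multiplicities over the fibre add up to that of \<open>a\<close> in the
      image, which is the factor by which the factorial of \<open>M\<close> grows when
      \<open>a\<close> is added.\<close>
    have sum: "(\<Sum>b\<in>{b\<in>Y. h b = a}. count N b) = Suc (count M a)"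
      unfolding sum_count_image_mset[OF assms(1) add.prems] True[symmetric] by simp
    show ?thesis
      unfolding if_P[OF True] sum prod_fact_count_add_mset by simp
  qed simp
  finally show ?case .
qed

text \<open>At \<open>Ident\<close> every row has a single nonzero entry, and each operation
  preserves this. The Gram ratio expresses that the adjoint sends \<open>e_b\<close> to the basis
  vector labelled \<open>relabel f b\<close> with coefficient 1; for \<open>HomPoly\<close> it
  contains the factorials of the multinomial expansion, the common \<open>k!\<close>
  cancelling.\<close>

lemma fmatr_rho:
  "b \<in> basis F m \<Longrightarrow> a \<in> basis F n \<Longrightarrow>
   fmatr F m (rho_matr f) b a = (if a = relabel f b then gram F a / gram F b else 0)"
proof (induction F arbitrary: a b)
  case Ident
  then show ?case by (auto simp: rho_matr_def)
next
  case (Product F G)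
  then show ?case by auto
next
  case (Tensor F G)
  then show ?case by auto
next
  case (SymPow k F)
  then obtain N M where b: "b = IMset N" and a: "a = IMset M"
    and NM: "size N = k" "size M = k" "set_mset N \<subseteq> basis F m" "set_mset M \<subseteq> basis F n"
    by (auto simp: msets_of_size_def)
  obtain bs where bs: "mset bs = N" using ex_mset by blast
  have len: "length bs = k" using bs NM(1) by auto
  have *: "prod_list (map2 (fmatr F m (rho_matr f)) bs as) =
      (if as = map (relabel f) bs then (\<Prod>b\<in>#mset bs. gram F (relabel f b) / gram F b) else 0)"
    if "length as = length bs" "set as \<subseteq> basis F n" "set bs \<subseteq> basis F m" for as bs
    using that by (induction as bs rule: list_induct2) (auto simp: SymPow.IH)
  have "fmatr (SymPow k F) m (rho_matr f) b a =
      (\<Sum>as\<in>permutations_of_multiset M. prod_list (map2 (fmatr F m (rho_matr f)) bs as))"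
    using sym_matr_eq[of M bs] NM len by (simp add: a b bs)
  \<comment> \<open>A factor vanishes unless the label in \<open>as\<close> is the relabelled one in
    \<open>bs\<close>, so only one enumeration of \<open>M\<close> can contribute.\<close>
  also have "\<dots> = (\<Sum>as\<in>permutations_of_multiset M.
      if as = map (relabel f) bs then (\<Prod>b\<in>#N. gram F (relabel f b) / gram F b) else 0)"
  proof (rule sum.cong[OF refl])
    fix as assume "as \<in> permutations_of_multiset M"
    then have "mset as = M" by (simp add: permutations_of_multiset_def)
    then have "length as = length bs" "set as \<subseteq> basis F n"
      using NM len by (metis size_mset, metis set_mset_mset)
    moreover have "set bs \<subseteq> basis F m" using NM(3) bs by auto
    ultimately show "prod_list (map2 (fmatr F m (rho_matr f)) bs as) =
        (if as = map (relabel f) bs then (\<Prod>b\<in>#N. gram F (relabel f b) / gram F b) else 0)"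
      using * bs by blast
  qed
  also have "\<dots> = (if image_mset (relabel f) N = M
      then (\<Prod>b\<in>#N. gram F (relabel f b) / gram F b) else 0)"
  proof -
    have "map (relabel f) bs \<in> permutations_of_multiset M \<longleftrightarrow> image_mset (relabel f) N = M"
      by (auto simp: permutations_of_multiset_def bs)
    then show ?thesis by (simp add: finite_permutations_of_multiset)
  qed
  also have "(\<Prod>b\<in>#N. gram F (relabel f b) / gram F b) =
      (\<Prod>b\<in>#image_mset (relabel f) N. gram F b) / (\<Prod>b\<in>#N. gram F b)"
    by (induction N) auto
  finally show ?case by (auto simp: a b)
next
  case (HomPoly k F)
  then obtain N M where b: "b = IMset N" and a: "a = IMset M"
    and NM: "size N = k" "size M = k" "set_mset N \<subseteq> basis F m" "set_mset M \<subseteq> basis F n"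
    by (auto simp: msets_of_size_def)
  let ?w = "\<lambda>b. gram F (relabel f b) / gram F b"
  have "(\<Prod>a\<in>#M. \<Sum>b\<in>basis F m. Poly_Mapping.single {#b#} (fmatr F m (rho_matr f) b a)) =
      (\<Prod>a\<in>#M. \<Sum>b\<in>basis F m. Poly_Mapping.single {#b#} (if a = relabel f b then ?w b else 0))"
  proof (intro arg_cong[where f = prod_mset] image_mset_cong sum.cong refl)
    fix a b assume "a \<in># M" "b \<in> basis F m"
    then show "Poly_Mapping.single {#b#} (fmatr F m (rho_matr f) b a) =
        Poly_Mapping.single {#b#} (if a = relabel f b then ?w b else 0)"
      using HomPoly.IH[of b a] NM(4) by (simp add: subset_iff)
  qed
  then have "fmatr (HomPoly k F) m (rho_matr f) b a = Poly_Mapping.lookup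
      (\<Prod>a\<in>#M. \<Sum>b\<in>basis F m. Poly_Mapping.single {#b#} (if a = relabel f b then ?w b else 0)) N"
    by (simp add: a b pullback_matr_def)
  also have "\<dots> = (if M = image_mset (relabel f) N then
       (\<Prod>a\<in>set_mset M. fact (count M a)) / (\<Prod>b\<in>set_mset N. fact (count N b)) * (\<Prod>b\<in>#N. ?w b)
     else 0)"
    using NM(3) by (rule lookup_relabel_product[OF finite_basis])
  also have "(\<Prod>b\<in>#N. ?w b) = (\<Prod>b\<in>#image_mset (relabel f) N. gram F b) / (\<Prod>b\<in>#N. gram F b)"
    by (induction N) auto
  finally show ?case by (auto simp: a b)
qed

subsection \<open>Index maps acting on the spaces\<close>

lemma inj_relabel:
  assumes "inj f" shows "inj (relabel f)"
proof (rule inj_on_inverseI)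
  show "relabel (inv f) (relabel f a) = a" for a
    using assms by (simp add: o_def)
qed

text \<open>Only the factorials in \<open>HomPoly\<close> depend on more than the shape of a label,
  and an injective relabelling keeps multiplicities. This lets a permutation act both as a pullback
  and as a pushforward.\<close>

lemma gram_relabel:
  assumes "inj f"
  shows "gram F (relabel f a) = gram F a"
proof (induction F arbitrary: a)
  case (SymPow k F)
  show ?case by (cases a) (simp_all add: multiset.map_comp o_def SymPow.IH)
next
  case (HomPoly k F)
  have "count (image_mset (relabel f) M) (relabel f b) = count M b" for M b
    using inj_relabel[OF assms] by (induction M) (auto simp: inj_eq)
  then have "(\<Prod>b\<in>set_mset (image_mset (relabel f) M). fact (count (image_mset (relabel f) M) b)) =
      (\<Prod>b\<in>set_mset M. fact (count M b) :: real)" for M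
    using inj_relabel[OF assms]
    by (simp add: prod.reindex inj_on_subset[of _ UNIV])
  then show ?case by (cases a) (simp_all add: multiset.map_comp o_def HomPoly.IH)
next
  case (Product F G)
  then show ?case by (cases a) simp_all
next
  case (Tensor F G)
  then show ?case by (cases a) simp_all
qed simp

primrec ext_maps :: "base_seq \<Rightarrow> nat \<Rightarrow> nat \<Rightarrow> (nat \<Rightarrow> nat) set" where
  "ext_maps Dupl m n = {..<m} \<rightarrow>\<^sub>E {..<n}"
| "ext_maps ZeroPad m n = {..<n} \<rightarrow>\<^sub>E {..<m}"

text \<open>\<open>ext_maps\<close> is the finite sample space of the random maps; this larger set
  also admits embeddings and permutations, which are not extensional.\<close>

primrec index_maps :: "base_seq \<Rightarrow> nat \<Rightarrow> nat \<Rightarrow> (nat \<Rightarrow> nat) set" where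
  "index_maps Dupl m n = {..<m} \<rightarrow> {..<n}"
| "index_maps ZeroPad m n = {..<n} \<rightarrow> {..<m}"

text \<open>One notation for both kinds of sequences, so that most arguments run once. The index map
  goes from \<open>m\<close> to \<open>n\<close> points for pullbacks and from \<open>n\<close> to
  \<open>m\<close> points for pushforwards.\<close>

primrec lin :: "construction \<Rightarrow> base_seq \<Rightarrow> nat \<Rightarrow> nat \<Rightarrow> (nat \<Rightarrow> nat) \<Rightarrow> coord_vec \<Rightarrow> coord_vec" where
  "lin F Dupl m n f = fmap F n m (rho_matr f)"
| "lin F ZeroPad m n f = fmap_adj F m n (rho_matr f)"

primrec compose_maps :: "base_seq \<Rightarrow> (nat \<Rightarrow> nat) \<Rightarrow> (nat \<Rightarrow> nat) \<Rightarrow> nat \<Rightarrow> nat" where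
  "compose_maps Dupl f g = g \<circ> f"
| "compose_maps ZeroPad f g = f \<circ> g"

lemma lin_Dupl:
  "lin F Dupl m n f x =
     (\<lambda>b. if b \<in> basis F m \<and> relabel f b \<in> basis F n
          then gram F (relabel f b) / gram F b * x (relabel f b) else 0)"
proof
  fix b
  have "(\<Sum>a\<in>basis F n. fmatr F m (rho_matr f) b a * x a) =
      (\<Sum>a\<in>basis F n. if a = relabel f b then gram F a / gram F b * x a else 0)"
    if "b \<in> basis F m"
    using that by (intro sum.cong refl) (auto simp: fmatr_rho)
  then show "lin F Dupl m n f x b = (if b \<in> basis F m \<and> relabel f b \<in> basis F n
          then gram F (relabel f b) / gram F b * x (relabel f b) else 0)"
    by (simp add: fmap_def finite_basis)
qed

text \<open>The Gram factors in the adjoint cancel the ratio in \<open>fmatr_rho\<close>, which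
  leaves an unweighted sum over the fibres of \<open>relabel f\<close>.\<close>

lemma lin_ZeroPad:
  "lin F ZeroPad m n f y =
     (\<lambda>a. if a \<in> basis F m then \<Sum>b | b \<in> basis F n \<and> relabel f b = a. y b else 0)"
proof
  fix a
  have "(\<Sum>b\<in>basis F n. gram F b * fmatr F n (rho_matr f) b a * y b) =
      gram F a * (\<Sum>b | b \<in> basis F n \<and> relabel f b = a. y b)"
    if "a \<in> basis F m"
  proof -
    have "(\<Sum>b\<in>basis F n. gram F b * fmatr F n (rho_matr f) b a * y b) =
        (\<Sum>b\<in>basis F n. if relabel f b = a then gram F a * y b else 0)"
      using that by (intro sum.cong refl) (auto simp: fmatr_rho less_imp_neq[OF gram_pos, symmetric])
    also have "\<dots> = (\<Sum>b | b \<in> basis F n \<and> relabel f b = a. gram F a * y b)"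
      by (simp add: sum.inter_filter finite_basis)
    finally show ?thesis by (simp add: sum_distrib_left)
  qed
  then show "lin F ZeroPad m n f y a =
      (if a \<in> basis F m then \<Sum>b | b \<in> basis F n \<and> relabel f b = a. y b else 0)"
    using gram_pos[of a F m] by (auto simp: fmap_adj_def)
qed

lemma lin_in_space: "lin F S m n f x \<in> space_of F m"
  by (cases S) (auto simp: fmap_def fmap_adj_def space_of_def)

lemma relabel_basis': "b \<in> basis F m \<Longrightarrow> f \<in> {..<m} \<rightarrow> {..<n} \<Longrightarrow> relabel f b \<in> basis F n"
  using relabel_basis supp_basis by blast

text \<open>For pullbacks the Gram ratios telescope; for pushforwards the fibres of the composite
  are partitioned by the intermediate label.\<close>

lemma lin_lin:
  assumes "f \<in> index_maps S l m" "g \<in> index_maps S m n"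
  shows "lin F S l m f (lin F S m n g x) = lin F S l n (compose_maps S f g) x"
proof (cases S)
  case Dupl
  have "lin F Dupl l m f (lin F Dupl m n g x) b = lin F Dupl l n (g \<circ> f) x b" for b
    using assms relabel_basis'[of b F l f m] relabel_basis'[of "relabel f b" F m g n]
      gram_pos[of b F l] gram_pos[of "relabel f b" F m]
    by (cases "b \<in> basis F l") (simp_all add: Dupl lin_Dupl del: lin.simps)
  then show ?thesis by (auto simp: Dupl simp del: lin.simps)
next
  case ZeroPad
  have "(\<Sum>b | b \<in> basis F m \<and> relabel f b = a. \<Sum>c | c \<in> basis F n \<and> relabel g c = b. x c) =
      (\<Sum>c | c \<in> basis F n \<and> relabel f (relabel g c) = a. x c)" for a
  proof -
    have "(\<Sum>b | b \<in> basis F m \<and> relabel f b = a. \<Sum>c | c \<in> basis F n \<and> relabel g c = b. x c) =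
      (\<Sum>b | b \<in> basis F m \<and> relabel f b = a.
        \<Sum>c | c \<in> {c. c \<in> basis F n \<and> relabel f (relabel g c) = a} \<and> relabel g c = b. x c)"
      by (intro sum.cong refl) auto
    also have "\<dots> = (\<Sum>c | c \<in> basis F n \<and> relabel f (relabel g c) = a. x c)"
      by (rule sum.group) (use assms in \<open>auto simp: finite_basis ZeroPad intro: relabel_basis'\<close>)
    finally show ?thesis .
  qed
  then show ?thesis by (simp add: ZeroPad lin_ZeroPad del: lin.simps cong: if_cong)
qed

lemma lin_cong:
  assumes "\<And>i. i < (case S of Dupl \<Rightarrow> m | ZeroPad \<Rightarrow> n) \<Longrightarrow> f i = g i"
  shows "lin F S m n f = lin F S m n g"
proof (cases S)
  case Dupl
  then have "relabel f b = relabel g b" if "b \<in> basis F m" for b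
    using assms supp_basis[OF that] by (intro relabel_cong) auto
  then show ?thesis by (simp add: Dupl lin_Dupl fun_eq_iff del: lin.simps cong: conj_cong)
next
  case ZeroPad
  then have "relabel f b = relabel g b" if "b \<in> basis F n" for b
    using assms supp_basis[OF that] by (intro relabel_cong) auto
  then have "{b \<in> basis F n. relabel f b = a} = {b \<in> basis F n. relabel g b = a}" for a
    by auto
  then show ?thesis by (simp add: ZeroPad lin_ZeroPad fun_eq_iff del: lin.simps)
qed

primrec opposite :: "base_seq \<Rightarrow> base_seq" where
  "opposite Dupl = ZeroPad"
| "opposite ZeroPad = Dupl"

primrec embed_map :: "base_seq \<Rightarrow> nat \<Rightarrow> nat \<Rightarrow> nat \<Rightarrow> nat" where
  "embed_map Dupl n N = (\<lambda>i. i div (N div n))"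
| "embed_map ZeroPad n N = (\<lambda>i. i)"

lemma embed_matr_eq: "embed_matr S n N = rho_matr (embed_map S n N)"
  by (cases S) (auto simp: rho_matr_def fun_eq_iff)

lemma basis_mono: "n \<le> N \<Longrightarrow> basis F n \<subseteq> basis F N"
  using basis_iff_supp supp_basis by fastforce

lemma embed_eq:
  assumes "index_le S n N"
  shows "embed F S n N x = lin F S N n (embed_map S n N) x"
proof (cases S)
  case Dupl
  then show ?thesis by (simp add: embed_def embed_matr_eq)
next
  case ZeroPad
  then have "n \<le> N" using assms by simp
  then have sub: "basis F n \<subseteq> basis F N" by (rule basis_mono)
  \<comment> \<open>Zero-padding appears as a pullback along an identity that does not map into
    \<open>{..<n}\<close>. Labels outside \<open>basis F n\<close> get the value 0 there, just as in
    the pushforward along the inclusion.\<close>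
  have "embed F ZeroPad n N x = lin F Dupl N n (\<lambda>i. i) x"
    by (simp add: embed_def embed_matr_eq)
  also have "\<dots> = lin F ZeroPad N n (\<lambda>i. i) x"
  proof
    fix b
    have "{c. c \<in> basis F n \<and> c = b} = (if b \<in> basis F n then {b} else {})" by auto
    then show "lin F Dupl N n (\<lambda>i. i) x b = lin F ZeroPad N n (\<lambda>i. i) x b"
      using sub gram_pos[of b F n] by (auto simp: lin_Dupl lin_ZeroPad simp del: lin.simps)
  qed
  finally show ?thesis by (simp add: ZeroPad)
qed

lemma embed_adj_eq:
  assumes "index_le (opposite S) n N"
  shows "embed_adj F (opposite S) n N x = lin F S n N (embed_map (opposite S) n N) x"
proof (cases S)
  case Dupl
  then have "n \<le> N" using assms by simp
  then have sub: "basis F n \<subseteq> basis F N" by (rule basis_mono)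
  \<comment> \<open>Conversely, the adjoint of zero-padding restricts to the labels in
    \<open>basis F n\<close>, which is the pullback along the inclusion.\<close>
  have "embed_adj F ZeroPad n N x = lin F ZeroPad n N (\<lambda>i. i) x"
    by (simp add: embed_adj_def embed_matr_eq)
  also have "\<dots> = lin F Dupl n N (\<lambda>i. i) x"
  proof
    fix b
    have "{c. c \<in> basis F N \<and> c = b} = (if b \<in> basis F N then {b} else {})" by auto
    then show "lin F ZeroPad n N (\<lambda>i. i) x b = lin F Dupl n N (\<lambda>i. i) x b"
      using sub gram_pos[of b F n] by (auto simp: lin_Dupl lin_ZeroPad simp del: lin.simps)
  qed
  finally show ?thesis by (simp add: Dupl)
next
  case ZeroPad
  then show ?thesis by (simp add: embed_adj_def embed_matr_eq)
qed

primrec perm_map :: "base_seq \<Rightarrow> (nat \<Rightarrow> nat) \<Rightarrow> nat \<Rightarrow> nat" where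
  "perm_map Dupl \<sigma> = inv \<sigma>"
| "perm_map ZeroPad \<sigma> = \<sigma>"

text \<open>A bijective relabelling has singleton fibres and preserves Gram entries, so pulling back
  along \<open>inv \<sigma>\<close> is pushing forward along \<open>\<sigma>\<close>.\<close>

lemma act_eq:
  assumes "\<sigma> permutes {..<n}"
  shows "act F n \<sigma> x = lin F S n n (perm_map S \<sigma>) x"
proof (cases S)
  case Dupl
  then show ?thesis by (simp add: act_def rho_matr_def[abs_def])
next
  case ZeroPad
  have *: "{b. b \<in> basis F n \<and> relabel \<sigma> b = a} = {relabel (inv \<sigma>) a}" if "a \<in> basis F n" for a
  proof -
    have "relabel (inv \<sigma>) a \<in> basis F n"
      using that permutes_in_image[OF permutes_inv[OF assms]] by (intro relabel_basis') auto
    then show ?thesis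
      using permutes_inverses[OF assms] permutes_inv_o[OF assms] by (auto simp: id_def)
  qed
  have "act F n \<sigma> x = lin F Dupl n n (inv \<sigma>) x"
    by (simp add: act_def rho_matr_def[abs_def])
  also have "\<dots> = lin F ZeroPad n n \<sigma> x"
  proof
    fix a
    have "relabel (inv \<sigma>) a \<in> basis F n" if "a \<in> basis F n"
      using that permutes_in_image[OF permutes_inv[OF assms]] by (intro relabel_basis') auto
    moreover have "gram F (relabel (inv \<sigma>) a) = gram F a"
      using permutes_inj[OF permutes_inv[OF assms]] by (rule gram_relabel)
    ultimately show "lin F Dupl n n (inv \<sigma>) x a = lin F ZeroPad n n \<sigma> x a"
      using * gram_pos[of a F n] by (auto simp: lin_Dupl lin_ZeroPad simp del: lin.simps)
  qed
  finally show ?thesis by (simp add: ZeroPad)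
qed

subsection \<open>Averages over random index maps\<close>

definition avg :: "('a \<Rightarrow> real) \<Rightarrow> 'a set \<Rightarrow> real" where
  "avg G A = (\<Sum>a\<in>A. G a) / card A"

lemma avg_cong: "A = B \<Longrightarrow> (\<And>a. a \<in> B \<Longrightarrow> G a = H a) \<Longrightarrow> avg G A = avg H B"
  by (simp add: avg_def cong: sum.cong)

lemma avg_swap: "avg (\<lambda>a. avg (G a) B) A = avg (\<lambda>b. avg (\<lambda>a. G a b) A) B"
  unfolding avg_def
  by (simp add: sum_divide_distrib[symmetric] mult.commute sum.swap[of G])

lemma avg_sum: "avg (\<lambda>a. \<Sum>i\<in>I. G i a) A = (\<Sum>i\<in>I. avg (G i) A)"
  unfolding avg_def by (subst sum.swap) (simp add: sum_divide_distrib)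

lemma avg_cmult: "avg (\<lambda>a. c * G a) A = c * avg G A"
  by (simp add: avg_def sum_distrib_left)

lemma avg_diff: "avg (\<lambda>a. G a - H a) A = avg G A - avg H A"
  by (simp add: avg_def sum_subtractf diff_divide_distrib)

lemma avg_bij: "bij_betw h A B \<Longrightarrow> avg (\<lambda>a. G (h a)) A = avg G B"
  by (simp add: avg_def sum.reindex_bij_betw bij_betw_same_card)

lemma avg_ge:
  assumes "finite A" "A \<noteq> {}" "\<And>a. a \<in> A \<Longrightarrow> c \<le> G a"
  shows "c \<le> avg G A"
proof -
  have "card A * c \<le> (\<Sum>a\<in>A. G a)"
    using sum_bounded_below[of A c G] assms(3) by simp
  then show ?thesis using assms(1,2) by (simp add: avg_def pos_le_divide_eq card_gt_0_iff mult.commute)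
qed

lemma avg_fibres:
  assumes "finite A" "finite B" "h ` A \<subseteq> B" "c > 0"
    and fibre: "\<And>b. b \<in> B \<Longrightarrow> card {a \<in> A. h a = b} = c"
  shows "avg (\<lambda>a. G (h a)) A = avg G B"
proof -
  have *: "(\<Sum>a\<in>A. H (h a)) = real c * (\<Sum>b\<in>B. H b)" for H
  proof -
    have "(\<Sum>a\<in>A. H (h a)) = (\<Sum>b\<in>B. \<Sum>a | a \<in> A \<and> h a = b. H (h a))"
      by (rule sum.group[symmetric]) (use assms in auto)
    also have "\<dots> = (\<Sum>b\<in>B. real c * H b)"
      by (intro sum.cong refl) (simp add: fibre)
    finally show ?thesis by (simp add: sum_distrib_left)
  qed
  from *[of "\<lambda>_. 1"] show ?thesis
    using \<open>c > 0\<close> by (simp add: avg_def *)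
qed

lemma card_filter_eq:
  assumes "b \<in> B" shows "card {a \<in> B. a = b} = 1"
proof -
  have "{a \<in> B. a = b} = {b}" using assms by auto
  then show ?thesis by simp
qed

text \<open>Every map into \<open>B'\<close> has equally many preimages under restriction along
  \<open>\<iota>\<close> followed by \<open>h\<close>, so a uniform random map stays uniform. The
  consistency statements for random maps below are instances of this.\<close>

lemma avg_PiE:
  assumes fin: "finite A" "finite A'" "finite B" "finite B'" and "B \<noteq> {}"
    and \<iota>: "inj_on \<iota> A'" "\<iota> \<in> A' \<rightarrow> A"
    and h: "h \<in> B \<rightarrow> B'" "c > 0" "\<And>b. b \<in> B' \<Longrightarrow> card {a \<in> B. h a = b} = c"
    and "\<And>f g. (\<And>i. i \<in> A' \<Longrightarrow> f i = g i) \<Longrightarrow> G f = G g"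
  shows "avg (\<lambda>f. G (h \<circ> f \<circ> \<iota>)) (A \<rightarrow>\<^sub>E B) = avg G (A' \<rightarrow>\<^sub>E B')"
proof -
  let ?r = "\<lambda>f. restrict (h \<circ> f \<circ> \<iota>) A'"
  have "avg (\<lambda>f. G (h \<circ> f \<circ> \<iota>)) (A \<rightarrow>\<^sub>E B) = avg (\<lambda>f. G (?r f)) (A \<rightarrow>\<^sub>E B)"
    by (intro avg_cong assms refl) simp
  also have "\<dots> = avg G (A' \<rightarrow>\<^sub>E B')"
  proof (rule avg_fibres)
    show "?r ` (A \<rightarrow>\<^sub>E B) \<subseteq> A' \<rightarrow>\<^sub>E B'"
      using \<iota>(2) h(1) by fastforce
    show "c ^ card A' * card B ^ card (A - \<iota> ` A') > 0"
      using h(2) fin \<open>B \<noteq> {}\<close> by (simp add: card_gt_0_iff)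
    fix g assume g: "g \<in> A' \<rightarrow>\<^sub>E B'"
    \<comment> \<open>\<open>T\<close> collects the values allowed at each point when the composite
      is prescribed to be \<open>g\<close>: a fibre of \<open>h\<close> on the image of
      \<open>\<iota>\<close>, anything elsewhere. The sizes do not depend on
      \<open>g\<close>.\<close>
    define T where "T i = (if i \<in> \<iota> ` A' then {a \<in> B. h a = g (inv_into A' \<iota> i)} else B)" for i
    have "{f \<in> A \<rightarrow>\<^sub>E B. ?r f = g} = Pi\<^sub>E A T"
    proof (intro set_eqI iffI)
      fix f assume "f \<in> {f \<in> A \<rightarrow>\<^sub>E B. ?r f = g}"
      then have f: "f \<in> A \<rightarrow>\<^sub>E B" and "?r f = g" by auto
      then have "h (f (\<iota> i)) = g i" if "i \<in> A'" for i
        using that by (metis comp_apply restrict_apply')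
      then show "f \<in> Pi\<^sub>E A T"
        using f \<iota> by (auto simp: T_def PiE_iff extensional_def)
    next
      fix f assume f: "f \<in> Pi\<^sub>E A T"
      have "f i \<in> B" if "i \<in> A" for i
        using PiE_mem[OF f that] by (auto simp: T_def split: if_splits)
      then have "f \<in> A \<rightarrow>\<^sub>E B" using f by (auto simp: PiE_iff)
      moreover have "?r f = g"
      proof
        fix i
        show "?r f i = g i"
        proof (cases "i \<in> A'")
          case True
          then have "f (\<iota> i) \<in> T (\<iota> i)" using f \<iota>(2) by (auto simp: PiE_iff)
          then show ?thesis using True \<iota>(1) by (simp add: T_def)
        next
          case False
          then show ?thesis using g by (simp add: PiE_iff extensional_def)
        qed
      qed
      ultimately show "f \<in> {f \<in> A \<rightarrow>\<^sub>E B. ?r f = g}" by simp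
    qed
    then have "card {f \<in> A \<rightarrow>\<^sub>E B. ?r f = g} = (\<Prod>i\<in>A. card (T i))"
      using fin by (simp add: card_PiE)
    also have "\<dots> = (\<Prod>i\<in>\<iota> ` A'. card (T i)) * (\<Prod>i\<in>A - \<iota> ` A'. card (T i))"
      using \<iota>(2) fin(1) by (subst mult.commute, intro prod.subset_diff) auto
    also have "(\<Prod>i\<in>\<iota> ` A'. card (T i)) = (\<Prod>i\<in>A'. card (T (\<iota> i)))"
      using \<iota>(1) by (simp add: prod.reindex)
    also have "\<dots> = (\<Prod>i\<in>A'. c)"
      by (intro prod.cong refl) (use \<iota>(1) h(3) g in \<open>auto simp: T_def PiE_iff\<close>)
    also have "(\<Prod>i\<in>A - \<iota> ` A'. card (T i)) = (\<Prod>i\<in>A - \<iota> ` A'. card B)"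
      by (intro prod.cong) (auto simp: T_def)
    finally show "card {f \<in> A \<rightarrow>\<^sub>E B. ?r f = g} = c ^ card A' * card B ^ card (A - \<iota> ` A')"
      by (simp only: prod_constant)
  qed (use fin in \<open>auto intro: finite_PiE\<close>)
  finally show ?thesis .
qed

text \<open>The index maps under which uniform random maps remain uniform: equal fibres serve for
  composing after the random map, injectivity for composing before it.\<close>

primrec balanced :: "base_seq \<Rightarrow> nat \<Rightarrow> nat \<Rightarrow> (nat \<Rightarrow> nat) \<Rightarrow> bool" where
  "balanced Dupl N n j \<longleftrightarrow>
     j \<in> {..<N} \<rightarrow> {..<n} \<and> (\<exists>c>0. \<forall>i<n. card {l \<in> {..<N}. j l = i} = c)"
| "balanced ZeroPad N n j \<longleftrightarrow> j \<in> {..<n} \<rightarrow> {..<N} \<and> inj_on j {..<n}"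

lemma balanced_index_maps:
  "balanced S N n j \<Longrightarrow> j \<in> index_maps S N n"
  "balanced (opposite S) N n j \<Longrightarrow> j \<in> index_maps S n N"
  by (cases S; simp)+

lemma ext_maps_subset: "f \<in> ext_maps S m n \<Longrightarrow> f \<in> index_maps S m n"
  by (cases S) auto

lemma finite_ext_maps [simp]: "finite (ext_maps S m n)"
  by (cases S) (auto intro: finite_PiE)

lemma ext_maps_nonempty: "m > 0 \<Longrightarrow> n > 0 \<Longrightarrow> ext_maps S m n \<noteq> {}"
  by (cases S) (auto simp: PiE_eq_empty_iff)

definition rand_avg ::
  "construction \<Rightarrow> base_seq \<Rightarrow> nat \<Rightarrow> nat \<Rightarrow> (coord_vec \<Rightarrow> real) \<Rightarrow> coord_vec \<Rightarrow> real" where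
  "rand_avg F S m n G x = avg (\<lambda>f. G (lin F S m n f x)) (ext_maps S m n)"

lemma expectation_deFinetti:
  assumes "m > 0" "n > 0"
  shows "measure_pmf.expectation (deFinetti F S m n) (\<lambda>\<Lambda>. G (\<Lambda> x)) = rand_avg F S m n G x"
proof -
  have "deFinetti F S m n = map_pmf (lin F S m n) (pmf_of_set (ext_maps S m n))"
    by (cases S) (simp_all add: lin.simps[abs_def])
  then show ?thesis using assms
    by (simp add: integral_pmf_of_set ext_maps_nonempty rand_avg_def avg_def)
qed

text \<open>The random map absorbs the embeddings of the sequence \<open>S\<close>; this makes the
  averages of one function on \<open>V_m\<close> a compatible sequence.\<close>

lemma rand_avg_right:
  assumes "balanced S N n j" "m > 0" "n > 0" "N > 0"
  shows "rand_avg F S m N G (lin F S N n j x) = rand_avg F S m n G x"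
proof -
  have eq: "rand_avg F S m N G (lin F S N n j x) =
      avg (\<lambda>f. G (lin F S m n (compose_maps S f j) x)) (ext_maps S m N)"
    unfolding rand_avg_def
    using assms(1) by (intro avg_cong) (auto simp: lin_lin ext_maps_subset balanced_index_maps)
  show ?thesis
  proof (cases S)
    case Dupl
    obtain c where c: "c > 0" "\<forall>i<n. card {l \<in> {..<N}. j l = i} = c"
      using assms(1) by (auto simp: Dupl)
    have "avg (\<lambda>f. G (lin F Dupl m n (j \<circ> f \<circ> (\<lambda>i. i)) x)) ({..<m} \<rightarrow>\<^sub>E {..<N}) =
        avg (\<lambda>f. G (lin F Dupl m n f x)) ({..<m} \<rightarrow>\<^sub>E {..<n})"
      by (rule avg_PiE[where c = c])
        (use assms c in \<open>auto simp: Dupl simp del: lin.simps intro!: arg_cong[where f = G] fun_cong[OF lin_cong]\<close>)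
    then show ?thesis unfolding eq by (simp add: Dupl rand_avg_def o_def del: lin.simps)
  next
    case ZeroPad
    have "avg (\<lambda>f. G (lin F ZeroPad m n ((\<lambda>i. i) \<circ> f \<circ> j) x)) ({..<N} \<rightarrow>\<^sub>E {..<m}) =
        avg (\<lambda>f. G (lin F ZeroPad m n f x)) ({..<n} \<rightarrow>\<^sub>E {..<m})"
    proof (rule avg_PiE[where c = 1])
      show "card {a \<in> {..<m}. a = b} = 1" if "b \<in> {..<m}" for b
        using that by (rule card_filter_eq)
    qed (use assms in \<open>auto simp: ZeroPad simp del: lin.simps intro!: arg_cong[where f = G] fun_cong[OF lin_cong]\<close>)
    then show ?thesis unfolding eq by (simp add: ZeroPad rand_avg_def o_def del: lin.simps)
  qed
qed

text \<open>Absorption on the side of the target, for the opposite sequence. It serves twice: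
  symmetrization becomes invisible to averages, and the de Finetti laws become projective.\<close>

lemma rand_avg_left:
  assumes "balanced (opposite S) M m j" "m > 0" "n > 0" "M > 0"
  shows "rand_avg F S M n (\<lambda>y. G (lin F S m M j y)) x = rand_avg F S m n G x"
proof -
  have eq: "rand_avg F S M n (\<lambda>y. G (lin F S m M j y)) x =
      avg (\<lambda>f. G (lin F S m n (compose_maps S j f) x)) (ext_maps S M n)"
    unfolding rand_avg_def
    using assms(1) by (intro avg_cong) (auto simp: lin_lin ext_maps_subset balanced_index_maps)
  show ?thesis
  proof (cases S)
    case ZeroPad
    obtain c where c: "c > 0" "\<forall>i<m. card {l \<in> {..<M}. j l = i} = c"
      using assms(1) by (auto simp: ZeroPad)
    have "avg (\<lambda>f. G (lin F ZeroPad m n (j \<circ> f \<circ> (\<lambda>i. i)) x)) ({..<n} \<rightarrow>\<^sub>E {..<M}) =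
        avg (\<lambda>f. G (lin F ZeroPad m n f x)) ({..<n} \<rightarrow>\<^sub>E {..<m})"
      by (rule avg_PiE[where c = c])
        (use assms c in \<open>auto simp: ZeroPad simp del: lin.simps intro!: arg_cong[where f = G] fun_cong[OF lin_cong]\<close>)
    then show ?thesis unfolding eq by (simp add: ZeroPad rand_avg_def o_def del: lin.simps)
  next
    case Dupl
    have "avg (\<lambda>f. G (lin F Dupl m n ((\<lambda>i. i) \<circ> f \<circ> j) x)) ({..<M} \<rightarrow>\<^sub>E {..<n}) =
        avg (\<lambda>f. G (lin F Dupl m n f x)) ({..<m} \<rightarrow>\<^sub>E {..<n})"
    proof (rule avg_PiE[where c = 1])
      show "card {a \<in> {..<n}. a = b} = 1" if "b \<in> {..<n}" for b
        using that by (rule card_filter_eq)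
    qed (use assms in \<open>auto simp: Dupl simp del: lin.simps intro!: arg_cong[where f = G] fun_cong[OF lin_cong]\<close>)
    then show ?thesis unfolding eq by (simp add: Dupl rand_avg_def o_def del: lin.simps)
  qed
qed

lemma card_div_fibre:
  assumes "c > 0" "i < n"
  shows "card {l \<in> {..<n * c}. l div c = i} = (c::nat)"
proof -
  have "{l \<in> {..<n * c}. l div c = i} = {i * c..<i * c + c}"
  proof (intro set_eqI iffI)
    fix l assume "l \<in> {i * c..<i * c + c}"
    then have l: "i * c \<le> l" "l < Suc i * c" by auto
    moreover have "Suc i * c \<le> n * c" using assms(2) by (intro mult_right_mono) auto
    ultimately have "l < n * c" by linarith
    then show "l \<in> {l \<in> {..<n * c}. l div c = i}"
      using l by (auto intro!: div_nat_eqI simp: mult.commute)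
  next
    fix l assume "l \<in> {l \<in> {..<n * c}. l div c = i}"
    then show "l \<in> {i * c..<i * c + c}"
      using dividend_less_times_div[OF assms(1), of l] by (auto simp: ac_simps)
  qed
  then show ?thesis by simp
qed

lemma balanced_embed_map:
  assumes "index_le S n N"
  shows "balanced S N n (embed_map S n N)"
proof (cases S)
  case Dupl
  then obtain c where N: "N = n * c" and "n > 0" "N > 0" using assms by auto
  then have c: "c > 0" "N div n = c" by auto
  have "i div c < n" if "i < N" for i
    using that c by (simp add: N less_mult_imp_div_less)
  moreover have "\<forall>i<n. card {l \<in> {..<N}. l div c = i} = c"
    using card_div_fibre[OF c(1)] by (simp add: N)
  ultimately show ?thesis using c by (auto simp: Dupl)
qed (use assms in \<open>auto simp: inj_on_def\<close>)

lemma permutes_lessThan: "\<sigma> permutes {..<n::nat} \<Longrightarrow> \<sigma> i < n \<longleftrightarrow> i < n"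
  using permutes_in_image[of \<sigma> "{..<n}" i] by simp

lemma permutes_perm_map: "\<sigma> permutes A \<Longrightarrow> perm_map S \<sigma> permutes A"
  by (cases S) (auto simp: permutes_inv)

lemma balanced_permutes:
  assumes "\<sigma> permutes {..<n}"
  shows "balanced S n n \<sigma>"
proof (cases S)
  case Dupl
  have "{l \<in> {..<n}. \<sigma> l = i} = {inv \<sigma> i}" if "i < n" for i
    using that permutes_lessThan[OF permutes_inv[OF assms]] permutes_inverses[OF assms] by auto
  then have "\<forall>i<n. card {l \<in> {..<n}. \<sigma> l = i} = 1" by simp
  then show ?thesis using assms by (auto simp: Dupl permutes_lessThan intro!: exI[of _ 1])
qed (use assms in \<open>auto simp: permutes_lessThan permutes_inj_on\<close>)

lemma extend_to_permutation:
  assumes "finite A" "S \<subseteq> A" "inj_on f S" "f ` S \<subseteq> A"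
  obtains \<sigma> where "\<sigma> permutes A" "\<And>i. i \<in> S \<Longrightarrow> \<sigma> i = f i"
proof -
  have "card (f ` S) = card S" using assms(3) by (rule card_image)
  then have "card (A - S) = card (A - f ` S)"
    using assms by (simp add: card_Diff_subset finite_subset)
  then obtain g where g: "bij_betw g (A - S) (A - f ` S)"
    using assms(1) by (metis bij_betw_iff_card finite_Diff)
  define \<sigma> where "\<sigma> i = (if i \<in> S then f i else if i \<in> A then g i else i)" for i
  have "bij_betw \<sigma> (S \<union> (A - S)) (f ` S \<union> (A - f ` S))"
  proof (rule bij_betw_combine)
    show "bij_betw \<sigma> S (f ` S)"
      using assms(3) by (auto simp: bij_betw_def \<sigma>_def inj_on_def)
    have "bij_betw g (A - S) (A - f ` S) = bij_betw \<sigma> (A - S) (A - f ` S)"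
      by (rule bij_betw_cong) (auto simp: \<sigma>_def)
    with g show "bij_betw \<sigma> (A - S) (A - f ` S)" by simp
  qed auto
  moreover have "S \<union> (A - S) = A" "f ` S \<union> (A - f ` S) = A" using assms by auto
  ultimately have "bij_betw \<sigma> A A" by simp
  then have "\<sigma> permutes A"
    by (rule bij_imp_permutes) (use assms(2) in \<open>auto simp: \<sigma>_def\<close>)
  then show ?thesis using that by (auto simp: \<sigma>_def)
qed

subsection \<open>Symmetrization\<close>

abbreviation perms :: "nat \<Rightarrow> (nat \<Rightarrow> nat) set" where
  "perms n \<equiv> {\<sigma>. \<sigma> permutes {..<n}}"

lemma card_perms: "card (perms n) = fact n"
  by (simp add: card_permutations)

lemma finite_perms [simp]: "finite (perms n)"
  by (simp add: finite_permutations)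

lemma perms_nonempty: "perms n \<noteq> {}"
  using permutes_id by blast

lemma avg_perms_const [simp]: "avg (\<lambda>_. c) (perms n) = c"
  by (simp add: avg_def card_perms)

lemma avg_perms_comp_right:
  "\<tau> permutes {..<n} \<Longrightarrow> avg (\<lambda>\<sigma>. G (\<sigma> \<circ> \<tau>)) (perms n) = avg G (perms n)"
  by (rule avg_bij[where h = "\<lambda>\<sigma>. \<sigma> \<circ> \<tau>"], rule bij_betw_byWitness[where f' = "\<lambda>\<sigma>. \<sigma> \<circ> inv \<tau>"])
    (auto simp: comp_assoc permutes_inv_o permutes_compose permutes_inv)

lemma avg_perms_comp_left:
  "\<tau> permutes {..<n} \<Longrightarrow> avg (\<lambda>\<sigma>. G (\<tau> \<circ> \<sigma>)) (perms n) = avg G (perms n)"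
  by (rule avg_bij[where h = "\<lambda>\<sigma>. \<tau> \<circ> \<sigma>"], rule bij_betw_byWitness[where f' = "\<lambda>\<sigma>. inv \<tau> \<circ> \<sigma>"])
    (auto simp: comp_assoc[symmetric] permutes_inv_o permutes_compose permutes_inv)

lemma avg_perms_inv: "avg (\<lambda>\<sigma>. G (inv \<sigma>)) (perms n) = avg G (perms n)"
  by (rule avg_bij, rule bij_betw_byWitness[where f' = inv])
    (auto simp: permutes_inv permutes_inv_inv)

definition sym_map :: "base_seq \<Rightarrow> nat \<Rightarrow> nat \<Rightarrow> (nat \<Rightarrow> nat) \<Rightarrow> nat \<Rightarrow> nat" where
  "sym_map S k n \<sigma> = compose_maps S (embed_map (opposite S) k n) (perm_map S \<sigma>)"

definition sym_avg ::
  "construction \<Rightarrow> base_seq \<Rightarrow> nat \<Rightarrow> nat \<Rightarrow> (coord_vec \<Rightarrow> real) \<Rightarrow> coord_vec \<Rightarrow> real" where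
  "sym_avg F S k n G x = avg (\<lambda>\<sigma>. G (lin F S k n (sym_map S k n \<sigma>) x)) (perms n)"

lemma embed_adj_act_eq:
  assumes "index_le (opposite S) k n" "\<sigma> permutes {..<n}"
  shows "embed_adj F (opposite S) k n (act F n \<sigma> x) = lin F S k n (sym_map S k n \<sigma>) x"
  unfolding embed_adj_eq[OF assms(1)] act_eq[OF assms(2), of F x S] sym_map_def
  using assms
  by (intro lin_lin balanced_index_maps balanced_embed_map balanced_permutes permutes_perm_map)

lemma free_sym_eq:
  assumes "index_le (opposite S) k n"
  shows "free_sym F (opposite S) k n q x = sym_avg F S k n (peval q) x"
  using assms by (simp add: free_sym_def sym_avg_def avg_def card_perms embed_adj_act_eq)

lemma balanced_sym_map:
  assumes "index_le (opposite S) k n" "\<sigma> permutes {..<n}"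
  shows "balanced (opposite S) n k (sym_map S k n \<sigma>)"
proof (cases S)
  case Dupl
  then show ?thesis
    using assms permutes_inv[OF assms(2)]
    by (auto simp: sym_map_def permutes_lessThan inj_on_def dest: permutes_inj[THEN injD])
next
  case ZeroPad
  let ?j = "embed_map Dupl k n"
  obtain c where j: "?j \<in> {..<n} \<rightarrow> {..<k}" and c: "c > 0" "\<forall>i<k. card {l \<in> {..<n}. ?j l = i} = c"
    using balanced_embed_map[OF assms(1)] by (auto simp: ZeroPad simp del: embed_map.simps)
  have "card {l \<in> {..<n}. ?j (\<sigma> l) = i} = card {l \<in> {..<n}. ?j l = i}" for i
    by (rule bij_betw_same_card[of \<sigma>], rule bij_betw_byWitness[where f' = "inv \<sigma>"])
      (use assms(2) permutes_lessThan[OF assms(2)] permutes_lessThan[OF permutes_inv[OF assms(2)]]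
        permutes_inverses[OF assms(2)] in auto)
  moreover have "?j \<circ> \<sigma> \<in> {..<n} \<rightarrow> {..<k}"
    using j permutes_lessThan[OF assms(2)] by (auto simp: Pi_iff simp del: embed_map.simps)
  ultimately show ?thesis
    using c by (auto simp: ZeroPad sym_map_def simp del: embed_map.simps)
qed

text \<open>Each \<open>sym_map\<close> is balanced for the opposite sequence, so every summand of
  the symmetrization has the same average. Averages therefore see a polynomial only through its
  symmetrization.\<close>

lemma rand_avg_sym:
  assumes "index_le (opposite S) k n" "m > 0"
  shows "rand_avg F S n m (sym_avg F S k n G) x = rand_avg F S k m G x"
proof -
  have pos: "k > 0" "n > 0" using assms(1) by (cases S; simp)+
  have "rand_avg F S n m (sym_avg F S k n G) x =
      avg (\<lambda>\<sigma>. rand_avg F S n m (\<lambda>y. G (lin F S k n (sym_map S k n \<sigma>) y)) x) (perms n)"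
    unfolding rand_avg_def sym_avg_def by (rule avg_swap)
  also have "\<dots> = avg (\<lambda>\<sigma>. rand_avg F S k m G x) (perms n)"
    using assms pos by (intro avg_cong refl rand_avg_left balanced_sym_map) auto
  finally show ?thesis by simp
qed

lemma inv_comp: "\<sigma> permutes A \<Longrightarrow> \<tau> permutes A \<Longrightarrow> inv \<tau> \<circ> inv \<sigma> = inv (\<sigma> \<circ> \<tau>)"
  by (simp add: o_inv_distrib permutes_bij)

lemma sym_avg_act:
  assumes "index_le (opposite S) k n" "\<tau> permutes {..<n}"
  shows "sym_avg F S k n G (act F n \<tau> x) = sym_avg F S k n G x"
proof -
  have "sym_avg F S k n G (act F n \<tau> x) =
      avg (\<lambda>\<sigma>. G (lin F S k n (sym_map S k n (\<sigma> \<circ> \<tau>)) x)) (perms n)"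
    unfolding sym_avg_def
  proof (rule avg_cong[OF refl])
    fix \<sigma> assume "\<sigma> \<in> perms n"
    then have \<sigma>: "\<sigma> permutes {..<n}" by simp
    have "compose_maps S (sym_map S k n \<sigma>) (perm_map S \<tau>) = sym_map S k n (\<sigma> \<circ> \<tau>)"
      using inv_comp[OF \<sigma> assms(2)] by (cases S) (auto simp: sym_map_def o_assoc)
    then show "G (lin F S k n (sym_map S k n \<sigma>) (act F n \<tau> x)) =
        G (lin F S k n (sym_map S k n (\<sigma> \<circ> \<tau>)) x)"
      using assms \<sigma>
      by (simp add: act_eq[of \<tau> n F x S] lin_lin balanced_index_maps balanced_sym_map
          balanced_permutes permutes_perm_map)
  qed
  also have "\<dots> = sym_avg F S k n G x"
    unfolding sym_avg_def using assms(2) by (rule avg_perms_comp_right)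
  finally show ?thesis .
qed

text \<open>Blocks of length \<open>c\<close> are permuted as \<open>\<sigma>\<close> does, keeping
  the offset inside a block. Duplication identifies the points of a block, so this permutation
  induces \<open>\<sigma>\<close> below.\<close>

lemma lift_block_permutation:
  fixes c :: nat
  assumes "\<sigma> permutes {..<n}" "c > 0"
  obtains \<sigma>' where "\<sigma>' permutes {..<n * c}" "\<And>l. l < n * c \<Longrightarrow> \<sigma>' l div c = \<sigma> (l div c)"
proof -
  define B where "B \<sigma> l = (if l < n * c then \<sigma> (l div c) * c + l mod c else l)" for \<sigma> :: "nat \<Rightarrow> nat" and l
  have lt: "\<sigma> (l div c) * c + l mod c < n * c" if "l < n * c" "\<sigma> permutes {..<n}" for \<sigma> l
  proof -
    have "\<sigma> (l div c) < n" using that by (simp add: permutes_lessThan less_mult_imp_div_less)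
    then have "Suc (\<sigma> (l div c)) * c \<le> n * c" by (intro mult_right_mono) auto
    moreover have "l mod c < c" using assms(2) by simp
    ultimately show ?thesis by simp
  qed
  have inv: "B \<sigma> (B (inv \<sigma>) l) = l" if "\<sigma> permutes {..<n}" for \<sigma> l
    using lt[OF _ permutes_inv[OF that], of l] permutes_inverses[OF that] assms(2)
    by (simp add: B_def)
  have bij: "bij_betw (B \<sigma>) {..<n * c} {..<n * c}"
    by (rule bij_betw_byWitness[where f' = "B (inv \<sigma>)"])
      (use inv[OF assms(1)] inv[OF permutes_inv[OF assms(1)]] lt[OF _ assms(1)]
        lt[OF _ permutes_inv[OF assms(1)]] in \<open>auto simp: permutes_inv_inv[OF assms(1)]\<close>,
       auto simp: B_def)
  have "B \<sigma> permutes {..<n * c}"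
    using bij by (rule bij_imp_permutes) (simp add: B_def)
  moreover have "B \<sigma> l div c = \<sigma> (l div c)" if "l < n * c" for l
    using that assms(2) by (simp add: B_def)
  ultimately show ?thesis using that by blast
qed

text \<open>An inner permutation of \<open>n\<close> points can be replaced by one of
  \<open>N\<close> points, which the outer average over \<open>\<tau>\<close> absorbs: the same
  permutation fixing the added points for pullbacks, a permutation of blocks for
  pushforwards.\<close>

lemma sym_avg_sym_avg:
  assumes kn: "index_le (opposite S) k n" and nN: "index_le (opposite S) n N"
  shows "sym_avg F S k N G x = avg (\<lambda>\<tau>. sym_avg F S k n G (lin F S n N (sym_map S n N \<tau>) x)) (perms N)"
proof -
  have "\<exists>\<sigma>'. \<sigma>' permutes {..<N} \<and> (\<forall>\<tau>. \<tau> permutes {..<N} \<longrightarrow>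
      lin F S k n (sym_map S k n \<sigma>) (lin F S n N (sym_map S n N \<tau>) x) =
      lin F S k N (sym_map S k N (\<sigma>' \<circ> \<tau>)) x)" if \<sigma>: "\<sigma> permutes {..<n}" for \<sigma>
  proof -
    have l: "lin F S k n (sym_map S k n \<sigma>) (lin F S n N (sym_map S n N \<tau>) x) =
        lin F S k N (compose_maps S (sym_map S k n \<sigma>) (sym_map S n N \<tau>)) x"
      if "\<tau> permutes {..<N}" for \<tau>
      using \<sigma> that assms by (intro lin_lin balanced_index_maps balanced_sym_map)
    show ?thesis
    proof (cases S)
      case Dupl
      have \<sigma>': "\<sigma> permutes {..<N}"
        using \<sigma> nN by (auto simp: Dupl intro: permutes_subset)
      have "compose_maps S (sym_map S k n \<sigma>) (sym_map S n N \<tau>) = sym_map S k N (\<sigma> \<circ> \<tau>)"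
        if "\<tau> permutes {..<N}" for \<tau>
        using inv_comp[OF \<sigma>' that] by (simp add: Dupl sym_map_def o_def)
      then show ?thesis using l \<sigma>' by auto
    next
      case ZeroPad
      obtain c b where N: "N = n * c" and n: "n = k * b" and pos: "k > 0" "n > 0" "N > 0"
        using assms by (auto simp: ZeroPad elim!: dvdE)
      have div: "N div n = c" "n div k = b" "N div k = b * c" "c > 0"
        using pos by (auto simp: N n)
      obtain \<sigma>' where \<sigma>': "\<sigma>' permutes {..<N}" "\<And>l. l < N \<Longrightarrow> \<sigma>' l div c = \<sigma> (l div c)"
        using lift_block_permutation[OF \<sigma> div(4)] N by auto
      have "lin F S k N (compose_maps S (sym_map S k n \<sigma>) (sym_map S n N \<tau>)) x =
          lin F S k N (sym_map S k N (\<sigma>' \<circ> \<tau>)) x" if \<tau>: "\<tau> permutes {..<N}" for \<tau>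
      proof (rule fun_cong[OF lin_cong])
        fix i assume "i < (case S of Dupl \<Rightarrow> k | ZeroPad \<Rightarrow> N)"
        then have "\<tau> i < N" using \<tau> by (simp add: ZeroPad permutes_lessThan)
        then show "compose_maps S (sym_map S k n \<sigma>) (sym_map S n N \<tau>) i =
            sym_map S k N (\<sigma>' \<circ> \<tau>) i"
          using \<sigma>'(2)[of "\<tau> i"]
          by (simp add: ZeroPad sym_map_def div mult.commute[of b c] div_mult2_eq)
      qed
      then show ?thesis using l \<sigma>'(1) by auto
    qed
  qed
  then obtain \<phi> where \<phi>: "\<And>\<sigma>. \<sigma> permutes {..<n} \<Longrightarrow> \<phi> \<sigma> permutes {..<N}"
    "\<And>\<sigma> \<tau>. \<sigma> permutes {..<n} \<Longrightarrow> \<tau> permutes {..<N} \<Longrightarrow>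
      lin F S k n (sym_map S k n \<sigma>) (lin F S n N (sym_map S n N \<tau>) x) =
      lin F S k N (sym_map S k N (\<phi> \<sigma> \<circ> \<tau>)) x"
    by metis
  have "avg (\<lambda>\<tau>. sym_avg F S k n G (lin F S n N (sym_map S n N \<tau>) x)) (perms N) =
      avg (\<lambda>\<sigma>. avg (\<lambda>\<tau>. G (lin F S k n (sym_map S k n \<sigma>) (lin F S n N (sym_map S n N \<tau>) x))) (perms N)) (perms n)"
    unfolding sym_avg_def by (rule avg_swap)
  also have "\<dots> = avg (\<lambda>\<sigma>. avg (\<lambda>\<tau>. G (lin F S k N (sym_map S k N (\<phi> \<sigma> \<circ> \<tau>)) x)) (perms N)) (perms n)"
    by (intro avg_cong refl) (simp add: \<phi>)
  also have "\<dots> = avg (\<lambda>\<sigma>. sym_avg F S k N G x) (perms n)"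
    unfolding sym_avg_def using \<phi>(1)
    by (intro avg_cong refl avg_perms_comp_left[where G = "\<lambda>\<tau>. G (lin F S k N (sym_map S k N \<tau>) x)"]) auto
  finally show ?thesis by simp
qed

section \<open>Random maps compared with random permutations\<close>

lemma card_PiE_const_on_pair:
  assumes "i < n" "j < n" "i \<noteq> (j::nat)"
  shows "card {f \<in> {..<n} \<rightarrow>\<^sub>E {..<m}. f i = f j} \<le> m ^ (n - 1)"
proof -
  let ?A = "{f \<in> {..<n} \<rightarrow>\<^sub>E {..<m}. f i = f j}" and ?r = "\<lambda>f. restrict f ({..<n} - {j})"
  have "inj_on ?r ?A"
  proof (rule inj_onI)
    fix f g assume fg: "f \<in> ?A" "g \<in> ?A" "?r f = ?r g"
    have eq: "f l = g l" if "l < n" "l \<noteq> j" for l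
      using fun_cong[OF fg(3), of l] that by simp
    have "f j = g j" using eq[OF assms(1,3)] fg(1,2) by simp
    show "f = g"
    proof (rule PiE_ext)
      show "f \<in> {..<n} \<rightarrow>\<^sub>E {..<m}" "g \<in> {..<n} \<rightarrow>\<^sub>E {..<m}" using fg by auto
      show "f l = g l" if "l \<in> {..<n}" for l
        using that eq[of l] \<open>f j = g j\<close> by (cases "l = j") auto
    qed
  qed
  moreover have "?r ` ?A \<subseteq> ({..<n} - {j}) \<rightarrow>\<^sub>E {..<m}"
  proof (rule image_subsetI)
    fix f assume "f \<in> ?A"
    then have "f l \<in> {..<m}" if "l \<in> {..<n}" for l using that by (blast dest: PiE_mem)
    then show "?r f \<in> ({..<n} - {j}) \<rightarrow>\<^sub>E {..<m}" by (simp add: restrict_PiE_iff)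
  qed
  moreover have "finite (({..<n} - {j}) \<rightarrow>\<^sub>E {..<m})"
    by (rule finite_PiE) simp_all
  ultimately have "card ?A \<le> card (({..<n} - {j}) \<rightarrow>\<^sub>E {..<m})"
    by (rule card_inj_on_le)
  also have "\<dots> = m ^ (n - 1)" using assms(2) by (simp add: card_PiE)
  finally show ?thesis .
qed

lemma card_not_inj_on_le:
  assumes "S \<subseteq> {..<n}"
  shows "card {f \<in> {..<n} \<rightarrow>\<^sub>E {..<m}. \<not> inj_on f S} \<le> (card S choose 2) * m ^ (n - 1)"
proof -
  have fin: "finite S" using assms finite_subset by blast
  let ?K = "{K. K \<subseteq> S \<and> card K = 2}"
  let ?B = "\<lambda>K. {f \<in> {..<n} \<rightarrow>\<^sub>E {..<m}. \<forall>i\<in>K. \<forall>j\<in>K. f i = f j}"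
  have "{f \<in> {..<n} \<rightarrow>\<^sub>E {..<m}. \<not> inj_on f S} \<subseteq> (\<Union>K\<in>?K. ?B K)"
  proof
    fix f assume f: "f \<in> {f \<in> {..<n} \<rightarrow>\<^sub>E {..<m}. \<not> inj_on f S}"
    then obtain i j where "i \<in> S" "j \<in> S" "i \<noteq> j" "f i = f j" by (auto simp: inj_on_def)
    then have "{i, j} \<in> ?K" "f \<in> ?B {i, j}" using f by auto
    then show "f \<in> (\<Union>K\<in>?K. ?B K)" by blast
  qed
  then have "card {f \<in> {..<n} \<rightarrow>\<^sub>E {..<m}. \<not> inj_on f S} \<le> card (\<Union>K\<in>?K. ?B K)"
    using fin by (intro card_mono) (auto intro: finite_subset[OF _ finite_PiE[of "{..<n}" "\<lambda>_. {..<m}"]])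
  also have "\<dots> \<le> (\<Sum>K\<in>?K. card (?B K))"
    using fin by (intro card_UN_le) auto
  also have "\<dots> \<le> (\<Sum>K\<in>?K. m ^ (n - 1))"
  proof (rule sum_mono)
    fix K assume "K \<in> ?K"
    then obtain i j where K: "K = {i, j}" "i \<noteq> j" "K \<subseteq> S" by (auto simp: card_2_iff)
    have "?B K \<subseteq> {f \<in> {..<n} \<rightarrow>\<^sub>E {..<m}. f i = f j}" unfolding K(1) by blast
    moreover have "{f \<in> {..<n} \<rightarrow>\<^sub>E {..<m}. f i = f j} \<subseteq> ?B K"
      unfolding K(1) by (rule Collect_mono) simp
    ultimately have eq: "?B K = {f \<in> {..<n} \<rightarrow>\<^sub>E {..<m}. f i = f j}" by (rule equalityI)
    have "i < n" "j < n" using K(3) assms unfolding K(1) by blast+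
    then show "card (?B K) \<le> m ^ (n - 1)"
      unfolding eq using K(2) by (rule card_PiE_const_on_pair)
  qed
  also have "\<dots> = (card S choose 2) * m ^ (n - 1)"
    using n_subsets[OF fin, of 2] by simp
  finally show ?thesis .
qed

text \<open>Composition with any \<open>\<tau>\<close> permutes the maps injective on
  \<open>S\<close>, and each of them agrees on \<open>S\<close> with a permutation. So, conditioned
  on injectivity, a random map looks on \<open>S\<close> like a random permutation.\<close>

lemma sum_inj_on_eq_avg_perms:
  assumes "S \<subseteq> {..<n}"
    and cong: "\<And>f g. (\<And>i. i \<in> S \<Longrightarrow> f i = g i) \<Longrightarrow> \<Phi> f = \<Phi> g"
  shows "(\<Sum>f | f \<in> {..<n} \<rightarrow>\<^sub>E {..<n} \<and> inj_on f S. \<Phi> f) =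
    card {f. f \<in> {..<n} \<rightarrow>\<^sub>E {..<n} \<and> inj_on f S} * avg \<Phi> (perms n)"
proof -
  let ?I = "{f. f \<in> {..<n} \<rightarrow>\<^sub>E {..<n} \<and> inj_on f S}"
  let ?t = "\<lambda>\<tau> f. restrict (\<tau> \<circ> f) {..<n}"
  have sub: "?t \<tau> ` ?I \<subseteq> ?I" if \<tau>: "\<tau> permutes {..<n}" for \<tau>
  proof (rule image_subsetI, rule CollectI, rule conjI)
    fix f assume f: "f \<in> ?I"
    then show "?t \<tau> f \<in> {..<n} \<rightarrow>\<^sub>E {..<n}"
      using \<tau> by (auto simp: PiE_iff permutes_lessThan)
    have "inj_on (?t \<tau> f) S = inj_on (\<tau> \<circ> f) S"
      using assms(1) by (intro inj_on_cong) auto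
    then show "inj_on (?t \<tau> f) S"
      using f permutes_inj_on[OF \<tau>] by (simp add: comp_inj_on)
  qed
  have inverse: "?t (inv \<tau>) (?t \<tau> f) = f" if \<tau>: "\<tau> permutes {..<n}" and f: "f \<in> ?I" for \<tau> f
  proof
    fix i
    show "?t (inv \<tau>) (?t \<tau> f) i = f i"
      using permutes_inverses(2)[OF \<tau>] f by (cases "i < n") (auto simp: PiE_iff extensional_def)
  qed
  have bij: "bij_betw (?t \<tau>) ?I ?I" if \<tau>: "\<tau> permutes {..<n}" for \<tau>
  proof (rule bij_betw_byWitness[where f' = "?t (inv \<tau>)"])
    show "\<forall>f\<in>?I. ?t (inv \<tau>) (?t \<tau> f) = f"
      using inverse[OF \<tau>] by (rule ballI)
    show "\<forall>f\<in>?I. ?t \<tau> (?t (inv \<tau>) f) = f"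
      using inverse[OF permutes_inv[OF \<tau>]] unfolding permutes_inv_inv[OF \<tau>] by (rule ballI)
  qed (rule sub[OF \<tau>], rule sub[OF permutes_inv[OF \<tau>]])
  have inj_eq: "avg (\<lambda>\<tau>. \<Phi> (\<tau> \<circ> f)) (perms n) = avg \<Phi> (perms n)" if f: "f \<in> ?I" for f
  proof -
    obtain \<sigma> where \<sigma>: "\<sigma> permutes {..<n}" "\<And>i. i \<in> S \<Longrightarrow> \<sigma> i = f i"
      using extend_to_permutation[of "{..<n}" S f] f assms(1) by (auto simp: PiE_iff)
    have "avg (\<lambda>\<tau>. \<Phi> (\<tau> \<circ> f)) (perms n) = avg (\<lambda>\<tau>. \<Phi> (\<tau> \<circ> \<sigma>)) (perms n)"
    proof (rule avg_cong[OF refl])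
      show "\<Phi> (\<tau> \<circ> f) = \<Phi> (\<tau> \<circ> \<sigma>)" for \<tau>
        using \<sigma>(2) by (intro cong) simp
    qed
    then show ?thesis using avg_perms_comp_right[OF \<sigma>(1)] by simp
  qed
  have "(\<Sum>f\<in>?I. \<Phi> f) = avg (\<lambda>\<tau>. \<Sum>f\<in>?I. \<Phi> f) (perms n)"
    by simp
  also have "\<dots> = avg (\<lambda>\<tau>. \<Sum>f\<in>?I. \<Phi> (\<tau> \<circ> f)) (perms n)"
  proof (rule avg_cong[OF refl])
    fix \<tau> assume "\<tau> \<in> perms n"
    then have "(\<Sum>f\<in>?I. \<Phi> f) = (\<Sum>f\<in>?I. \<Phi> (?t \<tau> f))"
      using sum.reindex_bij_betw[OF bij, of \<tau> \<Phi>] by simp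
    also have "\<dots> = (\<Sum>f\<in>?I. \<Phi> (\<tau> \<circ> f))"
    proof (rule sum.cong[OF refl])
      show "\<Phi> (?t \<tau> f) = \<Phi> (\<tau> \<circ> f)" for f
        using assms(1) by (intro cong) auto
    qed
    finally show "(\<Sum>f\<in>?I. \<Phi> f) = (\<Sum>f\<in>?I. \<Phi> (\<tau> \<circ> f))" .
  qed
  also have "\<dots> = (\<Sum>f\<in>?I. avg \<Phi> (perms n))"
    unfolding avg_sum by (rule sum.cong[OF refl inj_eq])
  finally show ?thesis by simp
qed

lemma avg_uniform_minus_avg_perms:
  assumes "S \<subseteq> {..<n}" "n > 0"
    and cong: "\<And>f g. (\<And>i. i \<in> S \<Longrightarrow> f i = g i) \<Longrightarrow> \<Phi> f = \<Phi> g"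
    and bound: "\<And>f. f \<in> {..<n} \<rightarrow> {..<n} \<Longrightarrow> \<bar>\<Phi> f\<bar> \<le> B"
  shows "\<bar>avg \<Phi> ({..<n} \<rightarrow>\<^sub>E {..<n}) - avg \<Phi> (perms n)\<bar> \<le> real (card S) * (real (card S) - 1) / real n * B"
proof -
  let ?P = "avg \<Phi> (perms n)" and ?U = "{..<n} \<rightarrow>\<^sub>E {..<n}"
  let ?N = "{f \<in> ?U. \<not> inj_on f S}"
  have finU: "finite ?U" by (auto intro: finite_PiE)
  have cU: "card ?U = n ^ n" by (simp add: card_PiE)
  have P: "\<bar>?P\<bar> \<le> B"
  proof -
    have \<sigma>: "\<bar>\<Phi> \<sigma>\<bar> \<le> B" if "\<sigma> \<in> perms n" for \<sigma>
      using that by (intro bound) (auto simp: permutes_lessThan)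
    have "- B \<le> ?P" "- B \<le> avg (\<lambda>f. -1 * \<Phi> f) (perms n)"
      by (intro avg_ge finite_perms perms_nonempty; drule \<sigma>; simp)+
    then show ?thesis unfolding avg_cmult by simp
  qed
  have "0 \<le> B" using P by linarith
  \<comment> \<open>Centring at \<open>?P\<close> makes the maps injective on \<open>S\<close>
    contribute nothing, so only collisions remain.\<close>
  have "(\<Sum>f\<in>?U. \<Phi> f - ?P) = (\<Sum>f\<in>{f \<in> ?U. inj_on f S}. \<Phi> f - ?P) + (\<Sum>f\<in>?N. \<Phi> f - ?P)"
  proof -
    have U: "?U = {f \<in> ?U. inj_on f S} \<union> ?N" by blast
    show ?thesis
      by (rule trans[OF sum.cong[OF U refl] sum.union_disjoint]) (use finU in auto)
  qed
  also have "(\<Sum>f\<in>{f \<in> ?U. inj_on f S}. \<Phi> f - ?P) = 0"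
    using sum_inj_on_eq_avg_perms[OF assms(1) cong] by (simp add: sum_subtractf)
  finally have eq: "(\<Sum>f\<in>?U. \<Phi> f - ?P) = (\<Sum>f\<in>?N. \<Phi> f - ?P)" by simp
  have "avg \<Phi> ?U - ?P = (\<Sum>f\<in>?U. \<Phi> f - ?P) / card ?U"
    using assms(2) by (simp add: avg_def sum_subtractf cU diff_divide_distrib)
  also have "\<bar>\<dots>\<bar> \<le> (\<Sum>f\<in>?N. \<bar>\<Phi> f - ?P\<bar>) / card ?U"
    unfolding eq abs_divide by (simp add: divide_right_mono sum_abs)
  also have "\<dots> \<le> (card ?N * (2 * B)) / card ?U"
  proof (intro divide_right_mono sum_bounded_above)
    fix f assume "f \<in> ?N"
    then have "\<bar>\<Phi> f\<bar> \<le> B" by (intro bound) auto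
    then show "\<bar>\<Phi> f - ?P\<bar> \<le> 2 * B" using P by linarith
  qed simp
  also have "\<dots> \<le> (real ((card S choose 2) * n ^ (n - 1)) * (2 * B)) / real (n ^ n)"
    unfolding cU using card_not_inj_on_le[OF assms(1), of n] \<open>0 \<le> B\<close>
    by (intro divide_right_mono mult_right_mono of_nat_mono) simp_all
  also have "\<dots> = real (card S choose 2) * 2 / real n * B"
  proof -
    have "n ^ n = n * n ^ (n - 1)"
      using power_minus_mult[OF assms(2), of n] by (simp add: mult.commute)
    then have "real (n ^ n) = real n * real (n ^ (n - 1))"
      by (metis of_nat_mult)
    then show ?thesis using assms(2) by simp
  qed
  also have "real (card S choose 2) * 2 = real (card S) * (real (card S) - 1)"
  proof -
    have "even (card S * (card S - 1))" by auto
    then have "(card S choose 2) * 2 = card S * (card S - 1)"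
      by (simp add: choose_two)
    then have "real (card S choose 2) * 2 = real (card S * (card S - 1))"
      by (metis of_nat_mult of_nat_numeral)
    then show ?thesis by (cases "card S") (simp_all add: algebra_simps)
  qed
  finally show ?thesis .
qed

subsection \<open>Polynomials as sums over lists of labels\<close>

text \<open>Equality is required on \<open>V\<close> only and coefficients need not be unique, so
  membership is meaningful without independence of the \<open>B i\<close>.\<close>

definition in_span :: "'i set \<Rightarrow> ('i \<Rightarrow> 'x \<Rightarrow> real) \<Rightarrow> 'x set \<Rightarrow> ('x \<Rightarrow> real) \<Rightarrow> bool" where
  "in_span I B V h \<longleftrightarrow> (\<exists>C. \<forall>x\<in>V. h x = (\<Sum>i\<in>I. C i * B i x))"

lemma in_span_base: "finite I \<Longrightarrow> i \<in> I \<Longrightarrow> in_span I B V (B i)"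
  unfolding in_span_def
  by (intro exI[of _ "\<lambda>j. of_bool (j = i)"]) (simp add: of_bool_def if_distrib[of "\<lambda>c. c * _"] cong: if_cong)

lemma in_span_cmult: "in_span I B V h \<Longrightarrow> in_span I B V (\<lambda>x. c * h x)"
  unfolding in_span_def
proof (elim exE)
  fix C assume "\<forall>x\<in>V. h x = (\<Sum>i\<in>I. C i * B i x)"
  then show "\<exists>C. \<forall>x\<in>V. c * h x = (\<Sum>i\<in>I. C i * B i x)"
    by (intro exI[of _ "\<lambda>i. c * C i"]) (simp add: sum_distrib_left mult.assoc)
qed

lemma in_span_add:
  "in_span I B V g \<Longrightarrow> in_span I B V h \<Longrightarrow> in_span I B V (\<lambda>x. g x + h x)"
  unfolding in_span_def
proof (elim exE)
  fix C D assume "\<forall>x\<in>V. g x = (\<Sum>i\<in>I. C i * B i x)" "\<forall>x\<in>V. h x = (\<Sum>i\<in>I. D i * B i x)"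
  then show "\<exists>C. \<forall>x\<in>V. g x + h x = (\<Sum>i\<in>I. C i * B i x)"
    by (intro exI[of _ "\<lambda>i. C i + D i"]) (simp add: distrib_right sum.distrib)
qed

lemma in_span_cong: "(\<And>x. x \<in> V \<Longrightarrow> g x = h x) \<Longrightarrow> in_span I B V g \<Longrightarrow> in_span I B V h"
  by (simp add: in_span_def)

lemma in_span_sum:
  "(\<And>j. j \<in> J \<Longrightarrow> in_span I B V (h j)) \<Longrightarrow> in_span I B V (\<lambda>x. \<Sum>j\<in>J. h j x)"
proof (induction J rule: infinite_finite_induct)
  case (insert j J)
  then show ?case by (auto intro: in_span_cong[OF _ in_span_add[of _ _ _ "h j"]])
qed (auto simp: in_span_def intro!: exI[of _ "\<lambda>_. 0"])

text \<open>Lists instead of multisets: relabelling is then \<open>map\<close>, and its fibres are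
  products of fibres of labels. The price is that coefficients are no longer unique.\<close>

definition monomials :: "construction \<Rightarrow> nat \<Rightarrow> nat \<Rightarrow> idx list set" where
  "monomials F d n = {bs. set bs \<subseteq> basis F n \<and> length bs \<le> d}"

definition lsupp :: "idx list \<Rightarrow> nat set" where
  "lsupp bs = (\<Union>a\<in>set bs. supp a)"

abbreviation lrel :: "(nat \<Rightarrow> nat) \<Rightarrow> idx list \<Rightarrow> idx list" where
  "lrel f \<equiv> map (relabel f)"

text \<open>For pullbacks a weighted coordinate is the inner product of \<open>x\<close> with
  \<open>e_a\<close>, which is carried along without any Gram ratio.\<close>

primrec weight :: "construction \<Rightarrow> base_seq \<Rightarrow> idx \<Rightarrow> real" where
  "weight F Dupl = gram F"
| "weight F ZeroPad = (\<lambda>a. 1)"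

definition mon :: "construction \<Rightarrow> base_seq \<Rightarrow> idx list \<Rightarrow> coord_vec \<Rightarrow> real" where
  "mon F S bs x = prod_list (map (\<lambda>a. weight F S a * x a) bs)"

lemma finite_monomials [simp]: "finite (monomials F d n)"
  unfolding monomials_def using finite_lists_length_le[OF finite_basis] .

lemma finite_lsupp [simp]: "finite (lsupp bs)"
  by (simp add: lsupp_def)

lemma lsupp_lrel: "lsupp (lrel f bs) = f ` lsupp bs"
  by (auto simp: lsupp_def supp_relabel)

lemma lsupp_monomials: "bs \<in> monomials F d n \<Longrightarrow> lsupp bs \<subseteq> {..<n}"
  using supp_basis by (fastforce simp: lsupp_def monomials_def)

lemma lrel_monomials:
  "bs \<in> monomials F d n \<Longrightarrow> f ` lsupp bs \<subseteq> {..<m} \<Longrightarrow> lrel f bs \<in> monomials F d m"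
  by (auto simp: monomials_def lsupp_def intro!: relabel_basis)

lemma lrel_cong: "(\<And>i. i \<in> lsupp bs \<Longrightarrow> f i = g i) \<Longrightarrow> lrel f bs = lrel g bs"
  by (auto simp: lsupp_def intro!: relabel_cong)

lemma lrel_lrel: "lrel f (lrel g bs) = lrel (f \<circ> g) bs"
  by simp

lemma lrel_PiE:
  "bs \<in> monomials F d n \<Longrightarrow> f \<in> {..<n} \<rightarrow>\<^sub>E {..<m} \<Longrightarrow> lrel f bs \<in> monomials F d m"
  by (rule lrel_monomials) (use lsupp_monomials in fastforce)+

lemma lrel_perm:
  "bs \<in> monomials F d n \<Longrightarrow> \<sigma> permutes {..<n} \<Longrightarrow> lrel \<sigma> bs \<in> monomials F d n"
  using lsupp_monomials by (intro lrel_monomials) (fastforce simp: permutes_lessThan)+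

lemma card_lsupp_le_degree: "bs \<in> monomials F d n \<Longrightarrow> card (lsupp bs) \<le> length bs * deg F"
proof -
  assume bs: "bs \<in> monomials F d n"
  have "card (lsupp bs) \<le> (\<Sum>a\<in>set bs. card (supp a))"
    unfolding lsupp_def by (intro card_UN_le) simp
  also have "\<dots> \<le> (\<Sum>a\<in>set bs. deg F)"
    using bs by (intro sum_mono card_supp_le[of _ F n]) (auto simp: monomials_def)
  also have "\<dots> \<le> length bs * deg F"
    by (simp add: card_length)
  finally show ?thesis .
qed

lemma card_lsupp_le:
  assumes "bs \<in> monomials F d n"
  shows "card (lsupp bs) \<le> d * deg F"
proof -
  have "length bs * deg F \<le> d * deg F"
    using assms by (intro mult_right_mono) (auto simp: monomials_def)
  then show ?thesis using card_lsupp_le_degree[OF assms] by linarith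
qed

lemma card_lsupp_not_inj:
  "\<not> inj_on f (lsupp bs) \<Longrightarrow> card (lsupp (lrel f bs)) < card (lsupp bs)"
  unfolding lsupp_lrel using card_image_le[of "lsupp bs" f] eq_card_imp_inj_on[of "lsupp bs" f]
  by fastforce

lemma card_lsupp_lrel_le: "card (lsupp (lrel f bs)) \<le> card (lsupp bs)"
  unfolding lsupp_lrel by (rule card_image_le) simp

lemma card_lsupp_perm: "\<sigma> permutes A \<Longrightarrow> card (lsupp (lrel \<sigma> bs)) = card (lsupp bs)"
  unfolding lsupp_lrel by (rule card_image) (rule permutes_inj_on)

lemma prod_list_sum_fibres:
  fixes w :: "'b \<Rightarrow> real"
  assumes "finite B"
  shows "prod_list (map (\<lambda>a. \<Sum>b | b \<in> B \<and> h b = a. w b) as) =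
    (\<Sum>bs | set bs \<subseteq> B \<and> map h bs = as. prod_list (map w bs))"
proof (induction as)
  case Nil
  have "{bs. set bs \<subseteq> B \<and> map h bs = []} = {[]}" by auto
  then show ?case by simp
next
  case (Cons a as)
  let ?X = "{b. b \<in> B \<and> h b = a}" and ?Y = "{bs. set bs \<subseteq> B \<and> map h bs = as}"
  have eq: "{bs. set bs \<subseteq> B \<and> map h bs = a # as} = (\<lambda>(b, bs). b # bs) ` (?X \<times> ?Y)"
    by (auto simp: map_eq_Cons_conv)
  have "(\<Sum>bs | set bs \<subseteq> B \<and> map h bs = a # as. prod_list (map w bs)) =
      (\<Sum>(b, bs)\<in>?X \<times> ?Y. w b * prod_list (map w bs))"
    unfolding eq by (subst sum.reindex) (auto simp: inj_on_def case_prod_unfold)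
  also have "\<dots> = (\<Sum>b\<in>?X. w b) * (\<Sum>bs\<in>?Y. prod_list (map w bs))"
    by (simp add: sum_product sum.cartesian_product)
  finally show ?case by (simp add: Cons.IH)
qed

lemma mon_lin_Dupl:
  assumes "bs \<in> monomials F d m" "f \<in> {..<m} \<rightarrow> {..<n}"
  shows "mon F Dupl bs (lin F Dupl m n f x) = mon F Dupl (lrel f bs) x"
proof -
  have "set bs \<subseteq> basis F m" using assms(1) by (simp add: monomials_def)
  then show ?thesis
  proof (induction bs)
    case (Cons b bs)
    then have "b \<in> basis F m" "relabel f b \<in> basis F n"
      using relabel_basis'[OF _ assms(2)] by auto
    then have "gram F b * lin F Dupl m n f x b = gram F (relabel f b) * x (relabel f b)"
      using gram_pos[of b F m] by (simp add: lin_Dupl del: lin.simps)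
    with Cons show ?case by (simp add: mon_def del: lin.simps)
  qed (simp add: mon_def)
qed

text \<open>Each coordinate of a pushforward is a sum over a fibre, so multiplying out replaces a
  monomial by the sum of all monomials relabelled to it. Regrouping by these moves the relabelling
  onto the coefficients, dually to \<open>mon_lin_Dupl\<close>.\<close>

lemma sum_mon_lin_ZeroPad:
  assumes "f \<in> {..<n} \<rightarrow> {..<m}"
  shows "(\<Sum>as\<in>monomials F d m. C as * mon F ZeroPad as (lin F ZeroPad m n f x)) =
    (\<Sum>bs\<in>monomials F d n. C (lrel f bs) * mon F ZeroPad bs x)"
proof -
  have "mon F ZeroPad as (lin F ZeroPad m n f x) =
      (\<Sum>bs | bs \<in> monomials F d n \<and> lrel f bs = as. mon F ZeroPad bs x)"
    if as: "as \<in> monomials F d m" for as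
  proof -
    have "mon F ZeroPad as (lin F ZeroPad m n f x) =
        prod_list (map (\<lambda>a. \<Sum>b | b \<in> basis F n \<and> relabel f b = a. x b) as)"
      using as by (auto simp: mon_def monomials_def lin_ZeroPad subset_iff simp del: lin.simps
          intro!: arg_cong[where f = prod_list])
    also have "\<dots> = (\<Sum>bs | set bs \<subseteq> basis F n \<and> lrel f bs = as. mon F ZeroPad bs x)"
      by (simp add: prod_list_sum_fibres[OF finite_basis] mon_def)
    also have "{bs. set bs \<subseteq> basis F n \<and> lrel f bs = as} = {bs. bs \<in> monomials F d n \<and> lrel f bs = as}"
      using as by (auto simp: monomials_def)
    finally show ?thesis .
  qed
  then have "(\<Sum>as\<in>monomials F d m. C as * mon F ZeroPad as (lin F ZeroPad m n f x)) =
      (\<Sum>as\<in>monomials F d m. \<Sum>bs | bs \<in> monomials F d n \<and> lrel f bs = as. C (lrel f bs) * mon F ZeroPad bs x)"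
    by (simp add: sum_distrib_left del: lin.simps)
  also have "\<dots> = (\<Sum>bs\<in>monomials F d n. C (lrel f bs) * mon F ZeroPad bs x)"
  proof (rule sum.group)
    show "lrel f ` monomials F d n \<subseteq> monomials F d m"
      using assms lsupp_monomials by (fastforce intro!: lrel_monomials)
  qed simp_all
  finally show ?thesis .
qed

abbreviation polyfun ::
  "construction \<Rightarrow> base_seq \<Rightarrow> nat \<Rightarrow> nat \<Rightarrow> (coord_vec \<Rightarrow> real) \<Rightarrow> bool" where
  "polyfun F S d n g \<equiv> in_span (monomials F d n) (mon F S) (space_of F n) g"

lemma mon_eq_prod_mset:
  "mon F S bs x = (\<Prod>a\<in>#mset bs. weight F S a) * (\<Prod>a\<in>#mset bs. x a)"
  by (induction bs) (simp_all add: mon_def)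

lemma abs_lookup_le_coeff_norm:
  "\<bar>Poly_Mapping.lookup q I\<bar> \<le> coeff_norm q"
proof (cases "I \<in> Poly_Mapping.keys q")
  case False
  then have "Poly_Mapping.lookup q I = 0" by (simp add: in_keys_iff)
  then show ?thesis by (simp add: coeff_norm_def)
qed (simp add: coeff_norm_def)

lemma weight_pos: "a \<in> basis F n \<Longrightarrow> weight F S a > 0"
  by (cases S) (auto simp: gram_pos)

lemma prod_weight_pos: "set_mset I \<subseteq> basis F n \<Longrightarrow> (\<Prod>a\<in>#I. weight F S a) > 0"
  by (induction I) (auto simp: weight_pos)

text \<open>With all weights equal to 1 the coefficients of \<open>q\<close> itself are kept; this
  is how the coefficient norm enters the rate for \<open>ZeroPad\<close>.\<close>

lemma peval_as_sum_mon:
  assumes "q \<in> polys_le F n d"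
  obtains C where "\<And>x. peval q x = (\<Sum>bs\<in>monomials F d n. C bs * mon F S bs x)"
    "S = ZeroPad \<Longrightarrow> (\<And>bs. \<bar>C bs\<bar> \<le> coeff_norm q)"
proof -
  \<comment> \<open>One enumeration is chosen for each exponent; all other lists will get
    coefficient 0.\<close>
  define ch :: "idx multiset \<Rightarrow> idx list" where "ch I = (SOME bs. mset bs = I)" for I
  have ch: "mset (ch I) = I" for I
    unfolding ch_def using someI_ex[OF ex_mset[of I]] .
  define C where "C bs = (if bs \<in> ch ` Poly_Mapping.keys q
    then Poly_Mapping.lookup q (mset bs) / (\<Prod>a\<in>#mset bs. weight F S a) else 0)" for bs
  have inj: "inj_on ch A" for A by (metis ch inj_onI)
  have sub: "ch ` Poly_Mapping.keys q \<subseteq> monomials F d n"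
  proof
    fix bs assume "bs \<in> ch ` Poly_Mapping.keys q"
    then obtain I where I: "I \<in> Poly_Mapping.keys q" "bs = ch I" by auto
    then have "set_mset I \<subseteq> basis F n" "size I \<le> d"
      using assms by (auto simp: polys_le_def polys_def)
    then show "bs \<in> monomials F d n"
      using ch[of I] by (metis (mono_tags, lifting) I(2) mem_Collect_eq monomials_def set_mset_mset size_mset)
  qed
  have "peval q x = (\<Sum>bs\<in>monomials F d n. C bs * mon F S bs x)" for x
  proof -
    have "peval q x = (\<Sum>I\<in>Poly_Mapping.keys q. C (ch I) * mon F S (ch I) x)"
      unfolding peval_def
    proof (rule sum.cong[OF refl])
      fix I assume I: "I \<in> Poly_Mapping.keys q"
      then have "set_mset I \<subseteq> basis F n"
        using assms by (auto simp: polys_le_def polys_def)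
      then have nz: "(\<Prod>a\<in>#I. weight F S a) \<noteq> 0"
        by (rule less_imp_neq[OF prod_weight_pos, symmetric])
      have cancel: "w \<noteq> 0 \<Longrightarrow> c * y = c / w * (w * y)" for c w y :: real
        by simp
      have "C (ch I) = Poly_Mapping.lookup q I / (\<Prod>a\<in>#I. weight F S a)"
        using I by (simp add: C_def ch)
      then show "Poly_Mapping.lookup q I * (\<Prod>a\<in>#I. x a) = C (ch I) * mon F S (ch I) x"
        using cancel[OF nz] by (simp only: mon_eq_prod_mset ch)
    qed
    also have "\<dots> = (\<Sum>bs\<in>ch ` Poly_Mapping.keys q. C bs * mon F S bs x)"
      by (simp add: sum.reindex[OF inj])
    also have "\<dots> = (\<Sum>bs\<in>monomials F d n. C bs * mon F S bs x)"
      using sub by (intro sum.mono_neutral_left) (auto simp: C_def)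
    finally show ?thesis .
  qed
  moreover have "\<bar>C bs\<bar> \<le> coeff_norm q" if "S = ZeroPad" for bs
    using abs_lookup_le_coeff_norm[of q "mset bs"] that by (auto simp: C_def)
  ultimately show ?thesis using that by blast
qed

lemma polyfun_peval:
  assumes "q \<in> polys_le F n d" shows "polyfun F S d n (peval q)"
  using peval_as_sum_mon[OF assms, of S] unfolding in_span_def by metis

lemma sum_mon_as_peval:
  obtains q where "q \<in> polys_le F n d"
    "\<And>x. peval q x = (\<Sum>bs\<in>monomials F d n. C bs * mon F S bs x)"
proof
  let ?c = "\<lambda>bs. C bs * (\<Prod>a\<in>#mset bs. weight F S a)"
  let ?q = "\<Sum>bs\<in>monomials F d n. Poly_Mapping.single (mset bs) (?c bs)"
  show "peval ?q x = (\<Sum>bs\<in>monomials F d n. C bs * mon F S bs x)" for x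
    by (simp add: peval_sum mon_eq_prod_mset mult.assoc)
  have "Poly_Mapping.keys ?q \<subseteq> mset ` monomials F d n"
    by (rule order_trans[OF keys_sum]) (auto split: if_splits)
  then show "?q \<in> polys_le F n d"
    by (fastforce simp: polys_le_def polys_def monomials_def)
qed

subsection \<open>The averaging operator on invariant polynomials\<close>

lemma avg_cmult_right: "avg (\<lambda>a. G a * c) A = avg G A * c"
  by (simp add: avg_def sum_distrib_right)

abbreviation funs :: "nat \<Rightarrow> nat \<Rightarrow> (nat \<Rightarrow> nat) set" where
  "funs m n \<equiv> {..<m} \<rightarrow>\<^sub>E {..<n}"

lemma finite_funs [simp]: "finite (funs m n)"
  by (rule finite_PiE) simp_all

lemma card_funs: "card (funs m n) = n ^ m"
  by (simp add: card_PiE)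

definition num_inj :: "nat \<Rightarrow> nat \<Rightarrow> nat set \<Rightarrow> nat" where
  "num_inj m n T = card {f \<in> funs m n. inj_on f T}"

lemma num_inj_pos:
  assumes "T \<subseteq> {..<m}" "m \<le> n"
  shows "num_inj m n T > 0"
proof -
  have "restrict (\<lambda>i. i) {..<m} \<in> {f \<in> funs m n. inj_on f T}"
    using assms by (auto simp: inj_on_def)
  then have "{f \<in> funs m n. inj_on f T} \<noteq> {}" by blast
  then show ?thesis unfolding num_inj_def by (simp add: card_gt_0_iff)
qed

text \<open>Precompose with a permutation carrying one set to the other. Hence one diagonal constant
  handles all monomials with the same number of points.\<close>

lemma num_inj_cong:
  assumes "T \<subseteq> {..<m}" "T' \<subseteq> {..<m}" "card T = card T'"
  shows "num_inj m n T = num_inj m n T'"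
proof -
  have le: "num_inj m n T \<le> num_inj m n T'"
    if T: "T \<subseteq> {..<m}" and T': "T' \<subseteq> {..<m}" and eq: "card T = card T'" for T T'
  proof -
    obtain h where h: "bij_betw h T' T"
      using T T' eq by (metis bij_betw_iff_card finite_lessThan finite_subset)
    then obtain \<sigma> where \<sigma>: "\<sigma> permutes {..<m}" "\<And>i. i \<in> T' \<Longrightarrow> \<sigma> i = h i"
      using extend_to_permutation[of "{..<m}" T' h] T T' by (auto simp: bij_betw_def)
    then have im: "\<sigma> ` T' = T" using h by (auto simp: bij_betw_def)
    let ?r = "\<lambda>f. restrict (f \<circ> \<sigma>) {..<m}"
    have "inj_on ?r (funs m n)"
    proof (rule inj_onI)
      fix f g assume fg: "f \<in> funs m n" "g \<in> funs m n" "?r f = ?r g"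
      show "f = g"
      proof (rule PiE_ext[OF fg(1,2)])
        fix i assume "i \<in> {..<m}"
        then have "inv \<sigma> i \<in> {..<m}"
          using permutes_lessThan[OF permutes_inv[OF \<sigma>(1)]] by simp
        then show "f i = g i"
          using fun_cong[OF fg(3), of "inv \<sigma> i"] permutes_inverses(1)[OF \<sigma>(1)] by simp
      qed
    qed
    then have "inj_on ?r {f \<in> funs m n. inj_on f T}"
      by (rule inj_on_subset) blast
    moreover have "?r ` {f \<in> funs m n. inj_on f T} \<subseteq> {f \<in> funs m n. inj_on f T'}"
    proof (rule image_subsetI)
      fix f assume f: "f \<in> {f \<in> funs m n. inj_on f T}"
      then have "f i \<in> {..<n}" if "i \<in> {..<m}" for i
        using that by (blast dest: PiE_mem)
      then have "?r f \<in> funs m n"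
        using permutes_lessThan[OF \<sigma>(1)] by (simp add: restrict_PiE_iff)
      moreover have "inj_on (?r f) T' = inj_on (f \<circ> \<sigma>) T'"
        using T' by (intro inj_on_cong) auto
      moreover have "inj_on (f \<circ> \<sigma>) T'"
        using f permutes_inj_on[OF \<sigma>(1)] by (intro comp_inj_on) (auto simp: im)
      ultimately show "?r f \<in> {f \<in> funs m n. inj_on f T'}" by simp
    qed
    moreover have "finite {f \<in> funs m n. inj_on f T'}" by simp
    ultimately show ?thesis
      unfolding num_inj_def by (rule card_inj_on_le)
  qed
  show ?thesis
    using le[OF assms] le[OF assms(2,1) assms(3)[symmetric]] by simp
qed

lemma sum_funs_split:
  "(\<Sum>f\<in>funs m n. G f) = (\<Sum>f\<in>{f \<in> funs m n. inj_on f T}. G f) + (\<Sum>f\<in>{f \<in> funs m n. \<not> inj_on f T}. G f)"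
proof -
  have U: "funs m n = {f \<in> funs m n. inj_on f T} \<union> {f \<in> funs m n. \<not> inj_on f T}" by blast
  show ?thesis
    by (rule trans[OF sum.cong[OF U refl] sum.union_disjoint]) auto
qed

text \<open>Injectivity on the points of a monomial allows an extension to a permutation, which acts
  trivially on invariant data. These maps form the diagonal of the triangular operator.\<close>

lemma lrel_inj_eq_perm:
  assumes "f \<in> funs m n" "inj_on f (lsupp bs)" "lsupp bs \<subseteq> {..<m}" "m \<le> n"
  obtains \<sigma> where "\<sigma> permutes {..<n}" "lrel f bs = lrel \<sigma> bs"
proof -
  have "f ` lsupp bs \<subseteq> {..<n}" using assms(1,3) by (blast dest: PiE_mem)
  then obtain \<sigma> where "\<sigma> permutes {..<n}" "\<And>i. i \<in> lsupp bs \<Longrightarrow> \<sigma> i = f i"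
    using extend_to_permutation[of "{..<n}" "lsupp bs" f] assms(2-4)
    by (metis finite_lessThan lessThan_subset_iff order_trans)
  then show ?thesis using that[of \<sigma>] lrel_cong[of bs \<sigma> f] by simp
qed

lemma avg_funs_comp_perm:
  assumes "\<tau> permutes {..<m}" and n: "n > 0"
    and cong: "\<And>f g. (\<And>i. i < m \<Longrightarrow> f i = g i) \<Longrightarrow> H f = H g"
  shows "avg (\<lambda>f. H (f \<circ> \<tau>)) (funs m n) = avg H (funs m n)"
proof -
  have "avg (\<lambda>f. H ((\<lambda>i. i) \<circ> f \<circ> \<tau>)) (funs m n) = avg H (funs m n)"
  proof (rule avg_PiE[where c = 1])
    show "card {a \<in> {..<n}. a = b} = 1" if "b \<in> {..<n}" for b
      using that by (rule card_filter_eq)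
    show "{..<n} \<noteq> {}" using n by auto
    show "inj_on \<tau> {..<m}" "\<tau> \<in> {..<m} \<rightarrow> {..<m}"
      using assms(1) by (auto simp: permutes_inj_on permutes_lessThan)
    show "H f = H g" if "\<And>i. i \<in> {..<m} \<Longrightarrow> f i = g i" for f g
      by (rule cong, rule that) simp
  qed simp_all
  then show ?thesis by (simp add: o_def)
qed

lemma avg_perm_comp_funs:
  assumes "\<tau> permutes {..<n}" and n: "n > 0"
    and cong: "\<And>f g. (\<And>i. i < m \<Longrightarrow> f i = g i) \<Longrightarrow> H f = H g"
  shows "avg (\<lambda>f. H (\<tau> \<circ> f)) (funs m n) = avg H (funs m n)"
proof -
  have "avg (\<lambda>f. H (\<tau> \<circ> f \<circ> (\<lambda>i. i))) (funs m n) = avg H (funs m n)"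
  proof (rule avg_PiE[where c = 1])
    show "card {a \<in> {..<n}. \<tau> a = b} = 1" if "b \<in> {..<n}" for b
    proof -
      have "{a \<in> {..<n}. \<tau> a = b} = {inv \<tau> b}"
        using that permutes_inverses[OF assms(1)] permutes_lessThan[OF permutes_inv[OF assms(1)]] by auto
      then show ?thesis by simp
    qed
    show "{..<n} \<noteq> {}" using n by auto
    show "\<tau> \<in> {..<n} \<rightarrow> {..<n}"
      using assms(1) by (auto simp: permutes_lessThan)
    show "H f = H g" if "\<And>i. i \<in> {..<m} \<Longrightarrow> f i = g i" for f g
      by (rule cong, rule that) simp
  qed simp_all
  then show ?thesis by (simp add: o_def)
qed

section \<open>Averaging coefficients along pushforwards\<close>

definition avg_coeff :: "nat \<Rightarrow> nat \<Rightarrow> (idx list \<Rightarrow> real) \<Rightarrow> idx list \<Rightarrow> real" where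
  "avg_coeff m n C bs = avg (\<lambda>f. C (lrel f bs)) (funs m n)"

definition perm_invariant :: "nat \<Rightarrow> (idx list \<Rightarrow> real) \<Rightarrow> bool" where
  "perm_invariant n C \<longleftrightarrow> (\<forall>\<sigma> bs. \<sigma> permutes {..<n} \<longrightarrow> lsupp bs \<subseteq> {..<n} \<longrightarrow> C (lrel \<sigma> bs) = C bs)"

lemma lrel_cong_less:
  "lsupp bs \<subseteq> {..<n} \<Longrightarrow> (\<And>i. i < n \<Longrightarrow> f i = g i) \<Longrightarrow> lrel f bs = lrel g bs"
  by (rule lrel_cong) auto

lemma lin_perm_inverse:
  assumes "\<sigma> permutes {..<n}"
  shows "act F n \<sigma> = lin F ZeroPad n n \<sigma>" "act F n \<sigma> = lin F Dupl n n (inv \<sigma>)"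
  using act_eq[OF assms, of F _ ZeroPad] act_eq[OF assms, of F _ Dupl]
  unfolding perm_map.simps by blast+

lemma permutes_funcset: "\<sigma> permutes {..<n} \<Longrightarrow> \<sigma> \<in> {..<n::nat} \<rightarrow> {..<n}"
  by (auto simp: permutes_lessThan)

text \<open>Non-unique coefficients of an invariant function need not be invariant themselves. Their
  average over the group is, and it still represents \<open>g\<close> because \<open>g\<close> is
  invariant.\<close>

lemma invariant_polyfun_ZeroPad:
  assumes "polyfun F ZeroPad d n g"
    and inv: "\<And>\<sigma> x. \<sigma> permutes {..<n} \<Longrightarrow> x \<in> space_of F n \<Longrightarrow> g (act F n \<sigma> x) = g x"
  obtains C where "perm_invariant n C"
    "\<And>x. x \<in> space_of F n \<Longrightarrow> g x = (\<Sum>bs\<in>monomials F d n. C bs * mon F ZeroPad bs x)"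
proof -
  obtain C0 where C0: "\<And>x. x \<in> space_of F n \<Longrightarrow> g x = (\<Sum>bs\<in>monomials F d n. C0 bs * mon F ZeroPad bs x)"
    using assms(1) unfolding in_span_def by blast
  define C where "C bs = avg (\<lambda>\<sigma>. C0 (lrel \<sigma> bs)) (perms n)" for bs
  have "C (lrel \<tau> bs) = C bs" if "\<tau> permutes {..<n}" for \<tau> bs
    using avg_perms_comp_right[OF that, of "\<lambda>\<sigma>. C0 (lrel \<sigma> bs)"] by (simp only: C_def lrel_lrel)
  then have "perm_invariant n C" by (simp only: perm_invariant_def) blast
  moreover have "g x = (\<Sum>bs\<in>monomials F d n. C bs * mon F ZeroPad bs x)" if x: "x \<in> space_of F n" for x
  proof -
    have "g x = avg (\<lambda>\<sigma>. g x) (perms n)" by (rule avg_perms_const[symmetric])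
    also have "\<dots> = avg (\<lambda>\<sigma>. g (act F n \<sigma> x)) (perms n)"
      by (rule avg_cong[OF refl]) (simp add: inv x)
    also have "\<dots> = avg (\<lambda>\<sigma>. \<Sum>bs\<in>monomials F d n. C0 (lrel \<sigma> bs) * mon F ZeroPad bs x) (perms n)"
    proof (rule avg_cong[OF refl])
      fix \<sigma> assume "\<sigma> \<in> perms n"
      then have \<sigma>: "\<sigma> permutes {..<n}" by simp
      show "g (act F n \<sigma> x) = (\<Sum>bs\<in>monomials F d n. C0 (lrel \<sigma> bs) * mon F ZeroPad bs x)"
        unfolding lin_perm_inverse(1)[OF \<sigma>] C0[OF lin_in_space]
        by (rule sum_mon_lin_ZeroPad[OF permutes_funcset[OF \<sigma>]])
    qed
    also have "\<dots> = (\<Sum>bs\<in>monomials F d n. C bs * mon F ZeroPad bs x)"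
      unfolding avg_sum C_def
      by (rule sum.cong[OF refl avg_cmult_right])
    finally show ?thesis .
  qed
  ultimately show ?thesis using that by blast
qed

text \<open>Since the relabelling sits on the coefficients, the expectation can be taken coefficient
  by coefficient; \<open>avg_coeff n m\<close> turns coefficients over \<open>m\<close> points into
  coefficients over \<open>n\<close> points.\<close>

lemma rand_avg_ZeroPad_sum:
  "rand_avg F ZeroPad m n (\<lambda>y. \<Sum>as\<in>monomials F d m. C as * mon F ZeroPad as y) x =
    (\<Sum>bs\<in>monomials F d n. avg_coeff n m C bs * mon F ZeroPad bs x)"
proof -
  have "rand_avg F ZeroPad m n (\<lambda>y. \<Sum>as\<in>monomials F d m. C as * mon F ZeroPad as y) x =
      avg (\<lambda>f. \<Sum>bs\<in>monomials F d n. C (lrel f bs) * mon F ZeroPad bs x) (funs n m)"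
    unfolding rand_avg_def ext_maps.simps
    by (intro avg_cong refl sum_mon_lin_ZeroPad) auto
  also have "\<dots> = (\<Sum>bs\<in>monomials F d n. avg_coeff n m C bs * mon F ZeroPad bs x)"
    unfolding avg_sum avg_coeff_def
    by (rule sum.cong[OF refl avg_cmult_right])
  finally show ?thesis .
qed

lemma perm_invariant_avg_coeff:
  assumes "n > 0"
  shows "perm_invariant m (avg_coeff m n C)"
  unfolding perm_invariant_def avg_coeff_def lrel_lrel
proof (intro allI impI)
  fix \<sigma> bs assume \<sigma>: "\<sigma> permutes {..<m}" and bs: "lsupp bs \<subseteq> {..<m}"
  show "avg (\<lambda>f. C (lrel (f \<circ> \<sigma>) bs)) (funs m n) = avg (\<lambda>f. C (lrel f bs)) (funs m n)"
  proof (rule avg_funs_comp_perm[OF \<sigma> assms, of "\<lambda>f. C (lrel f bs)"])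
    show "C (lrel f bs) = C (lrel g bs)" if "\<And>i. i < m \<Longrightarrow> f i = g i" for f g
      by (rule arg_cong[where f = C], rule lrel_cong_less[OF bs that])
  qed
qed

text \<open>
  On coefficients supported on monomials with at least \<open>s\<close> points, averaging over all self-maps
  acts on the monomials with exactly \<open>s\<close> points as a multiplication by a constant, because a
  map that is not injective on these points decreases their number.
\<close>

lemma avg_coeff_leading:
  assumes "perm_invariant n C" "lsupp bs \<subseteq> {..<n}"
    and vanish: "\<And>f. f \<in> funs n n \<Longrightarrow> \<not> inj_on f (lsupp bs) \<Longrightarrow> C (lrel f bs) = 0"
  shows "avg_coeff n n C bs = real (num_inj n n (lsupp bs)) / real (n ^ n) * C bs"
proof -
  have "(\<Sum>f\<in>funs n n. C (lrel f bs)) = (\<Sum>f\<in>{f \<in> funs n n. inj_on f (lsupp bs)}. C bs)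
      + (\<Sum>f\<in>{f \<in> funs n n. \<not> inj_on f (lsupp bs)}. 0)"
    unfolding sum_funs_split[of _ n n "lsupp bs"]
  proof (intro arg_cong2[where f = "(+)"] sum.cong refl)
    fix f assume "f \<in> {f \<in> funs n n. inj_on f (lsupp bs)}"
    then obtain \<sigma> where "\<sigma> permutes {..<n}" "lrel f bs = lrel \<sigma> bs"
      using lrel_inj_eq_perm[of f n n bs] assms(2) by blast
    then show "C (lrel f bs) = C bs"
      using assms(1,2) unfolding perm_invariant_def by metis
  qed (use vanish in blast)
  then show ?thesis by (simp add: avg_coeff_def avg_def num_inj_def card_funs)
qed

lemma perm_invariantD:
  "perm_invariant n C \<Longrightarrow> \<sigma> permutes {..<n} \<Longrightarrow> lsupp bs \<subseteq> {..<n} \<Longrightarrow> C (lrel \<sigma> bs) = C bs"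
  by (simp add: perm_invariant_def)

lemma card_lsupp_le_n:
  assumes "bs \<in> monomials F d n" shows "card (lsupp bs) \<le> n"
  using card_mono[OF _ lsupp_monomials[OF assms]] by simp

lemma num_inj_card:
  assumes "T \<subseteq> {..<n}"
  shows "num_inj n m T = num_inj n m {..<card T}"
proof -
  have "card T \<le> n" using card_mono[OF _ assms] by simp
  then show ?thesis using assms by (intro num_inj_cong) auto
qed

text \<open>For \<open>g\<close> in the kernel, subtracting a multiple of the averaged coefficients
  from \<open>C\<close> does not change the function represented. The inverse of the diagonal
  constant for \<open>s\<close> points clears one more size of support, and sizes already cleared
  stay cleared.\<close>

lemma rand_avg_injective_ZeroPad:
  assumes n: "n > 0" and g: "polyfun F ZeroPad d n g"
    and inv: "\<And>\<sigma> x. \<sigma> permutes {..<n} \<Longrightarrow> x \<in> space_of F n \<Longrightarrow> g (act F n \<sigma> x) = g x"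
    and zero: "\<And>x. x \<in> space_of F n \<Longrightarrow> rand_avg F ZeroPad n n g x = 0"
    and x: "x \<in> space_of F n"
  shows "g x = 0"
proof -
  let ?V = "space_of F n" and ?M = "monomials F d n" and ?m = "mon F ZeroPad"
  have "\<exists>C. perm_invariant n C \<and> (\<forall>bs\<in>?M. card (lsupp bs) < s \<longrightarrow> C bs = 0) \<and>
      (\<forall>x\<in>?V. g x = (\<Sum>bs\<in>?M. C bs * ?m bs x))" for s
  proof (induction s)
    case 0
    obtain C where "perm_invariant n C" "\<And>x. x \<in> ?V \<Longrightarrow> g x = (\<Sum>bs\<in>?M. C bs * ?m bs x)"
      using invariant_polyfun_ZeroPad[OF g inv] by blast
    then show ?case by auto
  next
    case (Suc s)
    then obtain C where C: "perm_invariant n C" "\<And>bs. bs \<in> ?M \<Longrightarrow> card (lsupp bs) < s \<Longrightarrow> C bs = 0"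
      and gC: "\<And>x. x \<in> ?V \<Longrightarrow> g x = (\<Sum>bs\<in>?M. C bs * ?m bs x)" by blast
    \<comment> \<open>For \<open>s\<close> greater than \<open>n\<close> this constant need not be
      positive, but then no monomial has \<open>s\<close> points.\<close>
    let ?c = "real (num_inj n n {..<s}) / real (n ^ n)"
    define C' where "C' bs = C bs - avg_coeff n n C bs / ?c" for bs
    have "perm_invariant n C'"
      using C(1) perm_invariant_avg_coeff[OF n, of n C] by (simp add: perm_invariant_def C'_def)
    moreover have "C' bs = 0" if bs: "bs \<in> ?M" and less: "card (lsupp bs) < Suc s" for bs
    proof -
      have vanish: "C (lrel f bs) = 0" if "f \<in> funs n n" "\<not> inj_on f (lsupp bs)" for f
      proof (rule C(2))
        show "lrel f bs \<in> ?M" using bs that(1) by (rule lrel_PiE)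
        show "card (lsupp (lrel f bs)) < s"
          using card_lsupp_not_inj[OF that(2)] less by linarith
      qed
      have lead: "avg_coeff n n C bs = real (num_inj n n (lsupp bs)) / real (n ^ n) * C bs"
        using C(1) lsupp_monomials[OF bs] vanish by (rule avg_coeff_leading)
      show ?thesis
      proof (cases "card (lsupp bs) = s")
        case True
        have "num_inj n n {..<s} > 0"
          using card_lsupp_le_n[OF bs] True by (intro num_inj_pos) auto
        then show ?thesis
          using n unfolding C'_def lead num_inj_card[OF lsupp_monomials[OF bs]] True by simp
      next
        case False
        then have "C bs = 0" using C(2)[OF bs] less by simp
        then show ?thesis by (simp add: C'_def lead)
      qed
    qed
    moreover have "g x = (\<Sum>bs\<in>?M. C' bs * ?m bs x)" if x: "x \<in> ?V" for x
    proof -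
      have "rand_avg F ZeroPad n n g x =
          rand_avg F ZeroPad n n (\<lambda>y. \<Sum>bs\<in>?M. C bs * ?m bs y) x"
        unfolding rand_avg_def by (rule avg_cong[OF refl]) (rule gC[OF lin_in_space])
      then have "(\<Sum>bs\<in>?M. avg_coeff n n C bs * ?m bs x) = 0"
        using zero[OF x] by (simp only: rand_avg_ZeroPad_sum)
      then have "(\<Sum>bs\<in>?M. avg_coeff n n C bs / ?c * ?m bs x) = 0"
        by (simp only: times_divide_eq_left sum_divide_distrib[symmetric] div_0)
      then show ?thesis
        by (simp only: C'_def left_diff_distrib sum_subtractf gC[OF x] diff_zero)
    qed
    ultimately show ?case by blast
  qed
  from this[of "Suc n"] obtain C where "\<And>bs. bs \<in> ?M \<Longrightarrow> C bs = 0"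
    "g x = (\<Sum>bs\<in>?M. C bs * ?m bs x)"
    using card_lsupp_le_n x by (metis le_imp_less_Suc)
  then show ?thesis by simp
qed

lemma avg_funs_restrict:
  assumes "k \<le> n" "l > 0"
    and cong: "\<And>f g. (\<And>i. i < k \<Longrightarrow> f i = g i) \<Longrightarrow> H f = H g"
  shows "avg H (funs n l) = avg H (funs k l)"
proof -
  have "avg (\<lambda>f. H ((\<lambda>i. i) \<circ> f \<circ> (\<lambda>i. i))) (funs n l) = avg H (funs k l)"
  proof (rule avg_PiE[where c = 1])
    show "card {a \<in> {..<l}. a = b} = 1" if "b \<in> {..<l}" for b
      using that by (rule card_filter_eq)
    show "{..<l} \<noteq> {}" using assms(2) by auto
    show "H f = H g" if "\<And>i. i \<in> {..<k} \<Longrightarrow> f i = g i" for f g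
      by (rule cong, rule that) simp
    show "(\<lambda>i. i) \<in> {..<k} \<rightarrow> {..<n}" using assms(1) by auto
  qed simp_all
  then show ?thesis by (simp add: o_def)
qed

lemma avg_coeff_restrict:
  assumes "lsupp bs \<subseteq> {..<k}" "k \<le> n" "l > 0"
  shows "avg_coeff n l C bs = avg_coeff k l C bs"
  unfolding avg_coeff_def using assms(2,3)
proof (rule avg_funs_restrict)
  show "C (lrel f bs) = C (lrel g bs)" if "\<And>i. i < k \<Longrightarrow> f i = g i" for f g
    by (rule arg_cong[where f = C], rule lrel_cong_less[OF assms(1) that])
qed

lemma move_into:
  assumes "bs \<in> monomials F d n" "card (lsupp bs) \<le> k" "k \<le> n"
  obtains \<tau> where "\<tau> permutes {..<n}" "lrel \<tau> bs \<in> monomials F d k"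
proof -
  obtain h where h: "inj_on h (lsupp bs)" "h ` lsupp bs \<subseteq> {..<k}"
    using assms(2) card_le_inj[of "lsupp bs" "{..<k}"] by auto
  then have "h ` lsupp bs \<subseteq> {..<n}" using assms(3) by fastforce
  then obtain \<tau> where \<tau>: "\<tau> permutes {..<n}" "\<And>i. i \<in> lsupp bs \<Longrightarrow> \<tau> i = h i"
    using extend_to_permutation[OF _ lsupp_monomials[OF assms(1)] h(1)] by blast
  then have "\<tau> ` lsupp bs \<subseteq> {..<k}" using h(2) by fastforce
  then show ?thesis using that \<tau>(1) lrel_monomials[OF assms(1)] by blast
qed

text \<open>A triangular system solved by increasing number of points. The correction
  \<open>R\<close> lives on exactly \<open>s\<close> points and cannot disturb the equations already
  solved, since relabelling never increases the number of points.\<close>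

lemma avg_coeff_surjective:
  assumes k: "k > 0" and P: "perm_invariant k P"
  obtains Q where "\<And>bs. bs \<in> monomials F d k \<Longrightarrow> avg_coeff k k Q bs = P bs"
proof -
  let ?M = "monomials F d k"
  have "\<exists>Q. perm_invariant k Q \<and> (\<forall>bs\<in>?M. card (lsupp bs) < s \<longrightarrow> avg_coeff k k Q bs = P bs)" for s
  proof (induction s)
    case 0
    show ?case using P by auto
  next
    case (Suc s)
    then obtain Q where Q: "perm_invariant k Q"
      "\<And>bs. bs \<in> ?M \<Longrightarrow> card (lsupp bs) < s \<Longrightarrow> avg_coeff k k Q bs = P bs" by blast
    let ?c = "real (num_inj k k {..<s}) / real (k ^ k)"
    define R where "R bs = (if card (lsupp bs) = s then (P bs - avg_coeff k k Q bs) / ?c else 0)" for bs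
    have R: "perm_invariant k R"
      using P perm_invariant_avg_coeff[OF k, of k Q]
      by (simp add: perm_invariant_def R_def card_lsupp_perm)
    have add: "avg_coeff k k (\<lambda>bs. Q bs + R bs) bs = avg_coeff k k Q bs + avg_coeff k k R bs" for bs
      by (simp add: avg_coeff_def avg_def sum.distrib add_divide_distrib)
    have "avg_coeff k k (\<lambda>bs. Q bs + R bs) bs = P bs"
      if bs: "bs \<in> ?M" and less: "card (lsupp bs) < Suc s" for bs
    proof -
      have "R (lrel f bs) = 0" if "\<not> inj_on f (lsupp bs)" for f
        using card_lsupp_not_inj[OF that] less by (simp add: R_def)
      then have lead: "avg_coeff k k R bs = real (num_inj k k (lsupp bs)) / real (k ^ k) * R bs"
        by (intro avg_coeff_leading R lsupp_monomials[OF bs])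
      show ?thesis
      proof (cases "card (lsupp bs) = s")
        case True
        have "num_inj k k {..<s} > 0"
          using card_lsupp_le_n[OF bs] True by (intro num_inj_pos) auto
        then show ?thesis
          using k unfolding add lead num_inj_card[OF lsupp_monomials[OF bs]] True
          by (simp add: R_def True)
      next
        case False
        then have "R bs = 0" by (simp add: R_def)
        then show ?thesis using False less Q(2)[OF bs] by (simp add: add lead)
      qed
    qed
    moreover have "perm_invariant k (\<lambda>bs. Q bs + R bs)"
      using Q(1) R by (simp add: perm_invariant_def)
    ultimately show ?case by blast
  qed
  from this[of "Suc k"] show ?thesis
    using card_lsupp_le_n[of _ F d k] that by (metis le_imp_less_Suc)
qed

text \<open>Only the equations on \<open>V_k\<close> have to be solved: a monomial has at most
  \<open>d * deg F\<close> points, a permutation moves these into \<open>{..<k}\<close>, and there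
  averaging over maps from \<open>n\<close> points or from \<open>k\<close> points is the
  same.\<close>

lemma rand_avg_surjective_ZeroPad:
  assumes k: "k > 0" "d * deg F \<le> k" "k \<le> n" and g: "polyfun F ZeroPad d n g"
    and inv: "\<And>\<sigma> x. \<sigma> permutes {..<n} \<Longrightarrow> x \<in> space_of F n \<Longrightarrow> g (act F n \<sigma> x) = g x"
  obtains q where "q \<in> polys_le F k d"
    "\<And>x. x \<in> space_of F n \<Longrightarrow> g x = rand_avg F ZeroPad k n (peval q) x"
proof -
  obtain P where P: "perm_invariant n P"
    "\<And>x. x \<in> space_of F n \<Longrightarrow> g x = (\<Sum>bs\<in>monomials F d n. P bs * mon F ZeroPad bs x)"
    using invariant_polyfun_ZeroPad[OF g inv] by blast
  have "perm_invariant k P"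
    unfolding perm_invariant_def
  proof (intro allI impI)
    fix \<sigma> bs assume "\<sigma> permutes {..<k}" "lsupp bs \<subseteq> {..<k}"
    moreover have "{..<k} \<subseteq> {..<n}" using k(3) by auto
    ultimately show "P (lrel \<sigma> bs) = P bs"
      using perm_invariantD[OF P(1)] by (meson order_trans permutes_subset)
  qed
  then obtain Q where Q: "\<And>bs. bs \<in> monomials F d k \<Longrightarrow> avg_coeff k k Q bs = P bs"
    using avg_coeff_surjective[OF k(1)] by blast
  obtain q where q: "q \<in> polys_le F k d"
    "\<And>x. peval q x = (\<Sum>bs\<in>monomials F d k. Q bs * mon F ZeroPad bs x)"
    using sum_mon_as_peval[where F = F and n = k and d = d and C = Q and S = ZeroPad] by blast
  have coeff: "avg_coeff n k Q bs = P bs" if bs: "bs \<in> monomials F d n" for bs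
  proof -
    have "card (lsupp bs) \<le> k" using card_lsupp_le[OF bs] k(2) by linarith
    then obtain \<tau> where \<tau>: "\<tau> permutes {..<n}" "lrel \<tau> bs \<in> monomials F d k"
      using move_into[OF bs _ k(3)] by blast
    have "avg_coeff n k Q bs = avg_coeff n k Q (lrel \<tau> bs)"
      using perm_invariantD[OF perm_invariant_avg_coeff[OF k(1)] \<tau>(1) lsupp_monomials[OF bs]] by simp
    also have "\<dots> = avg_coeff k k Q (lrel \<tau> bs)"
      using lsupp_monomials[OF \<tau>(2)] k by (intro avg_coeff_restrict) auto
    also have "\<dots> = P bs"
      using Q[OF \<tau>(2)] perm_invariantD[OF P(1) \<tau>(1) lsupp_monomials[OF bs]] by simp
    finally show ?thesis .
  qed
  have "g x = rand_avg F ZeroPad k n (peval q) x" if x: "x \<in> space_of F n" for x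
    unfolding q(2)[abs_def] rand_avg_ZeroPad_sum P(2)[OF x]
    by (rule sum.cong[OF refl]) (simp only: coeff)
  then show ?thesis using that q(1) by blast
qed

section \<open>Averaging monomials along pullbacks\<close>

definition orbit_avg :: "construction \<Rightarrow> nat \<Rightarrow> idx list \<Rightarrow> coord_vec \<Rightarrow> real" where
  "orbit_avg F n bs x = avg (\<lambda>\<sigma>. mon F Dupl (lrel \<sigma> bs) x) (perms n)"

lemma orbit_avg_perm:
  assumes "\<tau> permutes {..<n}" shows "orbit_avg F n (lrel \<tau> bs) = orbit_avg F n bs"
proof
  show "orbit_avg F n (lrel \<tau> bs) x = orbit_avg F n bs x" for x
    unfolding orbit_avg_def lrel_lrel
    using avg_perms_comp_right[OF assms, of "\<lambda>\<sigma>. mon F Dupl (lrel \<sigma> bs) x"] .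
qed

lemma rand_avg_mon_Dupl:
  assumes "bs \<in> monomials F d m"
  shows "rand_avg F Dupl m n (mon F Dupl bs) x = avg (\<lambda>f. mon F Dupl (lrel f bs) x) (funs m n)"
  unfolding rand_avg_def ext_maps.simps
  by (rule avg_cong[OF refl]) (rule mon_lin_Dupl[OF assms], blast)

lemma mon_lrel_cong:
  assumes "bs \<in> monomials F d m" "\<And>i. i < m \<Longrightarrow> f i = g i"
  shows "mon F S (lrel f bs) x = mon F S (lrel g bs) x"
  by (rule arg_cong[where f = "\<lambda>bs. mon F S bs x"])
    (rule lrel_cong_less[OF lsupp_monomials[OF assms(1)] assms(2)])

text \<open>A uniform random map followed by a permutation is again uniform, so each relabelled
  monomial may be replaced by its orbit average. Then all maps injective on the support contribute
  the same function.\<close>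

lemma rand_avg_mon_orbit_avg:
  assumes bs: "bs \<in> monomials F d m" and n: "n > 0"
  shows "rand_avg F Dupl m n (mon F Dupl bs) x = avg (\<lambda>f. orbit_avg F n (lrel f bs) x) (funs m n)"
proof -
  let ?H = "\<lambda>f. mon F Dupl (lrel f bs) x"
  have "avg (\<lambda>f. orbit_avg F n (lrel f bs) x) (funs m n) =
      avg (\<lambda>\<tau>. avg (\<lambda>f. ?H (\<tau> \<circ> f)) (funs m n)) (perms n)"
    unfolding orbit_avg_def lrel_lrel by (rule avg_swap)
  also have "\<dots> = avg (\<lambda>\<tau>. avg ?H (funs m n)) (perms n)"
  proof (rule avg_cong[OF refl])
    fix \<tau> assume "\<tau> \<in> perms n"
    then have "\<tau> permutes {..<n}" by simp
    then show "avg (\<lambda>f. ?H (\<tau> \<circ> f)) (funs m n) = avg ?H (funs m n)"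
      by (rule avg_perm_comp_funs[OF _ n]) (rule mon_lrel_cong[OF bs])
  qed
  finally show ?thesis by (simp only: rand_avg_mon_Dupl[OF bs] avg_perms_const)
qed

lemma rand_avg_orbit_avg:
  assumes bs: "bs \<in> monomials F d n" and n: "n > 0"
  shows "rand_avg F Dupl n n (orbit_avg F n bs) x = avg (\<lambda>f. orbit_avg F n (lrel f bs) x) (funs n n)"
proof -
  let ?H = "\<lambda>f. mon F Dupl (lrel f bs) x"
  have "rand_avg F Dupl n n (orbit_avg F n bs) x =
      avg (\<lambda>\<sigma>. rand_avg F Dupl n n (mon F Dupl (lrel \<sigma> bs)) x) (perms n)"
    unfolding rand_avg_def orbit_avg_def by (rule avg_swap)
  also have "\<dots> = avg (\<lambda>\<sigma>. rand_avg F Dupl n n (mon F Dupl bs) x) (perms n)"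
  proof (rule avg_cong[OF refl])
    fix \<sigma> assume "\<sigma> \<in> perms n"
    then have \<sigma>: "\<sigma> permutes {..<n}" by simp
    have "avg (\<lambda>f. ?H (f \<circ> \<sigma>)) (funs n n) = avg ?H (funs n n)"
      using \<sigma> n by (rule avg_funs_comp_perm) (rule mon_lrel_cong[OF bs])
    then show "rand_avg F Dupl n n (mon F Dupl (lrel \<sigma> bs)) x = rand_avg F Dupl n n (mon F Dupl bs) x"
      by (simp only: rand_avg_mon_Dupl[OF bs] rand_avg_mon_Dupl[OF lrel_perm[OF bs \<sigma>]] lrel_lrel)
  qed
  finally show ?thesis by (simp only: avg_perms_const rand_avg_mon_orbit_avg[OF bs n])
qed

lemma invariant_polyfun_Dupl:
  assumes "polyfun F Dupl d n g"
    and inv: "\<And>\<sigma> x. \<sigma> permutes {..<n} \<Longrightarrow> x \<in> space_of F n \<Longrightarrow> g (act F n \<sigma> x) = g x"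
  shows "in_span (monomials F d n) (orbit_avg F n) (space_of F n) g"
proof -
  obtain C where C: "\<And>x. x \<in> space_of F n \<Longrightarrow> g x = (\<Sum>bs\<in>monomials F d n. C bs * mon F Dupl bs x)"
    using assms(1) unfolding in_span_def by blast
  have "g x = (\<Sum>bs\<in>monomials F d n. C bs * orbit_avg F n bs x)" if x: "x \<in> space_of F n" for x
  proof -
    have "g x = avg (\<lambda>\<sigma>. g x) (perms n)" by (rule avg_perms_const[symmetric])
    also have "\<dots> = avg (\<lambda>\<sigma>. g (act F n \<sigma> x)) (perms n)"
      by (rule avg_cong[OF refl]) (simp add: inv x)
    also have "\<dots> = avg (\<lambda>\<sigma>. \<Sum>bs\<in>monomials F d n. C bs * mon F Dupl (lrel (inv \<sigma>) bs) x) (perms n)"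
    proof (rule avg_cong[OF refl])
      fix \<sigma> assume "\<sigma> \<in> perms n"
      then have \<sigma>: "\<sigma> permutes {..<n}" by simp
      show "g (act F n \<sigma> x) = (\<Sum>bs\<in>monomials F d n. C bs * mon F Dupl (lrel (inv \<sigma>) bs) x)"
        unfolding lin_perm_inverse(2)[OF \<sigma>] C[OF lin_in_space]
        using mon_lin_Dupl[OF _ permutes_funcset[OF permutes_inv[OF \<sigma>]]]
        by (intro sum.cong[OF refl]) (simp only:)
    qed
    also have "\<dots> = (\<Sum>bs\<in>monomials F d n. C bs * avg (\<lambda>\<sigma>. mon F Dupl (lrel (inv \<sigma>) bs) x) (perms n))"
      unfolding avg_sum avg_cmult ..
    also have "\<dots> = (\<Sum>bs\<in>monomials F d n. C bs * orbit_avg F n bs x)"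
      unfolding orbit_avg_def
      by (simp only: avg_perms_inv[where G = "\<lambda>\<sigma>. mon F Dupl (lrel \<sigma> _) x"])
    finally show ?thesis .
  qed
  then show ?thesis unfolding in_span_def by blast
qed

text \<open>
  For an invariant \<open>g\<close> in the kernel of the averaging operator, subtracting the multiple of the
  operator that annihilates the monomials with the largest number of points does not change \<open>g\<close>.
\<close>

lemma rand_avg_injective_Dupl:
  assumes n: "n > 0" and g: "polyfun F Dupl d n g"
    and inv: "\<And>\<sigma> x. \<sigma> permutes {..<n} \<Longrightarrow> x \<in> space_of F n \<Longrightarrow> g (act F n \<sigma> x) = g x"
    and zero: "\<And>x. x \<in> space_of F n \<Longrightarrow> rand_avg F Dupl n n g x = 0"
    and x: "x \<in> space_of F n"
  shows "g x = 0"
proof -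
  let ?V = "space_of F n" and ?A = "orbit_avg F n"
  \<comment> \<open>The elimination starts at \<open>W (Suc n)\<close>, which contains all
    monomials, and ends at \<open>W 0\<close>, which is empty and forces
    \<open>g x = 0\<close>.\<close>
  define W where "W s = {bs \<in> monomials F d n. card (lsupp bs) < s}" for s
  have fin: "finite (W s)" for s by (simp add: W_def)
  have *: "g x = 0" if "in_span (W s) ?A ?V g" for s
    using that
  proof (induction s)
    case 0
    then show ?case using x by (simp add: in_span_def W_def)
  next
    case (Suc s)
    then obtain C where C: "\<And>x. x \<in> ?V \<Longrightarrow> g x = (\<Sum>bs\<in>W (Suc s). C bs * ?A bs x)"
      unfolding in_span_def by blast
    let ?K = "\<lambda>bs x. avg (\<lambda>f. ?A (lrel f bs) x) (funs n n)"
    let ?c = "real (num_inj n n {..<s}) / real (n ^ n)"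
    \<comment> \<open>With \<open>s\<close> points the diagonal terms cancel and only maps with a
      collision remain; with fewer points both terms already lie in the smaller span.\<close>
    have "in_span (W s) ?A ?V (\<lambda>x. ?A bs x + (-1 / ?c) * ?K bs x)" if bs: "bs \<in> W (Suc s)" for bs
    proof -
      have bs': "bs \<in> monomials F d n" using bs by (simp add: W_def)
      show ?thesis
      proof (cases "card (lsupp bs) < s")
        case True
        have "in_span (W s) ?A ?V (\<lambda>x. 1 / real (card (funs n n)) * (\<Sum>f\<in>funs n n. ?A (lrel f bs) x))"
        proof (intro in_span_cmult in_span_sum in_span_base fin)
          fix f assume "f \<in> funs n n"
          then show "lrel f bs \<in> W s"
            using lrel_PiE[OF bs'] card_lsupp_lrel_le[of f bs] True by (simp add: W_def)
        qed
        moreover have "in_span (W s) ?A ?V (?A bs)"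
          using True bs' by (intro in_span_base fin) (simp add: W_def)
        ultimately show ?thesis
          unfolding avg_def by (intro in_span_add in_span_cmult) (simp_all only: mult_1 times_divide_eq_left)
      next
        case False
        then have s: "card (lsupp bs) = s" using bs by (simp add: W_def)
        have c: "num_inj n n {..<s} > 0"
          using card_lsupp_le_n[OF bs'] s by (intro num_inj_pos) auto
        let ?N = "{f \<in> funs n n. \<not> inj_on f (lsupp bs)}"
        have K: "?K bs x = ?c * ?A bs x + 1 / real (n ^ n) * (\<Sum>f\<in>?N. ?A (lrel f bs) x)" for x
        proof -
          have "(\<Sum>f\<in>{f \<in> funs n n. inj_on f (lsupp bs)}. ?A (lrel f bs) x) =
              (\<Sum>f\<in>{f \<in> funs n n. inj_on f (lsupp bs)}. ?A bs x)"
          proof (rule sum.cong[OF refl])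
            fix f assume "f \<in> {f \<in> funs n n. inj_on f (lsupp bs)}"
            then obtain \<sigma> where "\<sigma> permutes {..<n}" "lrel f bs = lrel \<sigma> bs"
              using lrel_inj_eq_perm[of f n n bs] lsupp_monomials[OF bs'] by blast
            then show "?A (lrel f bs) x = ?A bs x" by (simp only: orbit_avg_perm)
          qed
          also have "\<dots> = real (num_inj n n {..<s}) * ?A bs x"
            using num_inj_card[OF lsupp_monomials[OF bs']] s by (simp add: num_inj_def)
          finally show ?thesis
            unfolding avg_def sum_funs_split[of _ n n "lsupp bs"] card_funs
            by (simp add: add_divide_distrib)
        qed
        have "in_span (W s) ?A ?V (\<lambda>x. (-1 / ?c) * (1 / real (n ^ n) * (\<Sum>f\<in>?N. ?A (lrel f bs) x)))"
        proof (intro in_span_cmult in_span_sum in_span_base fin)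
          fix f assume "f \<in> ?N"
          then show "lrel f bs \<in> W s"
            using lrel_PiE[OF bs'] card_lsupp_not_inj[of f bs] s by (simp add: W_def)
        qed
        moreover have "(-1 / ?c) * (1 / real (n ^ n) * (\<Sum>f\<in>?N. ?A (lrel f bs) x)) =
            ?A bs x + (-1 / ?c) * ?K bs x" for x
          unfolding K using c n by (simp add: distrib_left)
        ultimately show ?thesis by (rule in_span_cong[rotated])
      qed
    qed
    then have "in_span (W s) ?A ?V (\<lambda>x. \<Sum>bs\<in>W (Suc s). C bs * (?A bs x + (-1 / ?c) * ?K bs x))"
      by (intro in_span_sum in_span_cmult)
    \<comment> \<open>The operator annihilates \<open>g\<close>, so modifying all generators in this
      way leaves the sum unchanged.\<close>
    moreover have "(\<Sum>bs\<in>W (Suc s). C bs * (?A bs x + (-1 / ?c) * ?K bs x)) = g x" if x: "x \<in> ?V" for x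
    proof -
      have "rand_avg F Dupl n n g x = rand_avg F Dupl n n (\<lambda>y. \<Sum>bs\<in>W (Suc s). C bs * ?A bs y) x"
        unfolding rand_avg_def by (rule avg_cong[OF refl]) (rule C[OF lin_in_space])
      also have "\<dots> = (\<Sum>bs\<in>W (Suc s). C bs * rand_avg F Dupl n n (?A bs) x)"
        unfolding rand_avg_def avg_sum avg_cmult ..
      also have "\<dots> = (\<Sum>bs\<in>W (Suc s). C bs * ?K bs x)"
      proof (rule sum.cong[OF refl])
        fix bs assume "bs \<in> W (Suc s)"
        then have "bs \<in> monomials F d n" by (simp add: W_def)
        from rand_avg_orbit_avg[OF this n]
        show "C bs * rand_avg F Dupl n n (?A bs) x = C bs * ?K bs x" by simp
      qed
      finally have K0: "(\<Sum>bs\<in>W (Suc s). C bs * ?K bs x) = 0" using zero[OF x] by simp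
      have "(\<Sum>bs\<in>W (Suc s). C bs * (?A bs x + (-1 / ?c) * ?K bs x)) =
          g x + (-1 / ?c) * (\<Sum>bs\<in>W (Suc s). C bs * ?K bs x)"
        unfolding C[OF x] sum_distrib_left sum.distrib[symmetric]
        by (rule sum.cong[OF refl]) (simp only: distrib_left mult.left_commute)
      then show ?thesis unfolding K0 by simp
    qed
    ultimately have "in_span (W s) ?A ?V g" by (rule in_span_cong[rotated])
    then show ?case by (rule Suc.IH)
  qed
  have "W (Suc n) = monomials F d n"
    using card_lsupp_le_n[of _ F d n] by (auto simp: W_def less_Suc_eq_le)
  then show ?thesis using *[of "Suc n"] invariant_polyfun_Dupl[OF g inv] by simp
qed

text \<open>The average of a monomial on \<open>V_k\<close> is a positive multiple of its orbit
  average on \<open>V_n\<close> plus orbit averages with fewer points. Solving for the leading term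
  yields all orbit averages by induction on the number of points.\<close>

lemma rand_avg_surjective_Dupl:
  assumes k: "k > 0" "d * deg F \<le> k" "k \<le> n" and g: "polyfun F Dupl d n g"
    and inv: "\<And>\<sigma> x. \<sigma> permutes {..<n} \<Longrightarrow> x \<in> space_of F n \<Longrightarrow> g (act F n \<sigma> x) = g x"
  obtains q where "q \<in> polys_le F k d"
    "\<And>x. x \<in> space_of F n \<Longrightarrow> g x = rand_avg F Dupl k n (peval q) x"
proof -
  have n: "n > 0" using k by simp
  let ?V = "space_of F n" and ?A = "orbit_avg F n"
  let ?M = "\<lambda>bs. rand_avg F Dupl k n (mon F Dupl bs)"
  have span: "in_span (monomials F d k) ?M ?V (?A bs)" if "bs \<in> monomials F d n" for bs
    using that
  proof (induction "card (lsupp bs)" arbitrary: bs rule: less_induct)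
    case less
    \<comment> \<open>Because \<open>d * deg F\<close> is at most \<open>k\<close>, a permutation
      moves the monomial into \<open>{..<k}\<close>, and its orbit average does not notice.\<close>
    have "card (lsupp bs) \<le> k" using card_lsupp_le[OF less.prems] k(2) by linarith
    then obtain \<tau> where \<tau>: "\<tau> permutes {..<n}" "lrel \<tau> bs \<in> monomials F d k"
      using move_into[OF less.prems _ k(3)] by blast
    define as where "as = lrel \<tau> bs"
    have as: "as \<in> monomials F d k" and card_as: "card (lsupp as) = card (lsupp bs)"
      using \<tau> card_lsupp_perm[OF \<tau>(1)] unfolding as_def by blast+
    have A: "?A as = ?A bs" unfolding as_def by (rule orbit_avg_perm[OF \<tau>(1)])
    let ?i = "real (num_inj k n (lsupp as))" and ?N = "{f \<in> funs k n. \<not> inj_on f (lsupp as)}"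
    have i: "?i > 0" using num_inj_pos[OF lsupp_monomials[OF as] k(3)] by simp
    have M: "?M as x = 1 / real (n ^ k) * (?i * ?A bs x + (\<Sum>f\<in>?N. ?A (lrel f as) x))" for x
    proof -
      have "(\<Sum>f\<in>{f \<in> funs k n. inj_on f (lsupp as)}. ?A (lrel f as) x) =
          (\<Sum>f\<in>{f \<in> funs k n. inj_on f (lsupp as)}. ?A bs x)"
      proof (rule sum.cong[OF refl])
        fix f assume "f \<in> {f \<in> funs k n. inj_on f (lsupp as)}"
        then obtain \<sigma> where "\<sigma> permutes {..<n}" "lrel f as = lrel \<sigma> as"
          using lrel_inj_eq_perm[of f k n as] lsupp_monomials[OF as] k(3) by blast
        then show "?A (lrel f as) x = ?A bs x" by (simp only: orbit_avg_perm A)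
      qed
      also have "\<dots> = ?i * ?A bs x" by (simp add: num_inj_def)
      finally show ?thesis
        unfolding rand_avg_mon_orbit_avg[OF as n] avg_def sum_funs_split[of _ k n "lsupp as"] card_funs
        by simp
    qed
    have "in_span (monomials F d k) ?M ?V
        (\<lambda>x. real (n ^ k) / ?i * ?M as x + (-1 / ?i) * (\<Sum>f\<in>?N. ?A (lrel f as) x))"
    proof (intro in_span_add in_span_cmult in_span_sum in_span_base finite_monomials as)
      fix f assume f: "f \<in> ?N"
      show "in_span (monomials F d k) ?M ?V (?A (lrel f as))"
      proof (rule less.hyps)
        show "card (lsupp (lrel f as)) < card (lsupp bs)"
          using card_lsupp_not_inj[of f as] f card_as by simp
        show "lrel f as \<in> monomials F d n"
          using lrel_PiE[OF as] f by blast
      qed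
    qed
    moreover have "real (n ^ k) / ?i * ?M as x + (-1 / ?i) * (\<Sum>f\<in>?N. ?A (lrel f as) x) = ?A bs x" for x
      unfolding M using i n by (simp add: distrib_left add_divide_distrib)
    ultimately show ?case by (rule in_span_cong[rotated])
  qed
  obtain C where C: "\<And>x. x \<in> ?V \<Longrightarrow> g x = (\<Sum>bs\<in>monomials F d n. C bs * ?A bs x)"
    using invariant_polyfun_Dupl[OF g inv] unfolding in_span_def by blast
  have "in_span (monomials F d k) ?M ?V (\<lambda>x. \<Sum>bs\<in>monomials F d n. C bs * ?A bs x)"
    by (intro in_span_sum in_span_cmult span)
  then obtain Q where Q: "\<And>x. x \<in> ?V \<Longrightarrow> g x = (\<Sum>bs\<in>monomials F d k. Q bs * ?M bs x)"
    unfolding in_span_def using C by metis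
  obtain q where q: "q \<in> polys_le F k d"
    "\<And>x. peval q x = (\<Sum>bs\<in>monomials F d k. Q bs * mon F Dupl bs x)"
    using sum_mon_as_peval[where F = F and n = k and d = d and C = Q and S = Dupl] by blast
  have "rand_avg F Dupl k n (peval q) x = (\<Sum>bs\<in>monomials F d k. Q bs * ?M bs x)" for x
    unfolding q(2)[abs_def] rand_avg_def avg_sum avg_cmult ..
  then show ?thesis using that q(1) Q by metis
qed

subsection \<open>Existence and uniqueness of dual costs\<close>

lemma rand_avg_injective:
  assumes "n > 0" "polyfun F S d n g"
    and "\<And>\<sigma> x. \<sigma> permutes {..<n} \<Longrightarrow> x \<in> space_of F n \<Longrightarrow> g (act F n \<sigma> x) = g x"
    and "\<And>x. x \<in> space_of F n \<Longrightarrow> rand_avg F S n n g x = 0"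
    and "x \<in> space_of F n"
  shows "g x = 0"
proof (cases S)
  case ZeroPad
  show ?thesis by (rule rand_avg_injective_ZeroPad[OF assms[unfolded ZeroPad]])
next
  case Dupl
  show ?thesis by (rule rand_avg_injective_Dupl[OF assms[unfolded Dupl]])
qed

lemma rand_avg_surjective:
  assumes "k > 0" "d * deg F \<le> k" "k \<le> n" "polyfun F S d n g"
    and "\<And>\<sigma> x. \<sigma> permutes {..<n} \<Longrightarrow> x \<in> space_of F n \<Longrightarrow> g (act F n \<sigma> x) = g x"
  obtains q where "q \<in> polys_le F k d"
    "\<And>x. x \<in> space_of F n \<Longrightarrow> g x = rand_avg F S k n (peval q) x"
proof (cases S)
  case ZeroPad
  show ?thesis
    by (rule rand_avg_surjective_ZeroPad[OF assms[unfolded ZeroPad]]) (use that ZeroPad in blast)+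
next
  case Dupl
  show ?thesis
    by (rule rand_avg_surjective_Dupl[OF assms[unfolded Dupl]]) (use that Dupl in blast)+
qed

lemma polyfun_lin:
  assumes g: "polyfun F S d m g" and f: "f \<in> index_maps S m n"
  shows "polyfun F S d n (\<lambda>x. g (lin F S m n f x))"
proof -
  obtain C where C: "\<And>x. x \<in> space_of F m \<Longrightarrow> g x = (\<Sum>bs\<in>monomials F d m. C bs * mon F S bs x)"
    using g unfolding in_span_def by blast
  show ?thesis
  proof (cases S)
    case ZeroPad
    have "g (lin F S m n f x) = (\<Sum>bs\<in>monomials F d n. C (lrel f bs) * mon F S bs x)" for x
      unfolding C[OF lin_in_space] unfolding ZeroPad
      using f by (intro sum_mon_lin_ZeroPad) (simp add: ZeroPad)
    then show ?thesis unfolding in_span_def by (intro exI[of _ "\<lambda>bs. C (lrel f bs)"] ballI)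
  next
    case Dupl
    have f': "f \<in> {..<m} \<rightarrow> {..<n}" using f by (simp add: Dupl)
    have eq: "g (lin F S m n f x) = (\<Sum>bs\<in>monomials F d m. C bs * mon F S (lrel f bs) x)" for x
      unfolding C[OF lin_in_space] unfolding Dupl
      by (rule sum.cong[OF refl]) (simp only: mon_lin_Dupl[OF _ f'])
    show ?thesis
      unfolding eq
    proof (intro in_span_sum in_span_cmult in_span_base finite_monomials)
      fix bs assume bs: "bs \<in> monomials F d m"
      show "lrel f bs \<in> monomials F d n"
        using bs by (rule lrel_monomials) (use lsupp_monomials[OF bs] f' in blast)
    qed
  qed
qed

lemma polyfun_sym_avg:
  assumes "polyfun F S d k g" "index_le (opposite S) k n"
  shows "polyfun F S d n (sym_avg F S k n g)"
proof -
  have "sym_avg F S k n g =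
      (\<lambda>x. 1 / real (card (perms n)) * (\<Sum>\<sigma>\<in>perms n. g (lin F S k n (sym_map S k n \<sigma>) x)))"
    by (simp add: sym_avg_def avg_def fun_eq_iff)
  moreover have "polyfun F S d n
      (\<lambda>x. 1 / real (card (perms n)) * (\<Sum>\<sigma>\<in>perms n. g (lin F S k n (sym_map S k n \<sigma>) x)))"
    using assms balanced_sym_map balanced_index_maps(2)
    by (intro in_span_cmult in_span_sum polyfun_lin) blast+
  ultimately show ?thesis by simp
qed

lemma index_le_pos: "index_le S n N \<Longrightarrow> n > 0 \<and> N > 0"
  by (cases S) auto

text \<open>Injectivity is applied to the difference of the symmetrizations: it is invariant, and by
  \<open>rand_avg_sym\<close> its average is the difference of the averages of \<open>q1\<close> and
  \<open>q2\<close>.\<close>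

lemma sym_avg_unique:
  assumes q1: "q1 \<in> polys_le F k1 d" and k1: "index_le (opposite S) k1 n"
    and q2: "q2 \<in> polys_le F k2 d" and k2: "index_le (opposite S) k2 n"
    and eq: "\<And>x. x \<in> space_of F n \<Longrightarrow> rand_avg F S k1 n (peval q1) x = rand_avg F S k2 n (peval q2) x"
    and x: "x \<in> space_of F n"
  shows "sym_avg F S k1 n (peval q1) x = sym_avg F S k2 n (peval q2) x"
proof -
  let ?g = "\<lambda>x. sym_avg F S k1 n (peval q1) x + (-1) * sym_avg F S k2 n (peval q2) x"
  have n: "n > 0" using index_le_pos[OF k1] by simp
  have "?g x = 0"
  proof (rule rand_avg_injective[OF n _ _ _ x])
    show "polyfun F S d n ?g"
      by (intro in_span_add in_span_cmult polyfun_sym_avg polyfun_peval q1 q2 k1 k2)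
    show "?g (act F n \<sigma> x) = ?g x" if "\<sigma> permutes {..<n}" for \<sigma> x
      using sym_avg_act[OF k1 that] sym_avg_act[OF k2 that] by simp
    show "rand_avg F S n n ?g x = 0" if x: "x \<in> space_of F n" for x
    proof -
      have "rand_avg F S n n ?g x = rand_avg F S n n (sym_avg F S k1 n (peval q1)) x -
          rand_avg F S n n (sym_avg F S k2 n (peval q2)) x"
        unfolding rand_avg_def by (simp add: avg_diff)
      then show ?thesis
        using rand_avg_sym[OF k1 n] rand_avg_sym[OF k2 n] eq[OF x] by simp
    qed
  qed
  then show ?thesis by simp
qed

lemma dual_cost_iff:
  assumes "k > 0"
  shows "dual_cost F S d p k q \<longleftrightarrow> q \<in> polys_le F k d \<and>
    (\<forall>n>0. \<forall>x\<in>space_of F n. peval (p n) x = rand_avg F S k n (peval q) x)"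
  unfolding dual_cost_def using expectation_deFinetti[OF assms, of _ F S "peval q"] by simp

lemma free_polys_embed:
  assumes "p \<in> free_polys F S d" "index_le S n N" "x \<in> space_of F n"
  shows "peval (p N) (lin F S N n (embed_map S n N) x) = peval (p n) x"
  using assms unfolding embed_eq[OF assms(2), symmetric] by (simp add: free_polys_def)

lemma dual_cost_exists:
  assumes p: "p \<in> free_polys F S d" and k: "k > 0" "d * deg F \<le> k"
  shows "\<exists>q. dual_cost F S d p k q"
proof -
  have ex: "\<exists>q. q \<in> polys_le F k d \<and>
      (\<forall>x\<in>space_of F n. peval (p n) x = rand_avg F S k n (peval q) x)" if "k \<le> n" for n
  proof (rule rand_avg_surjective[OF k that])
    have "n > 0" using that k by simp
    then show "polyfun F S d n (peval (p n))"
      using p by (intro polyfun_peval) (simp add: free_polys_def)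
    show "peval (p n) (act F n \<sigma> x) = peval (p n) x"
      if "\<sigma> permutes {..<n}" "x \<in> space_of F n" for \<sigma> x
      using p that \<open>n > 0\<close> by (simp add: free_polys_def)
  qed blast
  obtain q where q: "q \<in> polys_le F k d"
    "\<And>x. x \<in> space_of F k \<Longrightarrow> peval (p k) x = rand_avg F S k k (peval q) x"
    using ex[of k] by blast
  have kk: "index_le (opposite S) k k" using k by (cases S) auto
  have "peval (p n) x = rand_avg F S k n (peval q) x" if n: "n > 0" and x: "x \<in> space_of F n" for n x
  proof -
    \<comment> \<open>The product lies above both \<open>n\<close> and \<open>k\<close> in either
      index order.\<close>
    define N where "N = n * k"
    have N: "N > 0" "k \<le> N" using n k by (auto simp: N_def)
    have nN: "index_le S n N" and kN: "index_le S k N"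
      using n k by (cases S; simp add: N_def)+
    obtain r where r: "r \<in> polys_le F k d"
      "\<And>x. x \<in> space_of F N \<Longrightarrow> peval (p N) x = rand_avg F S k N (peval r) x"
      using ex[OF N(2)] by blast
    have pull: "peval (p m) y = rand_avg F S k m (peval r) y"
      if "index_le S m N" "y \<in> space_of F m" for m y
    proof -
      have "peval (p m) y = peval (p N) (lin F S N m (embed_map S m N) y)"
        using free_polys_embed[OF p that] by simp
      also have "\<dots> = rand_avg F S k m (peval r) y"
        using rand_avg_right[OF balanced_embed_map[OF that(1)] k(1)] index_le_pos[OF that(1)]
        by (simp add: r(2) lin_in_space)
      finally show ?thesis .
    qed
    \<comment> \<open>\<open>q\<close> is known to reproduce \<open>p k\<close> only, whereas
      \<open>r\<close> reproduces both \<open>p k\<close> and \<open>p n\<close>. Equal averages at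
      \<open>k\<close> force equal symmetrizations there, and averaging at \<open>n\<close> sees
      nothing else.\<close>
    have "sym_avg F S k k (peval r) y = sym_avg F S k k (peval q) y" if "y \<in> space_of F k" for y
      using r(1) kk q(1) kk _ that by (rule sym_avg_unique) (simp only: pull[OF kN, symmetric] q(2))
    then have "rand_avg F S k n (sym_avg F S k k (peval r)) x =
        rand_avg F S k n (sym_avg F S k k (peval q)) x"
      unfolding rand_avg_def by (intro avg_cong refl) (simp add: lin_in_space)
    then show ?thesis
      unfolding rand_avg_sym[OF kk n] by (simp add: pull[OF nN x])
  qed
  then show ?thesis using q(1) dual_cost_iff[OF k(1)] by blast
qed

lemma free_sym_unique:
  assumes "dual_cost F S d p k1 q1" "dual_cost F S d p k2 q2"
    and k1: "index_le (opposite S) k1 n" and k2: "index_le (opposite S) k2 n"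
    and x: "x \<in> space_of F n"
  shows "free_sym F (opposite S) k1 n q1 x = free_sym F (opposite S) k2 n q2 x"
  unfolding free_sym_eq[OF k1] free_sym_eq[OF k2]
proof (rule sym_avg_unique[OF _ k1 _ k2 _ x])
  have pos: "k1 > 0" "k2 > 0" "n > 0"
    using index_le_pos[OF k1] index_le_pos[OF k2] by auto
  show "q1 \<in> polys_le F k1 d" "q2 \<in> polys_le F k2 d"
    using assms(1,2) pos by (simp_all add: dual_cost_iff)
  show "rand_avg F S k1 n (peval q1) x = rand_avg F S k2 n (peval q2) x"
    if "x \<in> space_of F n" for x
    using assms(1,2) pos that by (metis dual_cost_iff)
qed

section \<open>Feasibility of index maps and monotonicity of the lower bounds\<close>

lemma realize_function:
  assumes "f \<in> {..<a} \<rightarrow> {..<b}" "b > (0::nat)"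
  obtains \<tau> where "\<tau> permutes {..<b * a}" "\<And>i. i < a \<Longrightarrow> \<tau> i div a = f i"
proof -
  \<comment> \<open>Offset \<open>i\<close> in block \<open>f i\<close>: any \<open>f\<close>
    becomes injective once each point of its target is replaced by a block of length
    \<open>a\<close>.\<close>
  let ?g = "\<lambda>i. f i * a + i"
  have div: "?g i div a = f i" if "i < a" for i using that by simp
  have "inj_on ?g {..<a}"
  proof (rule inj_onI)
    fix i j assume ij: "i \<in> {..<a}" "j \<in> {..<a}" "?g i = ?g j"
    then have "f i = f j" using div[of i] div[of j] by simp
    then show "i = j" using ij(3) by simp
  qed
  moreover have "?g ` {..<a} \<subseteq> {..<b * a}"
  proof
    fix l assume "l \<in> ?g ` {..<a}"
    then obtain i where i: "i < a" "l = ?g i" by auto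
    then have "f i < b" using assms(1) by auto
    then have "Suc (f i) * a \<le> b * a" by (intro mult_right_mono) auto
    then show "l \<in> {..<b * a}" using i by simp
  qed
  moreover have "{..<a} \<subseteq> {..<b * a}"
    using mult_le_mono1[of 1 b a] assms(2) by fastforce
  ultimately obtain \<tau> where "\<tau> permutes {..<b * a}" "\<And>i. i \<in> {..<a} \<Longrightarrow> \<tau> i = ?g i"
    using extend_to_permutation[of "{..<b * a}" "{..<a}" ?g] by blast
  then show ?thesis using that[of \<tau>] div by simp
qed

lemma FinSet_compatible_space:
  "FinSet_compatible F U L \<Omega> \<Longrightarrow> n > 0 \<Longrightarrow> x \<in> \<Omega> n \<Longrightarrow> x \<in> space_of F n"
  by (auto simp: FinSet_compatible_def)

text \<open>Every map of index sets factors through the embeddings into a common multiple and a permutation.\<close>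

lemma lin_in_feasible:
  assumes c: "FinSet_compatible F S (opposite S) \<Omega>"
    and f: "f \<in> index_maps S m n" and pos: "m > 0" "n > 0" and x: "x \<in> \<Omega> n"
  shows "lin F S m n f x \<in> \<Omega> m"
proof -
  define N where "N = n * m"
  have nN: "index_le S n N" and mN: "index_le (opposite S) m N"
    using pos by (cases S; simp add: N_def)+
  have step: "lin F S m N (embed_map (opposite S) m N)
      (lin F S N N (perm_map S \<sigma>) (lin F S N n (embed_map S n N) x)) \<in> \<Omega> m"
    if \<sigma>: "\<sigma> permutes {..<N}" for \<sigma>
    unfolding embed_eq[OF nN, symmetric] act_eq[OF \<sigma>, symmetric] embed_adj_eq[OF mN, symmetric]
    using c x \<sigma> nN mN pos by (simp add: FinSet_compatible_def image_subset_iff N_def)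
  have comp: "lin F S m N (embed_map (opposite S) m N)
      (lin F S N N (perm_map S \<sigma>) (lin F S N n (embed_map S n N) x)) =
      lin F S m n (compose_maps S (sym_map S m N \<sigma>) (embed_map S n N)) x"
    if \<sigma>: "\<sigma> permutes {..<N}" for \<sigma>
    unfolding embed_adj_eq[OF mN, symmetric] act_eq[OF \<sigma>, symmetric] embed_adj_act_eq[OF mN \<sigma>]
    by (intro lin_lin balanced_index_maps balanced_embed_map balanced_sym_map nN mN \<sigma>)
  obtain \<sigma> where \<sigma>: "\<sigma> permutes {..<N}"
    and eq: "\<And>i. i < (case S of Dupl \<Rightarrow> m | ZeroPad \<Rightarrow> n) \<Longrightarrow>
      compose_maps S (sym_map S m N \<sigma>) (embed_map S n N) i = f i"
  proof (cases S)
    case Dupl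
    obtain \<tau> where \<tau>: "\<tau> permutes {..<n * m}" "\<And>i. i < m \<Longrightarrow> \<tau> i div m = f i"
      using realize_function[of f m n] f pos by (auto simp: Dupl)
    have "N div n = m" using pos by (simp add: N_def)
    then show ?thesis
      using that[of "inv \<tau>"] permutes_inv[OF \<tau>(1)] permutes_inv_inv[OF \<tau>(1)] \<tau>(2)
      by (simp add: Dupl N_def sym_map_def)
  next
    case ZeroPad
    obtain \<tau> where \<tau>: "\<tau> permutes {..<m * n}" "\<And>i. i < n \<Longrightarrow> \<tau> i div n = f i"
      using realize_function[of f n m] f pos by (auto simp: ZeroPad)
    have "N div m = n" using pos by (simp add: N_def)
    then show ?thesis
      using that[of \<tau>] \<tau> by (simp add: ZeroPad N_def sym_map_def mult.commute)
  qed
  have "lin F S m n (compose_maps S (sym_map S m N \<sigma>) (embed_map S n N)) = lin F S m n f"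
    using eq by (rule lin_cong)
  then show ?thesis using step[OF \<sigma>] comp[OF \<sigma>] by simp
qed

lemma avg_ex_le:
  assumes "finite A" "A \<noteq> {}"
  shows "\<exists>a\<in>A. G a \<le> avg G A"
proof (rule ccontr)
  assume "\<not> ?thesis"
  then have "avg G A < G a" if "a \<in> A" for a using that by auto
  then have "(\<Sum>a\<in>A. avg G A) < (\<Sum>a\<in>A. G a)"
    using assms by (intro sum_strict_mono) auto
  then show False using assms by (simp add: avg_def)
qed

text \<open>The symmetrization at \<open>N\<close> is an average of the one at \<open>n\<close> over
  feasible points, and at one of these the value does not exceed the average.\<close>

lemma lower_val_mono:
  assumes c: "FinSet_compatible F S (opposite S) \<Omega>"
    and kn: "index_le (opposite S) k n" and nN: "index_le (opposite S) n N"
  shows "lower_val F (opposite S) \<Omega> k q n \<le> lower_val F (opposite S) \<Omega> k q N"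
proof -
  have kN: "index_le (opposite S) k N"
    using kn nN by (cases S) (auto intro: dvd_trans)
  show ?thesis
    unfolding lower_val_def free_sym_eq[OF kn] free_sym_eq[OF kN]
  proof (rule INF_greatest)
    fix x assume x: "x \<in> \<Omega> N"
    obtain \<tau> where \<tau>: "\<tau> \<in> perms N"
      "sym_avg F S k n (peval q) (lin F S n N (sym_map S n N \<tau>) x) \<le> sym_avg F S k N (peval q) x"
      unfolding sym_avg_sym_avg[OF kn nN, of F "peval q" x]
      using avg_ex_le[where A = "perms N" and
          G = "\<lambda>\<tau>. sym_avg F S k n (peval q) (lin F S n N (sym_map S n N \<tau>) x)",
          OF finite_perms perms_nonempty] by blast
    have "lin F S n N (sym_map S n N \<tau>) x \<in> \<Omega> n"
      using \<tau>(1) index_le_pos[OF nN]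
      by (intro lin_in_feasible[OF c _ _ _ x] balanced_index_maps(2) balanced_sym_map nN) auto
    then show "(INF x\<in>\<Omega> n. ereal (sym_avg F S k n (peval q) x)) \<le> ereal (sym_avg F S k N (peval q) x)"
      by (rule INF_lower2) (simp add: \<tau>(2))
  qed
qed

text \<open>The value of \<open>p n\<close> at \<open>x\<close> averages the symmetrization at
  \<open>N\<close> over random images of \<open>x\<close>, all of them feasible, so one image has at
  most this value.\<close>

lemma lower_val_le_upper_lim:
  assumes c: "FinSet_compatible F S (opposite S) \<Omega>"
    and kN: "index_le (opposite S) k N" and q: "dual_cost F S d p k q"
  shows "lower_val F (opposite S) \<Omega> k q N \<le> upper_lim \<Omega> p"
  unfolding upper_lim_def upper_val_def
proof (intro INF_greatest)
  fix n x assume "n \<in> {0<..}" and x: "x \<in> \<Omega> n"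
  then have n: "n > 0" by simp
  have k: "k > 0" "N > 0" using index_le_pos[OF kN] by auto
  have "peval (p n) x = rand_avg F S N n (sym_avg F S k N (peval q)) x"
    using q n FinSet_compatible_space[OF c n x] by (simp add: dual_cost_iff[OF k(1)] rand_avg_sym[OF kN n])
  then obtain f where f: "f \<in> ext_maps S N n"
    "sym_avg F S k N (peval q) (lin F S N n f x) \<le> peval (p n) x"
    unfolding rand_avg_def using avg_ex_le[OF finite_ext_maps ext_maps_nonempty[OF k(2) n]] by metis
  have "lin F S N n f x \<in> \<Omega> N"
    using lin_in_feasible[OF c ext_maps_subset[OF f(1)] k(2) n x] .
  then show "lower_val F (opposite S) \<Omega> k q N \<le> ereal (peval (p n) x)"
    unfolding lower_val_def free_sym_eq[OF kN] by (rule INF_lower2) (simp add: f(2))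
qed

subsection \<open>Rates of convergence\<close>

lemma continuous_on_prod_mset:
  fixes x :: "'a::topological_space \<Rightarrow> 'b \<Rightarrow> real"
  assumes "\<And>a. continuous_on V (\<lambda>y. x y a)"
  shows "continuous_on V (\<lambda>y. \<Prod>a\<in>#I. x y a)"
  by (induction I) (auto intro!: continuous_intros assms)

lemma continuous_on_coordinate: "continuous_on V (\<lambda>x::coord_vec. x a)"
  by (rule continuous_on_product_coordinates[THEN continuous_on_subset]) simp

lemma continuous_on_peval: "continuous_on V (peval q)"
  unfolding peval_def
  by (intro continuous_on_sum continuous_on_mult continuous_on_const continuous_on_prod_mset
      continuous_on_coordinate)

lemma continuous_on_lin: "continuous_on V (lin F S m n f)"
proof (rule continuous_on_coordinatewise_then_product)
  fix b
  show "continuous_on V (\<lambda>x. lin F S m n f x b)"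
  proof (cases S)
    case Dupl
    show ?thesis
    proof (cases "b \<in> basis F m \<and> relabel f b \<in> basis F n")
      case True
      show ?thesis unfolding Dupl lin_Dupl if_P[OF True]
        by (rule continuous_on_mult_left[OF continuous_on_coordinate])
    next
      case False
      show ?thesis unfolding Dupl lin_Dupl if_not_P[OF False] by (rule continuous_on_const)
    qed
  next
    case ZeroPad
    show ?thesis
      by (cases "b \<in> basis F m")
        (simp_all add: ZeroPad lin_ZeroPad continuous_on_sum continuous_on_coordinate del: lin.simps)
  qed
qed

lemma peval_bounded_on_compact:
  assumes "compact K"
  obtains B where "\<And>x. x \<in> K \<Longrightarrow> \<bar>peval q x\<bar> \<le> B"
proof -
  have "compact (peval q ` K)"
    using continuous_on_peval assms by (rule compact_continuous_image)
  then have "bounded (peval q ` K)" by (rule compact_imp_bounded)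
  then obtain B where "\<forall>y\<in>peval q ` K. norm y \<le> B" unfolding bounded_iff by blast
  then show ?thesis using that by auto
qed

text \<open>For a comparison with permutations, the random map on \<open>k\<close> points is
  extended to a random self-map of \<open>n\<close> points. Only its values on \<open>{..<k}\<close>
  matter, hence the constant \<open>k(k - 1)\<close>.\<close>

lemma rand_avg_minus_sym_avg_Dupl:
  assumes k: "k > 0" "k \<le> n"
    and bound: "\<And>f. f \<in> {..<k} \<rightarrow> {..<n} \<Longrightarrow> \<bar>G (lin F Dupl k n f x)\<bar> \<le> B"
  shows "\<bar>rand_avg F Dupl k n G x - sym_avg F Dupl k n G x\<bar> \<le> real k * (real k - 1) / real n * B"
proof -
  let ?\<Phi> = "\<lambda>f. G (lin F Dupl k n f x)"
  have cong: "?\<Phi> f = ?\<Phi> g" if "\<And>i. i < k \<Longrightarrow> f i = g i" for f g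
    by (rule arg_cong[where f = G], rule fun_cong[OF lin_cong]) (simp add: that)
  have "rand_avg F Dupl k n G x = avg ?\<Phi> (funs n n)"
    unfolding rand_avg_def ext_maps.simps
    using k by (intro avg_funs_restrict[symmetric] cong) auto
  moreover have "sym_avg F Dupl k n G x = avg ?\<Phi> (perms n)"
    using avg_perms_inv[of ?\<Phi> n] by (simp add: sym_avg_def sym_map_def o_def del: lin.simps)
  moreover have "\<bar>avg ?\<Phi> (funs n n) - avg ?\<Phi> (perms n)\<bar> \<le>
      real (card {..<k}) * (real (card {..<k}) - 1) / real n * B"
  proof (rule avg_uniform_minus_avg_perms)
    show "?\<Phi> f = ?\<Phi> g" if "\<And>i. i \<in> {..<k} \<Longrightarrow> f i = g i" for f g
      by (rule cong, rule that) simp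
    show "\<bar>?\<Phi> f\<bar> \<le> B" if "f \<in> {..<n} \<rightarrow> {..<n}" for f
      using that k by (intro bound) auto
  qed (use k in auto)
  ultimately show ?thesis by simp
qed

lemma sum_abs_mon_length:
  "(\<Sum>bs | set bs \<subseteq> basis F n \<and> length bs = j. \<bar>mon F ZeroPad bs x\<bar>) = norm1 F n x ^ j"
proof -
  \<comment> \<open>Having length \<open>j\<close> means lying over \<open>replicate j ()\<close>
    under a constant map, so the distributive law for fibres produces the power.\<close>
  have "{bs. set bs \<subseteq> basis F n \<and> length bs = j} =
      {bs. set bs \<subseteq> basis F n \<and> map (\<lambda>_. ()) bs = replicate j ()}"
    by (auto simp: map_replicate_const)
  moreover have "\<bar>mon F ZeroPad bs x\<bar> = prod_list (map (\<lambda>a. \<bar>x a\<bar>) bs)" for bs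
    by (induction bs) (simp_all add: mon_def abs_mult)
  ultimately have "(\<Sum>bs | set bs \<subseteq> basis F n \<and> length bs = j. \<bar>mon F ZeroPad bs x\<bar>) =
      prod_list (map (\<lambda>a. \<Sum>b | b \<in> basis F n \<and> () = a. \<bar>x b\<bar>) (replicate j ()))"
    by (simp only: prod_list_sum_fibres[OF finite_basis])
  then show ?thesis by (simp add: norm1_def prod_list_replicate)
qed

text \<open>Grouping by length \<open>j\<close> gives the powers of the norm, each at most
  \<open>R ^ d\<close> because \<open>R\<close> is at least 1; the lengths \<open>0, ..., d\<close>
  are then summed.\<close>

lemma sum_length_weighted_mon:
  assumes x: "norm1 F n x \<le> R" and "1 \<le> R" and "0 \<le> E"
  shows "(\<Sum>bs\<in>monomials F d n. \<bar>mon F ZeroPad bs x\<bar> * (real (length bs) * E)) \<le>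
    real d * (real d + 1) * E * R ^ d"
proof -
  have norm: "0 \<le> norm1 F n x" by (simp add: norm1_def sum_nonneg)
  have "(\<Sum>bs\<in>monomials F d n. \<bar>mon F ZeroPad bs x\<bar> * (real (length bs) * E)) =
      (\<Sum>j\<in>{..d}. \<Sum>bs | bs \<in> monomials F d n \<and> length bs = j. \<bar>mon F ZeroPad bs x\<bar> * (real (length bs) * E))"
  proof (rule sum.group[symmetric])
    show "length ` monomials F d n \<subseteq> {..d}" by (auto simp: monomials_def)
  qed simp_all
  also have "\<dots> = (\<Sum>j\<in>{..d}. norm1 F n x ^ j * (real j * E))"
  proof (rule sum.cong[OF refl])
    fix j assume "j \<in> {..d}"
    then have "{bs. bs \<in> monomials F d n \<and> length bs = j} = {bs. set bs \<subseteq> basis F n \<and> length bs = j}"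
      by (auto simp: monomials_def)
    then show "(\<Sum>bs | bs \<in> monomials F d n \<and> length bs = j. \<bar>mon F ZeroPad bs x\<bar> * (real (length bs) * E)) =
        norm1 F n x ^ j * (real j * E)"
      by (simp add: sum_abs_mon_length[symmetric] sum_distrib_right)
  qed
  also have "\<dots> \<le> (\<Sum>j\<in>{..d}. R ^ d * (real j * E))"
  proof (intro sum_mono mult_right_mono)
    fix j assume j: "j \<in> {..d}"
    have "norm1 F n x ^ j \<le> R ^ j" using x norm by (rule power_mono)
    also have "\<dots> \<le> R ^ d" using j assms(2) by (intro power_increasing) auto
    finally show "norm1 F n x ^ j \<le> R ^ d" .
    show "0 \<le> real j * E" using assms(3) by simp
  qed
  also have "\<dots> = R ^ d * (\<Sum>j\<le>d. real j) * E"
    by (simp add: sum_distrib_left sum_distrib_right mult.assoc)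
  also have "(\<Sum>j\<le>d. real j) = real d * (real d + 1) / 2"
    by (induction d) (auto simp: field_simps)
  also have "R ^ d * (real d * (real d + 1) / 2) * E \<le> R ^ d * (real d * (real d + 1)) * E"
    using assms(2,3) by (intro mult_right_mono mult_left_mono) auto
  finally show ?thesis by (simp add: mult_ac)
qed

text \<open>The random map goes from \<open>n\<close> to \<open>k\<close> points and cannot be
  compared with a permutation directly. As \<open>k\<close> divides \<open>n\<close>, it can be
  drawn as \<open>j \<circ> f\<close> with the block map \<open>j\<close> and a uniform self-map
  \<open>f\<close> of \<open>n\<close> points, while the symmetrization uses
  \<open>j \<circ> \<sigma>\<close>.\<close>

lemma rand_avg_minus_sym_avg_ZeroPad:
  assumes k: "k > 0" "n > 0" "k dvd n" and q: "q \<in> polys_le F k d"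
    and x: "norm1 F n x \<le> R" "1 \<le> R"
  shows "\<bar>rand_avg F ZeroPad k n (peval q) x - sym_avg F ZeroPad k n (peval q) x\<bar> \<le>
    real d * (real d + 1) * real (deg F) * (real d * real (deg F) - 1) / real n * coeff_norm q * R ^ d"
proof -
  let ?M = "monomials F d n" and ?m = "mon F ZeroPad" and ?Q = "coeff_norm q" and ?D = "real (deg F)"
  define j where "j = embed_map Dupl k n"
  obtain C where C: "\<And>x. peval q x = (\<Sum>bs\<in>monomials F d k. C bs * ?m bs x)"
    and C_le: "\<And>bs. \<bar>C bs\<bar> \<le> ?Q"
    by (rule peval_as_sum_mon[OF q, where S = ZeroPad]) simp
  have Q0: "0 \<le> ?Q" using C_le[of "[]"] by linarith
  have j: "balanced Dupl n k j"
    unfolding j_def using k by (intro balanced_embed_map) simp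
  then obtain c where jm: "j \<in> {..<n} \<rightarrow> {..<k}" and c: "c > 0" "\<And>i. i \<in> {..<k} \<Longrightarrow> card {l \<in> {..<n}. j l = i} = c"
    unfolding balanced.simps by blast
  let ?\<Phi> = "\<lambda>bs f. C (lrel (j \<circ> f) bs)"
  have cong: "?\<Phi> bs f = ?\<Phi> bs g" if "\<And>i. i \<in> lsupp bs \<Longrightarrow> f i = g i" for bs f g
    by (rule arg_cong[where f = C], rule lrel_cong) (simp add: that)
  have "rand_avg F ZeroPad k n (peval q) x = (\<Sum>bs\<in>?M. avg (?\<Phi> bs) (funs n n) * ?m bs x)"
    unfolding C[abs_def] rand_avg_ZeroPad_sum
  proof (rule sum.cong[OF refl])
    fix bs assume bs: "bs \<in> ?M"
    have "avg (\<lambda>f. C (lrel (j \<circ> f \<circ> (\<lambda>i. i)) bs)) (funs n n) = avg (\<lambda>f. C (lrel f bs)) (funs n k)"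
    proof (rule avg_PiE[where c = c and G = "\<lambda>f. C (lrel f bs)"])
      show "j \<in> {..<n} \<rightarrow> {..<k}" by (rule jm)
      show "0 < c" by (rule c(1))
      show "card {l \<in> {..<n}. j l = i} = c" if "i \<in> {..<k}" for i using that by (rule c(2))
      show "C (lrel f bs) = C (lrel g bs)" if "\<And>i. i \<in> {..<n} \<Longrightarrow> f i = g i" for f g
        by (rule arg_cong[where f = C], rule lrel_cong_less[OF lsupp_monomials[OF bs]], rule that) simp
      show "{..<n} \<noteq> {}" using k by auto
    qed simp_all
    then show "avg_coeff n k C bs * ?m bs x = avg (?\<Phi> bs) (funs n n) * ?m bs x"
      by (simp add: avg_coeff_def o_def)
  qed
  moreover have "sym_avg F ZeroPad k n (peval q) x = (\<Sum>bs\<in>?M. avg (?\<Phi> bs) (perms n) * ?m bs x)"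
  proof -
    have "sym_avg F ZeroPad k n (peval q) x = avg (\<lambda>\<sigma>. \<Sum>bs\<in>?M. ?\<Phi> bs \<sigma> * ?m bs x) (perms n)"
      unfolding sym_avg_def
    proof (rule avg_cong[OF refl])
      fix \<sigma> assume "\<sigma> \<in> perms n"
      then have "j \<circ> \<sigma> \<in> {..<n} \<rightarrow> {..<k}" using jm by (auto simp: permutes_lessThan Pi_iff)
      moreover have "sym_map ZeroPad k n \<sigma> = j \<circ> \<sigma>" by (simp add: sym_map_def j_def)
      ultimately show "peval q (lin F ZeroPad k n (sym_map ZeroPad k n \<sigma>) x) =
          (\<Sum>bs\<in>?M. ?\<Phi> bs \<sigma> * ?m bs x)"
        unfolding C using sum_mon_lin_ZeroPad[of "j \<circ> \<sigma>" n k] by simp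
    qed
    then show ?thesis by (simp only: avg_sum avg_cmult_right)
  qed
  ultimately have "\<bar>rand_avg F ZeroPad k n (peval q) x - sym_avg F ZeroPad k n (peval q) x\<bar> =
      \<bar>\<Sum>bs\<in>?M. (avg (?\<Phi> bs) (funs n n) - avg (?\<Phi> bs) (perms n)) * ?m bs x\<bar>"
    by (simp only: left_diff_distrib sum_subtractf)
  also have "\<dots> \<le> (\<Sum>bs\<in>?M. \<bar>?m bs x\<bar> * (real (length bs) * (?D * (real d * ?D - 1) / real n * ?Q)))"
  proof (rule order_trans[OF sum_abs sum_mono])
    fix bs assume bs: "bs \<in> ?M"
    let ?s = "card (lsupp bs)"
    have "\<bar>avg (?\<Phi> bs) (funs n n) - avg (?\<Phi> bs) (perms n)\<bar> \<le> real ?s * (real ?s - 1) / real n * ?Q"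
      by (rule avg_uniform_minus_avg_perms[OF lsupp_monomials[OF bs] k(2)], rule cong) (auto simp: C_le)
    also have "\<dots> \<le> real (length bs) * ?D * (real d * ?D - 1) / real n * ?Q"
    proof (intro mult_right_mono divide_right_mono Q0 of_nat_0_le_iff)
      have s1: "real ?s \<le> real (length bs) * ?D"
        using card_lsupp_le_degree[OF bs] by (metis of_nat_mono of_nat_mult)
      have s2: "real ?s \<le> real d * ?D"
        using card_lsupp_le[OF bs] by (metis of_nat_mono of_nat_mult)
      \<comment> \<open>One factor is bounded through the length, which is later summed over the
        monomials, the other through the uniform bound \<open>dD\<close>.\<close>
      show "real ?s * (real ?s - 1) \<le> real (length bs) * ?D * (real d * ?D - 1)"
      proof (cases "?s = 0")
        \<comment> \<open>Without points the left side is 0, so the right side must be nonnegative: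
          \<open>dD - 1\<close> is negative only if \<open>d\<close> or \<open>D\<close> is 0, and
          then the length or \<open>D\<close> makes the product vanish.\<close>
        case True
        show ?thesis
        proof (cases "length bs = 0 \<or> deg F = 0")
          case False
          then have "1 \<le> length bs" by (simp add: Suc_le_eq)
          also have "length bs \<le> d" using bs by (simp add: monomials_def)
          finally have "1 \<le> d" .
          then have "1 \<le> d * deg F" using False by (simp add: Suc_le_eq)
          then have "1 \<le> real d * ?D" by (metis of_nat_1 of_nat_mono of_nat_mult)
          then show ?thesis by (simp add: True)
        qed (auto simp: True)
      next
        case False
        then have "1 \<le> real ?s" by linarith
        with s1 s2 show ?thesis by (intro mult_mono) linarith+
      qed
    qed
    finally have "\<bar>avg (?\<Phi> bs) (funs n n) - avg (?\<Phi> bs) (perms n)\<bar> * \<bar>?m bs x\<bar> \<le>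
        real (length bs) * ?D * (real d * ?D - 1) / real n * ?Q * \<bar>?m bs x\<bar>"
      by (rule mult_right_mono) simp
    then show "\<bar>(avg (?\<Phi> bs) (funs n n) - avg (?\<Phi> bs) (perms n)) * ?m bs x\<bar> \<le>
        \<bar>?m bs x\<bar> * (real (length bs) * (?D * (real d * ?D - 1) / real n * ?Q))"
      by (simp add: abs_mult mult_ac)
  qed
  also have "\<dots> \<le> real d * (real d + 1) * (?D * (real d * ?D - 1) / real n * ?Q) * R ^ d"
  \<comment> \<open>For \<open>d = 0\<close> the factor \<open>dD - 1\<close> is negative, but the
    empty list is the only monomial and has length 0.\<close>
  proof (cases "d = 0")
    case True
    then show ?thesis by (simp add: monomials_def)
  next
    case False
    have "0 \<le> ?D * (real d * ?D - 1)"
    proof (cases "deg F = 0")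
      case False
      then have "1 \<le> d * deg F" using \<open>d \<noteq> 0\<close> by (simp add: Suc_le_eq)
      then have "1 \<le> real d * ?D" by (metis of_nat_1 of_nat_mono of_nat_mult)
      then show ?thesis by simp
    qed simp
    then show ?thesis using Q0 x by (intro sum_length_weighted_mon) simp_all
  qed
  finally show ?thesis by (simp add: mult_ac)
qed

text \<open>A difference of extended reals is safe only for finite values. Compactness and
  nonemptiness make \<open>upper_val\<close> finite, and the pointwise bound transfers this to
  \<open>lower_val\<close>.\<close>

lemma upper_val_minus_lower_val:
  assumes "compact (\<Omega> n)" "\<Omega> n \<noteq> {}" and kn: "index_le (opposite S) k n"
    and bound: "\<And>x. x \<in> \<Omega> n \<Longrightarrow> peval (p n) x - sym_avg F S k n (peval q) x \<le> B"
  shows "upper_val \<Omega> p n - lower_val F (opposite S) \<Omega> k q n \<le> ereal B"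
    and "upper_val \<Omega> p n \<le> lower_val F (opposite S) \<Omega> k q n + ereal B"
proof -
  let ?u = "upper_val \<Omega> p n" and ?l = "lower_val F (opposite S) \<Omega> k q n"
  obtain c where c: "\<And>x. x \<in> \<Omega> n \<Longrightarrow> \<bar>peval (p n) x\<bar> \<le> c"
    using peval_bounded_on_compact[OF assms(1)] by blast
  obtain x0 where x0: "x0 \<in> \<Omega> n" using assms(2) by blast
  have "ereal (- c) \<le> ?u"
    unfolding upper_val_def by (rule INF_greatest) (use c in \<open>fastforce simp: abs_le_iff\<close>)
  moreover have "?u \<le> ereal (peval (p n) x0)"
    unfolding upper_val_def using x0 by (rule INF_lower)
  ultimately obtain u where u: "?u = ereal u" by (cases ?u) auto
  have "ereal (u - B) \<le> ?l"
    unfolding lower_val_def free_sym_eq[OF kn]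
  proof (rule INF_greatest)
    fix x assume x: "x \<in> \<Omega> n"
    have "?u \<le> ereal (peval (p n) x)"
      unfolding upper_val_def using x by (rule INF_lower)
    then have "u \<le> peval (p n) x" by (simp add: u)
    then show "ereal (u - B) \<le> ereal (sym_avg F S k n (peval q) x)"
      using bound[OF x] by simp
  qed
  moreover have "?l \<le> ereal (sym_avg F S k n (peval q) x0)"
    unfolding lower_val_def free_sym_eq[OF kn] using x0 by (rule INF_lower)
  ultimately obtain l where l: "?l = ereal l" "u - B \<le> l" by (cases ?l) auto
  then show "?u - ?l \<le> ereal B" "?u \<le> ?l + ereal B" by (simp_all add: u)
qed

lemma radius_bound:
  assumes "radius F \<Omega> < \<infinity>" "\<And>n. n > 0 \<Longrightarrow> \<Omega> n \<noteq> {}"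
  shows "\<exists>R. radius F \<Omega> = ereal R \<and> (\<forall>n>0. \<forall>x\<in>\<Omega> n. norm1 F n x \<le> R)"
proof -
  have le: "ereal (norm1 F n x) \<le> radius F \<Omega>" if "n > 0" "x \<in> \<Omega> n" for n x
    unfolding radius_def using that by (intro SUP_upper2[of n]) (auto intro: SUP_upper)
  obtain x where x: "x \<in> \<Omega> 1" using assms(2)[of 1] by auto
  have "0 \<le> norm1 F 1 x" by (simp add: norm1_def sum_nonneg)
  then have "0 \<le> radius F \<Omega>" using le[OF _ x] by (metis ereal_less_eq(5) less_one order_trans)
  then obtain R where R: "radius F \<Omega> = ereal R"
    using assms(1) by (cases "radius F \<Omega>") auto
  then show ?thesis using le by simp
qed

lemma dual_cost_minus_sym_ZeroPad:
  assumes c: "FinSet_compatible F ZeroPad Dupl \<Omega>" and q: "dual_cost F ZeroPad d p k q"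
    and k: "k > 0" "n > 0" "k dvd n" and x: "x \<in> \<Omega> n"
    and R: "norm1 F n x \<le> R"
  shows "peval (p n) x - sym_avg F ZeroPad k n (peval q) x \<le>
    real d * (real d + 1) * real (deg F) * (real d * real (deg F) - 1) / real n * coeff_norm q * max 1 R ^ d"
proof -
  have "q \<in> polys_le F k d" and eq: "peval (p n) x = rand_avg F ZeroPad k n (peval q) x"
    using q k(2) FinSet_compatible_space[OF c k(2) x] by (simp_all add: dual_cost_iff[OF k(1)])
  from rand_avg_minus_sym_avg_ZeroPad[OF k this(1), of x "max 1 R"] R
  show ?thesis unfolding eq by (simp add: max.coboundedI2 abs_le_iff)
qed

lemma dual_cost_minus_sym_Dupl:
  assumes c: "FinSet_compatible F Dupl ZeroPad \<Omega>" and q: "dual_cost F Dupl d p k q"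
    and k: "k > 0" "k \<le> n" and x: "x \<in> \<Omega> n"
    and B: "\<And>y. y \<in> \<Omega> k \<Longrightarrow> \<bar>peval q y\<bar> \<le> B"
  shows "peval (p n) x - sym_avg F Dupl k n (peval q) x \<le> real k * (real k - 1) / real n * B"
proof -
  have n: "n > 0" using k by simp
  have c': "FinSet_compatible F Dupl (opposite Dupl) \<Omega>" using c by simp
  have eq: "peval (p n) x = rand_avg F Dupl k n (peval q) x"
    using q n FinSet_compatible_space[OF c n x] by (simp add: dual_cost_iff[OF k(1)])
  have "\<bar>rand_avg F Dupl k n (peval q) x - sym_avg F Dupl k n (peval q) x\<bar> \<le>
      real k * (real k - 1) / real n * B"
  proof (rule rand_avg_minus_sym_avg_Dupl[OF k])
    fix f assume "f \<in> {..<k} \<rightarrow> {..<n}"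
    then have "f \<in> index_maps Dupl k n" by simp
    then show "\<bar>peval q (lin F Dupl k n f x)\<bar> \<le> B"
      by (intro B lin_in_feasible[OF c' _ k(1) n x])
  qed
  then show ?thesis unfolding eq by linarith
qed

lemma dual_cost_minus_sym_le:
  assumes c: "FinSet_compatible F S (opposite S) \<Omega>" and q: "dual_cost F S d p k q" and k: "k > 0"
    and comp: "compact (\<Omega> k)" and ne: "\<And>n. n > 0 \<Longrightarrow> \<Omega> n \<noteq> {}"
    and bounded: "S = ZeroPad \<Longrightarrow> radius F \<Omega> < \<infinity>"
  obtains B where "\<And>n x. index_le (opposite S) k n \<Longrightarrow> x \<in> \<Omega> n \<Longrightarrow>
    peval (p n) x - sym_avg F S k n (peval q) x \<le> B / real n"
proof (cases S)
  case ZeroPad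
  have "\<exists>R. radius F \<Omega> = ereal R \<and> (\<forall>n>0. \<forall>x\<in>\<Omega> n. norm1 F n x \<le> R)"
    using bounded[OF ZeroPad] ne by (rule radius_bound)
  then obtain R where R: "\<forall>n>0. \<forall>x\<in>\<Omega> n. norm1 F n x \<le> R" by blast
  show ?thesis
  proof (rule that)
    fix n x assume n: "index_le (opposite S) k n" and x: "x \<in> \<Omega> n"
    then have kn: "n > 0" "k dvd n" by (auto simp: ZeroPad)
    have "FinSet_compatible F ZeroPad Dupl \<Omega>" using c by (simp add: ZeroPad)
    from dual_cost_minus_sym_ZeroPad[OF this q[unfolded ZeroPad] k kn x R[rule_format, OF kn(1) x]]
    show "peval (p n) x - sym_avg F S k n (peval q) x \<le>
        (real d * (real d + 1) * real (deg F) * (real d * real (deg F) - 1) * coeff_norm q * max 1 R ^ d) / real n"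
      unfolding ZeroPad times_divide_eq_left .
  qed
next
  case Dupl
  obtain B where B: "\<And>y. y \<in> \<Omega> k \<Longrightarrow> \<bar>peval q y\<bar> \<le> B"
    using peval_bounded_on_compact[OF comp] by blast
  show ?thesis
  proof (rule that)
    fix n x assume n: "index_le (opposite S) k n" and x: "x \<in> \<Omega> n"
    then have kn: "k \<le> n" by (simp add: Dupl)
    have "FinSet_compatible F Dupl ZeroPad \<Omega>" using c by (simp add: Dupl)
    from dual_cost_minus_sym_Dupl[OF this q[unfolded Dupl] k kn x B]
    show "peval (p n) x - sym_avg F S k n (peval q) x \<le> (real k * (real k - 1) * B) / real n"
      unfolding Dupl times_divide_eq_left .
  qed
qed

lemma SUP_lower_val:
  assumes c: "FinSet_compatible F S (opposite S) \<Omega>" and q: "dual_cost F S d p k q" and k: "k > 0"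
    and comp: "\<And>n. n > 0 \<Longrightarrow> compact (\<Omega> n)" and ne: "\<And>n. n > 0 \<Longrightarrow> \<Omega> n \<noteq> {}"
    and bounded: "S = ZeroPad \<Longrightarrow> radius F \<Omega> < \<infinity>"
  shows "(SUP n\<in>{n. index_le (opposite S) k n}. lower_val F (opposite S) \<Omega> k q n) = upper_lim \<Omega> p"
    (is "?sup = _")
proof (rule antisym)
  show "?sup \<le> upper_lim \<Omega> p"
    by (rule SUP_least) (use lower_val_le_upper_lim[OF c _ q] in blast)
  obtain B where B: "\<And>n x. index_le (opposite S) k n \<Longrightarrow> x \<in> \<Omega> n \<Longrightarrow>
      peval (p n) x - sym_avg F S k n (peval q) x \<le> B / real n"
    using dual_cost_minus_sym_le[OF c q k comp[OF k] ne bounded] by blast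
  show "upper_lim \<Omega> p \<le> ?sup"
  proof (rule ereal_le_epsilon2)
    fix e :: real assume e: "0 < e"
    obtain j where "B / e < real j" using reals_Archimedean2 by blast
    also have "j \<le> k * Suc j" using k by (cases k) auto
    then have "real j \<le> real (k * Suc j)" by (rule of_nat_mono)
    finally have je: "B / real (k * Suc j) \<le> e"
      using e k by (simp add: field_simps del: of_nat_mult of_nat_Suc)
    \<comment> \<open>Multiples of \<open>k\<close> lie above \<open>k\<close> in both index orders,
      so one sequence with vanishing gap serves both cases.\<close>
    define n where "n = k * Suc j"
    have n: "index_le (opposite S) k n" "n > 0"
      using k by (cases S; simp add: n_def)+
    have "upper_lim \<Omega> p \<le> upper_val \<Omega> p n"
      unfolding upper_lim_def using n(2) by (intro INF_lower) simp
    also have "\<dots> \<le> lower_val F (opposite S) \<Omega> k q n + ereal (B / real n)"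
      by (rule upper_val_minus_lower_val(2)[where \<Omega> = \<Omega> and n = n, OF comp[OF n(2)] ne[OF n(2)] n(1)]) (rule B[OF n(1)])
    also have "\<dots> \<le> ?sup + ereal e"
      using je n(1) by (intro add_mono SUP_upper) (simp_all add: n_def)
    finally show "upper_lim \<Omega> p \<le> ?sup + ereal e" .
  qed
qed

subsection \<open>Free measures\<close>

text \<open>The space of a pmf also contains the functions outside its support. They have
  probability 0 but must be sent into \<open>\<Omega> m\<close> for measurability, so an arbitrary
  point is chosen there.\<close>

definition deFinetti_law ::
  "construction \<Rightarrow> base_seq \<Rightarrow> (nat \<Rightarrow> coord_vec set) \<Rightarrow> nat \<Rightarrow> coord_vec \<Rightarrow> nat \<Rightarrow> coord_vec measure" where
  "deFinetti_law F S \<Omega> n x m =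
    distr (measure_pmf (pmf_of_set (ext_maps S m n))) (restrict_space borel (\<Omega> m))
      (\<lambda>f. if f \<in> ext_maps S m n then lin F S m n f x else (SOME y. y \<in> \<Omega> m))"

lemma lin_measurable:
  assumes "\<And>x. x \<in> A \<Longrightarrow> lin F S m n f x \<in> B"
  shows "lin F S m n f \<in> measurable (restrict_space borel A) (restrict_space borel B)"
  by (rule measurable_restrict_space3[OF borel_measurable_continuous_onI[OF continuous_on_lin]])
    (use assms in auto)

context
  fixes F :: construction and S :: base_seq and \<Omega> :: "nat \<Rightarrow> coord_vec set" and n :: nat and x :: coord_vec
  assumes c: "FinSet_compatible F S (opposite S) \<Omega>" and n: "n > 0" and x: "x \<in> \<Omega> n"
    and ne: "\<And>m. m > 0 \<Longrightarrow> \<Omega> m \<noteq> {}"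
begin

lemma deFinetti_map_in_feasible:
  assumes "m > 0"
  shows "(if f \<in> ext_maps S m n then lin F S m n f x else (SOME y. y \<in> \<Omega> m)) \<in> \<Omega> m"
  using lin_in_feasible[OF c ext_maps_subset assms n x] some_in_eq[of "\<Omega> m"] ne[OF assms] by auto

lemma deFinetti_map_measurable:
  assumes "m > 0"
  shows "(\<lambda>f. if f \<in> ext_maps S m n then lin F S m n f x else (SOME y. y \<in> \<Omega> m)) \<in>
    measurable (measure_pmf (pmf_of_set (ext_maps S m n))) (restrict_space borel (\<Omega> m))"
  using deFinetti_map_in_feasible[OF assms] by (simp add: space_restrict_space)

lemma prob_space_deFinetti_law: "m > 0 \<Longrightarrow> prob_space (deFinetti_law F S \<Omega> n x m)"
  unfolding deFinetti_law_def
  by (rule prob_space.prob_space_distr[OF prob_space_measure_pmf deFinetti_map_measurable])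

lemma sets_deFinetti_law: "sets (deFinetti_law F S \<Omega> n x m) = sets (restrict_space borel (\<Omega> m))"
  by (simp add: deFinetti_law_def)

lemma space_deFinetti_law: "space (deFinetti_law F S \<Omega> n x m) = \<Omega> m"
  by (simp add: deFinetti_law_def space_restrict_space)

text \<open>Probabilities are averages of indicators; in this form \<open>rand_avg_left\<close>,
  which holds for arbitrary functions, transfers to measures.\<close>

lemma emeasure_deFinetti_law:
  assumes m: "m > 0" and X: "X \<in> sets (restrict_space borel (\<Omega> m))"
  shows "emeasure (deFinetti_law F S \<Omega> n x m) X = ennreal (rand_avg F S m n (indicator X) x)"
proof -
  let ?E = "ext_maps S m n"
  let ?T = "\<lambda>f. if f \<in> ?E then lin F S m n f x else (SOME y. y \<in> \<Omega> m)"
  have "emeasure (deFinetti_law F S \<Omega> n x m) X = emeasure (measure_pmf (pmf_of_set ?E)) (?T -` X)"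
    unfolding deFinetti_law_def by (simp add: emeasure_distr[OF deFinetti_map_measurable[OF m] X])
  also have "\<dots> = ennreal (real (card (?E \<inter> ?T -` X)) / real (card ?E))"
    using m n by (simp add: measure_pmf.emeasure_eq_measure measure_pmf_of_set ext_maps_nonempty)
  also have "real (card (?E \<inter> ?T -` X)) = (\<Sum>f\<in>?E. indicator X (lin F S m n f x))"
  proof -
    have "?E \<inter> ?T -` X = {f \<in> ?E. lin F S m n f x \<in> X}" by auto
    then show ?thesis by (simp add: indicator_def sum.If_cases Int_def)
  qed
  finally show ?thesis by (simp add: rand_avg_def avg_def)
qed

text \<open>Permutations and adjoint embeddings both come from balanced index maps, so invariance
  and projectivity of the laws need only this one computation.\<close>

lemma distr_deFinetti_law:
  assumes j: "balanced (opposite S) M m j" and pos: "m > 0" "M > 0"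
  shows "distr (deFinetti_law F S \<Omega> n x M) (deFinetti_law F S \<Omega> n x m) (lin F S m M j) =
    deFinetti_law F S \<Omega> n x m" (is "?lhs = ?rhs")
proof (rule measure_eqI)
  fix X assume "X \<in> sets ?lhs"
  then have X: "X \<in> sets (restrict_space borel (\<Omega> m))" by (simp add: sets_deFinetti_law)
  have into: "lin F S m M j y \<in> \<Omega> m" if "y \<in> \<Omega> M" for y
    using lin_in_feasible[OF c balanced_index_maps(2)[OF j] pos that] .
  have meas: "lin F S m M j \<in> measurable (restrict_space borel (\<Omega> M)) (restrict_space borel (\<Omega> m))"
    using into by (rule lin_measurable)
  have pre: "lin F S m M j -` X \<inter> \<Omega> M \<in> sets (restrict_space borel (\<Omega> M))"
    using measurable_sets[OF meas X] by (simp add: space_restrict_space)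
  have "emeasure ?lhs X = emeasure (deFinetti_law F S \<Omega> n x M) (lin F S m M j -` X \<inter> \<Omega> M)"
    using meas X
    by (subst emeasure_distr) (simp_all add: space_deFinetti_law sets_deFinetti_law
        measurable_cong_sets[OF sets_deFinetti_law sets_deFinetti_law])
  also have "\<dots> = ennreal (rand_avg F S M n (indicator (lin F S m M j -` X \<inter> \<Omega> M)) x)"
    by (rule emeasure_deFinetti_law[OF pos(2) pre])
  also have "rand_avg F S M n (indicator (lin F S m M j -` X \<inter> \<Omega> M)) x =
      rand_avg F S M n (\<lambda>y. indicator X (lin F S m M j y)) x"
    unfolding rand_avg_def
  proof (rule avg_cong[OF refl])
    fix f assume "f \<in> ext_maps S M n"
    then have "lin F S M n f x \<in> \<Omega> M"
      using lin_in_feasible[OF c ext_maps_subset pos(2) n x] by blast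
    then show "indicator (lin F S m M j -` X \<inter> \<Omega> M) (lin F S M n f x) =
        (indicator X (lin F S m M j (lin F S M n f x)) :: real)"
      by (simp add: indicator_def)
  qed
  also have "\<dots> = rand_avg F S m n (indicator X) x"
    by (rule rand_avg_left[OF j pos(1) n pos(2)])
  also have "ennreal (rand_avg F S m n (indicator X) x) = emeasure ?rhs X"
    by (rule emeasure_deFinetti_law[OF pos(1) X, symmetric])
  finally show "emeasure ?lhs X = emeasure ?rhs X" .
qed simp

lemma deFinetti_law_free: "deFinetti_law F S \<Omega> n x \<in> free_measures F (opposite S) \<Omega>"
  unfolding free_measures_def
proof (intro CollectI conjI allI impI)
  show "prob_space (deFinetti_law F S \<Omega> n x m)" if "m > 0" for m
    using that by (rule prob_space_deFinetti_law)
  show "sets (deFinetti_law F S \<Omega> n x m) = sets (restrict_space borel (\<Omega> m))" for m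
    by (rule sets_deFinetti_law)
  show "distr (deFinetti_law F S \<Omega> n x m) (deFinetti_law F S \<Omega> n x m) (act F m \<sigma>) =
      deFinetti_law F S \<Omega> n x m" if m: "m > 0" and \<sigma>: "\<sigma> permutes {..<m}" for m \<sigma>
  proof -
    have "act F m \<sigma> = lin F S m m (perm_map S \<sigma>)" by (rule ext) (rule act_eq[OF \<sigma>])
    then show ?thesis
      using distr_deFinetti_law[OF balanced_permutes[OF permutes_perm_map[OF \<sigma>]] m m] by simp
  qed
  show "distr (deFinetti_law F S \<Omega> n x M) (deFinetti_law F S \<Omega> n x m) (embed_adj F (opposite S) m M) =
      deFinetti_law F S \<Omega> n x m" if mM: "index_le (opposite S) m M" for m M
  proof -
    have "embed_adj F (opposite S) m M = lin F S m M (embed_map (opposite S) m M)"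
      by (rule ext) (rule embed_adj_eq[OF mM])
    then show ?thesis
      using distr_deFinetti_law[OF balanced_embed_map[OF mM]] index_le_pos[OF mM] by simp
  qed
qed

lemma integral_deFinetti_law:
  assumes m: "m > 0"
  shows "(\<integral>y. peval q y \<partial>deFinetti_law F S \<Omega> n x m) = rand_avg F S m n (peval q) x"
proof -
  let ?E = "ext_maps S m n"
  let ?T = "\<lambda>f. if f \<in> ?E then lin F S m n f x else (SOME y. y \<in> \<Omega> m)"
  have "peval q \<in> borel_measurable (restrict_space borel (\<Omega> m))"
    by (intro measurable_restrict_space1 borel_measurable_continuous_onI continuous_on_peval)
  then have "(\<integral>y. peval q y \<partial>deFinetti_law F S \<Omega> n x m) =
      measure_pmf.expectation (pmf_of_set ?E) (\<lambda>f. peval q (?T f))"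
    unfolding deFinetti_law_def by (rule integral_distr[OF deFinetti_map_measurable[OF m]])
  also have "\<dots> = (\<Sum>f\<in>?E. peval q (?T f)) / card ?E"
    using m n by (simp add: integral_pmf_of_set ext_maps_nonempty)
  also have "(\<Sum>f\<in>?E. peval q (?T f)) = (\<Sum>f\<in>?E. peval q (lin F S m n f x))"
    by (rule sum.cong[OF refl]) simp
  finally show ?thesis by (simp add: rand_avg_def avg_def)
qed

end

text \<open>Integrate the symmetrization against \<open>\<mu> n\<close>: by invariance and
  projectivity every summand has the integral of \<open>q\<close> under \<open>\<mu> k\<close>,
  while pointwise on \<open>\<Omega> n\<close> the symmetrization is at least
  \<open>lower_val\<close>.\<close>

lemma lower_val_le_integral:
  assumes c: "FinSet_compatible F S (opposite S) \<Omega>" and \<mu>: "\<mu> \<in> free_measures F (opposite S) \<Omega>"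
    and kn: "index_le (opposite S) k n" and comp: "compact (\<Omega> k)" and ne: "\<Omega> n \<noteq> {}"
  shows "lower_val F (opposite S) \<Omega> k q n \<le> ereal (\<integral>x. peval q x \<partial>\<mu> k)"
proof -
  have pos: "k > 0" "n > 0" using index_le_pos[OF kn] by auto
  interpret prob_space "\<mu> n" using \<mu> pos by (simp add: free_measures_def)
  have sets: "sets (\<mu> m) = sets (restrict_space borel (\<Omega> m))" if "m > 0" for m
    using \<mu> that by (simp add: free_measures_def)
  have space: "space (\<mu> m) = \<Omega> m" if "m > 0" for m
    using sets_eq_imp_space_eq[OF sets[OF that]] by (simp add: space_restrict_space)
  have meas: "lin F S m l f \<in> measurable (\<mu> l) (\<mu> m)"
    if "f \<in> index_maps S m l" "m > 0" "l > 0" for m l f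
    using lin_measurable[of "\<Omega> l" F S m l f "\<Omega> m"] lin_in_feasible[OF c that]
    by (simp add: measurable_cong_sets[OF sets[OF that(3)] sets[OF that(2)]])
  have qmeas: "peval q \<in> borel_measurable (\<mu> k)"
    using measurable_restrict_space1[OF borel_measurable_continuous_onI[OF continuous_on_peval]]
    by (simp add: measurable_cong_sets[OF sets[OF pos(1)] refl])
  let ?h = "\<lambda>\<sigma>. lin F S k n (sym_map S k n \<sigma>)" and ?I = "\<integral>x. peval q x \<partial>\<mu> k"
  have hmaps: "sym_map S k n \<sigma> \<in> index_maps S k n" if "\<sigma> \<in> perms n" for \<sigma>
    using that by (intro balanced_index_maps(2) balanced_sym_map[OF kn]) simp
  have hmeas: "(\<lambda>y. peval q (?h \<sigma> y)) \<in> borel_measurable (\<mu> n)" if "\<sigma> \<in> perms n" for \<sigma>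
    using measurable_comp[OF meas[OF hmaps[OF that] pos] qmeas] by (simp add: o_def)
  obtain B where B: "\<And>y. y \<in> \<Omega> k \<Longrightarrow> \<bar>peval q y\<bar> \<le> B"
    using peval_bounded_on_compact[OF comp] by blast
  have int: "integrable (\<mu> n) (\<lambda>y. peval q (?h \<sigma> y))" if "\<sigma> \<in> perms n" for \<sigma>
  proof (rule integrable_const_bound[where B = B])
    show "AE y in \<mu> n. norm (peval q (?h \<sigma> y)) \<le> B"
      using lin_in_feasible[OF c hmaps[OF that] pos] by (intro AE_I2) (simp add: space[OF pos(2)] B)
  qed (rule hmeas[OF that])
  have val: "(\<integral>y. peval q (?h \<sigma> y) \<partial>\<mu> n) = ?I" if "\<sigma> \<in> perms n" for \<sigma>
  proof -
    have \<sigma>: "\<sigma> permutes {..<n}" using that by simp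
    let ?e = "embed_adj F (opposite S) k n"
    have e: "?e = lin F S k n (embed_map (opposite S) k n)"
      by (rule ext) (rule embed_adj_eq[OF kn])
    have a: "act F n \<sigma> = lin F S n n (perm_map S \<sigma>)" by (rule ext) (rule act_eq[OF \<sigma>])
    have emeas: "?e \<in> measurable (\<mu> n) (\<mu> k)"
      unfolding e using pos by (intro meas balanced_index_maps(2) balanced_embed_map kn)
    have ameas: "act F n \<sigma> \<in> measurable (\<mu> n) (\<mu> n)"
      unfolding a using pos \<sigma> by (intro meas balanced_index_maps(1) balanced_permutes permutes_perm_map)
    have "?I = (\<integral>y. peval q y \<partial>distr (\<mu> n) (\<mu> k) ?e)"
      using \<mu> kn by (simp add: free_measures_def)
    also have "\<dots> = (\<integral>y. peval q (?e y) \<partial>\<mu> n)"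
      by (rule integral_distr[OF emeas qmeas])
    also have "\<dots> = (\<integral>y. peval q (?e y) \<partial>distr (\<mu> n) (\<mu> n) (act F n \<sigma>))"
      using \<mu> pos \<sigma> by (simp add: free_measures_def)
    also have "\<dots> = (\<integral>y. peval q (?e (act F n \<sigma> y)) \<partial>\<mu> n)"
      using measurable_comp[OF emeas qmeas] by (intro integral_distr[OF ameas]) (simp add: o_def)
    finally show ?thesis by (simp only: embed_adj_act_eq[OF kn \<sigma>])
  qed
  have sum: "has_bochner_integral (\<mu> n) (\<lambda>y. \<Sum>\<sigma>\<in>perms n. peval q (?h \<sigma> y)) (\<Sum>\<sigma>\<in>perms n. ?I)"
    using int val by (intro has_bochner_integral_sum) (metis has_bochner_integral_integrable)
  then have "has_bochner_integral (\<mu> n) (sym_avg F S k n (peval q)) ?I"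
    unfolding sym_avg_def[abs_def] avg_def
    using has_bochner_integral_divide_zero[OF sum, of "real (card (perms n))"]
    by (simp add: card_perms)
  then have sym: "integrable (\<mu> n) (sym_avg F S k n (peval q))"
    "(\<integral>y. sym_avg F S k n (peval q) y \<partial>\<mu> n) = ?I"
    by (auto simp: has_bochner_integral_iff)
  let ?l = "lower_val F (opposite S) \<Omega> k q n"
  have le: "?l \<le> ereal (sym_avg F S k n (peval q) y)" if "y \<in> \<Omega> n" for y
    unfolding lower_val_def free_sym_eq[OF kn] using that by (rule INF_lower)
  show ?thesis
  \<comment> \<open>Minus infinity satisfies the inequality trivially, and a point of
    \<open>\<Omega> n\<close> excludes plus infinity.\<close>
  proof (cases ?l)
    case (real r)
    then have "r \<le> (\<integral>y. sym_avg F S k n (peval q) y \<partial>\<mu> n)"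
      using le by (intro integral_ge_const[OF sym(1)] AE_I2) (simp add: space[OF pos(2)])
    then show ?thesis by (simp add: real sym(2))
  next
    case PInf
    then show ?thesis using le ne by fastforce
  qed simp
qed

theorem theorem5p2:
  fixes F :: construction and U L :: base_seq and D d :: nat
    and \<Omega> :: "nat \<Rightarrow> coord_vec set" and p :: "nat \<Rightarrow> coord_poly"
  assumes pair: "FinSet_pair F U L D"
    and compat: "FinSet_compatible F U L \<Omega>"
    and comp: "\<And>n. n > 0 \<Longrightarrow> compact (\<Omega> n)"
    and semialg: "\<And>n. n > 0 \<Longrightarrow> semialgebraic F n (\<Omega> n)"
    and nonempty: "\<And>n. n > 0 \<Longrightarrow> \<Omega> n \<noteq> {}"
    and free: "p \<in> free_polys F U d"
    and bounded: "U = ZeroPad \<Longrightarrow> radius F \<Omega> < \<infinity>"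
  shows
    "(\<forall>k>0. k \<ge> d * D \<longrightarrow> (\<exists>q. dual_cost F U d p k q)) \<and>
     (\<forall>k1>0. \<forall>k2>0. \<forall>q1 q2 n.
        k1 \<ge> d * D \<and> k2 \<ge> d * D \<and> dual_cost F U d p k1 q1 \<and> dual_cost F U d p k2 q2 \<and>
        index_le L k1 n \<and> index_le L k2 n \<longrightarrow>
        (\<forall>x\<in>space_of F n. free_sym F L k1 n q1 x = free_sym F L k2 n q2 x)) \<and>
     (\<forall>k>0. \<forall>q. k \<ge> d * D \<and> dual_cost F U d p k q \<longrightarrow>
        upper_lim \<Omega> p =
          (INF \<mu>\<in>free_measures F L \<Omega>. ereal (\<integral>x. peval q x \<partial>\<mu> k)) \<and>
        (\<forall>n N. index_le L k n \<and> index_le L n N \<longrightarrow>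
           lower_val F L \<Omega> k q n \<le> lower_val F L \<Omega> k q N \<and>
           lower_val F L \<Omega> k q N \<le> upper_lim \<Omega> p) \<and>
        (SUP n\<in>{n. index_le L k n}. lower_val F L \<Omega> k q n) = upper_lim \<Omega> p \<and>
        (U = Dupl \<longrightarrow> (\<forall>n\<ge>k.
           upper_val \<Omega> p n - lower_val F L \<Omega> k q n
             \<le> ereal (real k * (real k - 1) / real n) * (SUP x\<in>\<Omega> k. ereal \<bar>peval q x\<bar>))) \<and>
        (U = ZeroPad \<longrightarrow> (\<forall>n>0. k dvd n \<longrightarrow>
           upper_val \<Omega> p n - lower_val F L \<Omega> k q n
             \<le> ereal (real d * (real d + 1) * real D * (real d * real D - 1) / real n
                       * coeff_norm q) * (max 1 (radius F \<Omega>)) ^ d)))"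
proof -
  have L: "L = opposite U" and D: "D = deg F"
    using pair by (auto simp: FinSet_pair_def)
  note c = compat[unfolded L]
  have sup: "(SUP n\<in>{n. index_le (opposite U) k n}. lower_val F (opposite U) \<Omega> k q n) = upper_lim \<Omega> p"
    if k: "k > 0" and q: "dual_cost F U d p k q" for k q
    using c q k comp nonempty bounded by (rule SUP_lower_val)
  have opt_val: "upper_lim \<Omega> p = (INF \<mu>\<in>free_measures F L \<Omega>. ereal (\<integral>x. peval q x \<partial>\<mu> k))"
    if k: "k > 0" and q: "dual_cost F U d p k q" for k q
  proof (rule antisym)
    show "upper_lim \<Omega> p \<le> (INF \<mu>\<in>free_measures F L \<Omega>. ereal (\<integral>x. peval q x \<partial>\<mu> k))"
      unfolding L sup[OF k q, symmetric]
    proof (intro INF_greatest SUP_least)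
      fix \<mu> n assume \<mu>: "\<mu> \<in> free_measures F (opposite U) \<Omega>" and "n \<in> {n. index_le (opposite U) k n}"
      then have kn: "index_le (opposite U) k n" by simp
      then show "lower_val F (opposite U) \<Omega> k q n \<le> ereal (\<integral>x. peval q x \<partial>\<mu> k)"
        using lower_val_le_integral[OF c \<mu> kn comp[OF k] nonempty] index_le_pos[OF kn] by blast
    qed
    show "(INF \<mu>\<in>free_measures F L \<Omega>. ereal (\<integral>x. peval q x \<partial>\<mu> k)) \<le> upper_lim \<Omega> p"
      unfolding upper_lim_def upper_val_def L
    proof (intro INF_greatest)
      fix n x assume "n \<in> {0<..}" and x: "x \<in> \<Omega> n"
      then have n: "n > 0" by simp
      have "(\<integral>y. peval q y \<partial>deFinetti_law F U \<Omega> n x k) = peval (p n) x"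
        using q n FinSet_compatible_space[OF c n x]
        by (simp add: integral_deFinetti_law[OF c n x nonempty k] dual_cost_iff[OF k])
      then show "(INF \<mu>\<in>free_measures F (opposite U) \<Omega>. ereal (\<integral>x. peval q x \<partial>\<mu> k)) \<le> ereal (peval (p n) x)"
        using deFinetti_law_free[OF c n x nonempty] by (intro INF_lower2) auto
    qed
  qed
  have rate_Dupl: "upper_val \<Omega> p n - lower_val F L \<Omega> k q n
      \<le> ereal (real k * (real k - 1) / real n) * (SUP x\<in>\<Omega> k. ereal \<bar>peval q x\<bar>)"
    if k: "k > 0" and q: "dual_cost F U d p k q" and U: "U = Dupl" and kn: "k \<le> n" for k q n
  proof -
    let ?s = "SUP x\<in>\<Omega> k. ereal \<bar>peval q x\<bar>"
    obtain B where B: "\<And>y. y \<in> \<Omega> k \<Longrightarrow> \<bar>peval q y\<bar> \<le> B"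
      using peval_bounded_on_compact[OF comp[OF k]] by blast
    have le: "ereal \<bar>peval q y\<bar> \<le> ?s" if "y \<in> \<Omega> k" for y
      using that by (rule SUP_upper)
    \<comment> \<open>Boundedness on the compact \<open>\<Omega> k\<close> and nonemptiness make the
      supremum a real number, so the product of extended reals is one of reals.\<close>
    have "?s \<le> ereal B" by (rule SUP_least) (simp add: B)
    moreover have "0 \<le> ?s"
      using le nonempty[OF k] by (metis abs_ge_zero all_not_in_conv ereal_less_eq(5) order_trans)
    ultimately obtain M where M: "?s = ereal M" by (cases ?s) auto
    have n: "n > 0" "index_le (opposite U) k n" using k kn by (simp_all add: U)
    have "upper_val \<Omega> p n - lower_val F (opposite U) \<Omega> k q n \<le> ereal (real k * (real k - 1) / real n * M)"
    proof (rule upper_val_minus_lower_val(1)[where \<Omega> = \<Omega> and n = n, OF comp[OF n(1)] nonempty[OF n(1)] n(2)])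
      fix x assume x: "x \<in> \<Omega> n"
      have M': "\<bar>peval q y\<bar> \<le> M" if "y \<in> \<Omega> k" for y
        using le[OF that] by (simp add: M)
      have "FinSet_compatible F Dupl ZeroPad \<Omega>" using c by (simp add: U)
      from dual_cost_minus_sym_Dupl[OF this q[unfolded U] k kn x M']
      show "peval (p n) x - sym_avg F U k n (peval q) x \<le> real k * (real k - 1) / real n * M"
        unfolding U .
    qed
    then show ?thesis unfolding L M times_ereal.simps .
  qed
  have rate_ZeroPad: "upper_val \<Omega> p n - lower_val F L \<Omega> k q n
      \<le> ereal (real d * (real d + 1) * real D * (real d * real D - 1) / real n * coeff_norm q) *
        (max 1 (radius F \<Omega>)) ^ d"
    if k: "k > 0" and q: "dual_cost F U d p k q" and U: "U = ZeroPad" and n: "n > 0" "k dvd n" for k q n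
  proof -
    have "\<exists>R. radius F \<Omega> = ereal R \<and> (\<forall>n>0. \<forall>x\<in>\<Omega> n. norm1 F n x \<le> R)"
      using bounded[OF U] nonempty by (rule radius_bound)
    then obtain R where R: "radius F \<Omega> = ereal R" "\<forall>n>0. \<forall>x\<in>\<Omega> n. norm1 F n x \<le> R"
      by blast
    have pow: "max 1 (radius F \<Omega>) ^ d = ereal (max 1 R ^ d)"
      by (simp add: R(1) max_def)
    have kn: "index_le (opposite U) k n" using k n by (simp add: U)
    have "upper_val \<Omega> p n - lower_val F (opposite U) \<Omega> k q n \<le>
        ereal (real d * (real d + 1) * real D * (real d * real D - 1) / real n * coeff_norm q * max 1 R ^ d)"
    proof (rule upper_val_minus_lower_val(1)[where \<Omega> = \<Omega> and n = n, OF comp[OF n(1)] nonempty[OF n(1)] kn])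
      fix x assume x: "x \<in> \<Omega> n"
      show "peval (p n) x - sym_avg F U k n (peval q) x \<le>
          real d * (real d + 1) * real D * (real d * real D - 1) / real n * coeff_norm q * max 1 R ^ d"
      proof -
        have "FinSet_compatible F ZeroPad Dupl \<Omega>" using c by (simp add: U)
        from dual_cost_minus_sym_ZeroPad[OF this q[unfolded U] k n x R(2)[rule_format, OF n(1) x]]
        show ?thesis unfolding U D .
      qed
    qed
    then show ?thesis unfolding L pow times_ereal.simps .
  qed
  show ?thesis
  proof (intro conjI allI impI ballI)
    fix k assume "0 < k" "d * D \<le> k"
    then show "\<exists>q. dual_cost F U d p k q"
      using dual_cost_exists[OF free] by (simp add: D)
  next
    fix k1 k2 q1 q2 n x
    assume *: "d * D \<le> k1 \<and> d * D \<le> k2 \<and> dual_cost F U d p k1 q1 \<and> dual_cost F U d p k2 q2 \<and>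
        index_le L k1 n \<and> index_le L k2 n" and x: "x \<in> space_of F n"
    then show "free_sym F L k1 n q1 x = free_sym F L k2 n q2 x"
      unfolding L by (intro free_sym_unique[OF _ _ _ _ x]) auto
  next
    fix k q assume k: "0 < k" and "d * D \<le> k \<and> dual_cost F U d p k q"
    then have q: "dual_cost F U d p k q" by simp
    show "upper_lim \<Omega> p = (INF \<mu>\<in>free_measures F L \<Omega>. ereal (\<integral>x. peval q x \<partial>\<mu> k))"
      using k q by (rule opt_val)
    show "lower_val F L \<Omega> k q n \<le> lower_val F L \<Omega> k q N"
      if "index_le L k n \<and> index_le L n N" for n N
      using that unfolding L by (intro lower_val_mono[OF c]) auto
    show "lower_val F L \<Omega> k q N \<le> upper_lim \<Omega> p"
      if "index_le L k n \<and> index_le L n N" for n N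
    proof -
      have "index_le L k N" using that by (cases L) (auto intro: dvd_trans)
      then show ?thesis unfolding L by (rule lower_val_le_upper_lim[OF c _ q])
    qed
    show "(SUP n\<in>{n. index_le L k n}. lower_val F L \<Omega> k q n) = upper_lim \<Omega> p"
      unfolding L using k q by (rule sup)
    show "upper_val \<Omega> p n - lower_val F L \<Omega> k q n
        \<le> ereal (real k * (real k - 1) / real n) * (SUP x\<in>\<Omega> k. ereal \<bar>peval q x\<bar>)"
      if "U = Dupl" "k \<le> n" for n
      using k q that by (rule rate_Dupl)
    show "upper_val \<Omega> p n - lower_val F L \<Omega> k q n
        \<le> ereal (real d * (real d + 1) * real D * (real d * real D - 1) / real n * coeff_norm q) *
          (max 1 (radius F \<Omega>)) ^ d"
      if "U = ZeroPad" "0 < n" "k dvd n" for n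
      using k q that by (rule rate_ZeroPad)
  qed
qed

end
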